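(* For $m\in\mathbb{N}_0=\{0,1,2,\dots\}$ let $M_m=2^{2^m}$, and for integers $n\ge1$ define $\eta_1=0$ and, for $n\ge2$, $$\eta_n=\begin{cases}(-1)^n&\text{if }M_{2N}\le n<M_{2N+1}\text{ for some }N\in\mathbb{N}_0,\\ 0&\text{if }M_{2N+1}\le n<M_{2N+2}\text{ for some }N\in\mathbb{N}_0.\end{cases}$$ Let $a_n=1+\eta_n$ and let $f(s)=\sum_{n=1}^\infty a_nn^{-s}$ for $\operatorname{Re}s>1$, extended by analytic continuation to $\operatorname{Re}s>0$, $s\ne1$. Then, for every $0<\sigma<\frac12$, $$\frac1{T^{2-2\sigma}}\int_0^T|f(\sigma+it)|^2\,dt$$ does not converge as $T\to\infty$.
   Context: The partial sums $\sum_{n\le x}\eta_n$ take only the values $0$ and $1$, so $\sum_{n\le x}a_n=x+O(1)$ and $f(s)-1/(s-1)$ has an analytic continuation to $\operatorname{Re}s>0$; $f$ denotes the continued function. *)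

theory Defs
  imports "HOL-Complex_Analysis.Complex_Analysis"
begin

definition M :: "nat \<Rightarrow> nat"
  where "M m = 2 ^ (2 ^ m)"

text \<open>
  As \<open>M 0 = 2\<close>, the \<open>else\<close> branch gives the value 0 both at \<open>n = 1\<close> and on the blocks
  \<open>M (2 * N + 1) \<le> n < M (2 * N + 2)\<close>.  The value at \<open>n = 0\<close> is never used.
\<close>

definition eta :: "nat \<Rightarrow> real"
  where "eta n = (if \<exists>N. M (2 * N) \<le> n \<and> n < M (2 * N + 1) then (-1) ^ n else 0)"

definition a_coeff :: "nat \<Rightarrow> real"
  where "a_coeff n = 1 + eta n"

definition is_continuation :: "(complex \<Rightarrow> complex) \<Rightarrow> bool"
  where "is_continuation g \<longleftrightarrow>
    g holomorphic_on ({s. Re s > 0} - {1}) \<and>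
    (\<forall>s. Re s > 1 \<longrightarrow>
      (\<lambda>n. of_real (a_coeff (Suc n)) * of_nat (Suc n) powr (- s)) sums g s)"

text \<open>
  The choice is legitimate: a continuation exists (\<open>is_continuation_dirichlet_f\<close> below), and
  its values on the punctured half-plane are uniquely determined (\<open>is_continuation_unique\<close>).
  Values of \<open>dirichlet_f\<close> elsewhere are irrelevant.
\<close>

definition dirichlet_f :: "complex \<Rightarrow> complex"
  where "dirichlet_f = (SOME g. is_continuation g)"

lemma is_continuation_unique:
  assumes g: "is_continuation g" and h: "is_continuation h"
    and s: "Re s > 0" "s \<noteq> 1"
  shows "g s = h s"
proof -
  define S where "S = {s. Re s > 0} - {1 :: complex}"
  have oS: "open S"
    unfolding S_def by (intro open_Diff open_halfspace_Re_gt) auto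
  have cS: "connected S"
    unfolding S_def
    by (intro connected_open_delete open_halfspace_Re_gt convex_connected convex_halfspace_Re_gt) simp
  show ?thesis
  proof (rule analytic_continuation_open[of "{s. Re s > 1}" S g h])
    show "open {s. Re s > (1::real)}" by (rule open_halfspace_Re_gt)
    show "{s. Re s > 1} \<noteq> {}" by (auto intro!: exI[of _ 2])
    show "{s. Re s > 1} \<subseteq> S" unfolding S_def by auto
    show "g holomorphic_on S" "h holomorphic_on S"
      using g h unfolding is_continuation_def S_def by auto
    show "s \<in> S" using s by (simp add: S_def)
    show "g z = h z" if "z \<in> {s. Re s > 1}" for z
      using g h that unfolding is_continuation_def by (auto intro: sums_unique2)
  qed (use oS cS in auto)
qed

definition eta_sum :: "nat \<Rightarrow> real"
  where "eta_sum n = (\<Sum>k<n. eta (Suc k))"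

lemma even_M: "even (M m)"
  by (simp add: M_def)

lemma eta_sum_eq:
  "eta_sum n = (if (\<exists>N. M (2 * N) \<le> n \<and> n < M (2 * N + 1)) \<and> even n then 1 else 0)"
proof (induction n)
  case 0
  have "\<not> (\<exists>N. M (2 * N) \<le> 0)" by (auto simp: M_def)
  then show ?case by (auto simp: eta_sum_def)
next
  case (Suc n)
  define P where "P = (\<lambda>n. \<exists>N. M (2 * N) \<le> n \<and> n < M (2 * N + 1))"
  have ev: "even (Suc n)" if ne: "P n \<noteq> P (Suc n)"
  proof (cases "P n")
    case True
    then obtain N where N: "M (2 * N) \<le> n" "n < M (2 * N + 1)" by (auto simp: P_def)
    have "\<not> Suc n < M (2 * N + 1)"
      using ne True N by (metis P_def le_Suc_eq)
    then have "Suc n = M (2 * N + 1)" using N by linarith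
    then show ?thesis using even_M by metis
  next
    case False
    then obtain N where N: "M (2 * N) \<le> Suc n" "Suc n < M (2 * N + 1)"
      using ne unfolding P_def by blast
    have "\<not> M (2 * N) \<le> n"
      using False N by (metis P_def Suc_lessD)
    then have "Suc n = M (2 * N)" using N by linarith
    then show ?thesis using even_M by metis
  qed
  have "eta_sum (Suc n) = eta_sum n + eta (Suc n)"
    by (simp add: eta_sum_def)
  also have "\<dots> = (if P n \<and> even n then 1 else 0) + (if P (Suc n) then (-1) ^ Suc n else 0)"
    using Suc.IH unfolding P_def eta_def by simp
  also have "\<dots> = (if P (Suc n) \<and> even (Suc n) then 1 else 0)"
    using ev by (cases "P n"; cases "P (Suc n)"; cases "even n") auto
  finally show ?case unfolding P_def .
qed

lemma eta_sum_cases: "eta_sum n = 0 \<or> eta_sum n = 1"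
  by (simp add: eta_sum_eq)

text \<open>
  Summand of the series for the continuation minus \<open>1 / (s - 1)\<close>: the first part comes from
  summing \<open>eta n * n powr (- s)\<close> by parts, the second is \<open>n powr (- s)\<close> minus the integral of
  \<open>x powr (- s)\<close> over \<open>{n..n + 1}\<close>, with \<open>n = Suc k\<close>.
\<close>

definition cont_term :: "nat \<Rightarrow> complex \<Rightarrow> complex"
  where "cont_term k s =
    of_real (eta_sum (Suc k)) * (of_nat (Suc k) powr (- s) - of_nat (Suc (Suc k)) powr (- s))
    + (of_nat (Suc k) powr (- s)
       - (of_nat (Suc (Suc k)) powr (1 - s) - of_nat (Suc k) powr (1 - s)) / (1 - s))"

lemma dirichlet_partial_sum:
  assumes "s \<noteq> 1"
  shows "(\<Sum>k<n. of_real (a_coeff (Suc k)) * of_nat (Suc k) powr (- s)) =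
    (\<Sum>k<n. cont_term k s) + of_real (eta_sum n) * of_nat (Suc n) powr (- s)
    + of_nat (Suc n) powr (1 - s) / (1 - s) + 1 / (s - 1)"
proof (induction n)
  case 0
  have "1 - s \<noteq> 0" "s - 1 \<noteq> 0" using assms by auto
  then show ?case by (simp add: eta_sum_def field_simps)
next
  case (Suc n)
  have e: "eta_sum (Suc n) = eta_sum n + eta (Suc n)" by (simp add: eta_sum_def)
  show ?case
    unfolding sum.lessThan_Suc Suc.IH cont_term_def[of n s] a_coeff_def[of "Suc n"] e
    by (simp add: algebra_simps diff_divide_distrib del: of_nat_Suc)
qed

lemma powr_diff_bound:
  fixes s :: complex and n x :: real
  assumes s: "Re s > 0" and n: "n \<ge> 1" and x: "n \<le> x" "x \<le> n + 1"
  shows "norm (of_real x powr (- s) - of_real n powr (- s)) \<le> norm s * n powr (- Re s - 1)"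
proof -
  define C where "C = closed_segment (of_real n) (of_real x :: complex)"
  have C: "\<exists>y. z = of_real y \<and> n \<le> y \<and> y \<le> x" if "z \<in> C" for z
    using that x unfolding C_def closed_segment_of_real
    by (auto simp: closed_segment_eq_real_ivl)
  have "norm (of_real x powr (- s) - of_real n powr (- s))
      \<le> (norm s * n powr (- Re s - 1)) * norm (of_real x - of_real n :: complex)"
  proof (rule field_differentiable_bound[where S = C and f' = "\<lambda>z. - s * z powr (- s - 1)"])
    show "convex C" by (simp add: C_def)
    show "of_real x \<in> C" "of_real n \<in> C" by (auto simp: C_def)
    fix z assume "z \<in> C"
    then obtain y where y: "z = of_real y" "n \<le> y" "y \<le> x" using C by blast
    have "z \<notin> \<real>\<^sub>\<le>\<^sub>0" using y n by simp
    then show "((\<lambda>z. z powr (- s)) has_field_derivative - s * z powr (- s - 1)) (at z within C)"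
      by (rule has_field_derivative_at_within[OF has_field_derivative_powr])
    have "norm (z powr (- s - 1)) = y powr (- Re s - 1)"
      using y n by (simp add: norm_powr_real_powr)
    also have "\<dots> \<le> n powr (- Re s - 1)"
      using y n s by (intro powr_mono2') auto
    finally show "norm (- s * z powr (- s - 1)) \<le> norm s * n powr (- Re s - 1)"
      by (simp add: norm_mult mult_left_mono)
  qed
  also have "norm (of_real x - of_real n :: complex) \<le> 1"
    using x by (metis abs_of_nonneg add.commute diff_ge_0_iff_ge diff_le_eq norm_of_real of_real_diff)
  then have "(norm s * n powr (- Re s - 1)) * norm (of_real x - of_real n :: complex)
      \<le> norm s * n powr (- Re s - 1)"
    by (intro mult_right_le_one_le) auto
  finally show ?thesis .
qed

lemma powr_integral_bound:
  fixes s :: complex and n :: real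
  assumes s: "Re s > 0" "s \<noteq> 1" and n: "n \<ge> 1"
  shows "norm (of_real n powr (- s)
      - (of_real (n + 1) powr (1 - s) - of_real n powr (1 - s)) / (1 - s))
    \<le> norm s * n powr (- Re s - 1)"
proof -
  define C where "C = closed_segment (of_real n) (of_real (n + 1) :: complex)"
  define F where "F = (\<lambda>z. z powr (1 - s) / (1 - s) - z * of_real n powr (- s))"
  have C: "\<exists>y. z = of_real y \<and> n \<le> y \<and> y \<le> n + 1" if "z \<in> C" for z
    using that unfolding C_def closed_segment_of_real
    by (auto simp: closed_segment_eq_real_ivl)
  have "norm (F (of_real (n + 1)) - F (of_real n))
      \<le> (norm s * n powr (- Re s - 1)) * norm (of_real (n + 1) - of_real n :: complex)"
  proof (rule field_differentiable_bound
      [where S = C and f' = "\<lambda>z. z powr (- s) - of_real n powr (- s)"])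
    show "convex C" by (simp add: C_def)
    show "of_real (n + 1) \<in> C" "of_real n \<in> C" unfolding C_def by (rule ends_in_segment)+
    fix z assume "z \<in> C"
    then obtain y where y: "z = of_real y" "n \<le> y" "y \<le> n + 1" using C by blast
    have z: "z \<notin> \<real>\<^sub>\<le>\<^sub>0" using y n by simp
    have "((\<lambda>z. z powr (1 - s)) has_field_derivative (1 - s) * z powr (1 - s - 1)) (at z)"
      using z by (rule has_field_derivative_powr)
    then have "((\<lambda>z. z powr (1 - s) / (1 - s)) has_field_derivative
        (1 - s) * z powr (1 - s - 1) / (1 - s)) (at z)"
      by (rule DERIV_cdivide)
    also have "(1 - s) * z powr (1 - s - 1) / (1 - s) = z powr (- s)"
      using s by simp
    finally have "(F has_field_derivative z powr (- s) - 1 * of_real n powr (- s)) (at z)"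
      unfolding F_def by (intro DERIV_diff DERIV_cmult_right DERIV_ident)
    then show "(F has_field_derivative z powr (- s) - of_real n powr (- s)) (at z within C)"
      by (simp add: has_field_derivative_at_within)
    show "norm (z powr (- s) - of_real n powr (- s)) \<le> norm s * n powr (- Re s - 1)"
      using powr_diff_bound[of s n y] s n y by simp
  qed
  also have "F (of_real (n + 1)) - F (of_real n) =
      - (of_real n powr (- s)
      - (of_real (n + 1) powr (1 - s) - of_real n powr (1 - s)) / (1 - s))"
    by (simp add: F_def algebra_simps diff_divide_distrib)
  finally show ?thesis by (simp add: norm_minus_commute)
qed

lemma norm_cont_term_le:
  assumes s: "Re s > 0" "s \<noteq> 1"
  shows "norm (cont_term k s) \<le> 2 * norm s * real (Suc k) powr (- Re s - 1)"
proof -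
  let ?B = "norm s * real (Suc k) powr (- Re s - 1)"
  define A where "A = of_nat (Suc k) powr (- s) - of_nat (Suc (Suc k)) powr (- s :: complex)"
  have "norm A \<le> ?B"
    using powr_diff_bound[of s "real (Suc k)" "real (Suc (Suc k))"] s
    unfolding A_def by (subst norm_minus_commute) (simp add: add_ac)
  moreover have "norm (of_real (eta_sum (Suc k)) * A) \<le> norm A"
    using eta_sum_cases[of "Suc k"] by auto
  ultimately have 1: "norm (of_real (eta_sum (Suc k)) * A) \<le> ?B" by linarith
  have 2: "norm (of_nat (Suc k) powr (- s)
       - (of_nat (Suc (Suc k)) powr (1 - s) - of_nat (Suc k) powr (1 - s)) / (1 - s)) \<le> ?B"
    using powr_integral_bound[of s "real (Suc k)"] s by (simp add: add_ac)
  show ?thesis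
    unfolding cont_term_def A_def[symmetric]
    by (rule order_trans[OF norm_triangle_ineq]) (use 1 2 in linarith)
qed

lemma is_continuation_exists: "\<exists>g. is_continuation g"
proof -
  define S where "S = {s. Re s > 0} - {1 :: complex}"
  have oS: "open S"
    unfolding S_def by (intro open_Diff open_halfspace_Re_gt) auto
  obtain h where h: "\<forall>s\<in>S. (\<lambda>n. cont_term n s) sums h s \<and> h field_differentiable (at s)"
  proof (rule series_differentiable_comparison_complex[OF oS, where f = cont_term])
    fix n s assume "s \<in> S"
    then have "1 - s \<noteq> 0" by (auto simp: S_def)
    then have "cont_term n holomorphic_on S"
      unfolding cont_term_def S_def by (intro holomorphic_intros) auto
    then show "cont_term n field_differentiable (at s)"
      using oS \<open>s \<in> S\<close> holomorphic_on_imp_differentiable_at by blast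
  next
    fix s assume "s \<in> S"
    then have s: "Re s > 0" by (simp add: S_def)
    define d where "d = Re s / 2"
    define b where "b = (\<lambda>n. 2 * (norm s + d) * real (Suc n) powr (- d - 1))"
    have d: "d > 0" using s by (simp add: d_def)
    have sm: "summable (\<lambda>n. real (Suc n) powr (- d - 1))"
      using d by (subst summable_Suc_iff) (simp add: summable_real_powr_iff)
    have bound: "norm (cont_term n y) \<le> b n" if y: "y \<in> ball s d \<inter> S" for n y
    proof -
      have dist: "norm (s - y) < d" using y by (simp add: dist_norm)
      have ny: "norm y \<le> norm s + d"
        using dist norm_triangle_sub[of y s] by (simp add: norm_minus_commute)
      have "\<bar>Re (s - y)\<bar> < d" using dist abs_Re_le_cmod[of "s - y"] by linarith
      then have ry: "Re y \<ge> d" unfolding d_def minus_complex.simps by linarith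
      have "norm (cont_term n y) \<le> 2 * norm y * real (Suc n) powr (- Re y - 1)"
        using y by (intro norm_cont_term_le) (auto simp: S_def)
      also have "\<dots> \<le> b n"
        unfolding b_def using ny ry d by (intro mult_mono powr_mono) auto
      finally show ?thesis .
    qed
    show "\<exists>d h. 0 < d \<and> summable h \<and> range h \<subseteq> \<real>\<^sub>\<ge>\<^sub>0 \<and>
        (\<forall>\<^sub>F n in sequentially. \<forall>y\<in>ball s d \<inter> S. cmod (cont_term n y) \<le> cmod (h n))"
    proof (intro exI conjI)
      show "0 < d" by (rule d)
      show "summable (\<lambda>n. complex_of_real (b n))"
        unfolding b_def summable_complex_of_real by (intro summable_mult sm)
      show "range (\<lambda>n. complex_of_real (b n)) \<subseteq> \<real>\<^sub>\<ge>\<^sub>0"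
        using d by (auto simp: b_def)
      have "norm (complex_of_real (b n)) = b n" for n
        unfolding norm_of_real using d by (intro abs_of_nonneg) (simp add: b_def)
      then show "\<forall>\<^sub>F n in sequentially. \<forall>y\<in>ball s d \<inter> S.
          norm (cont_term n y) \<le> norm (complex_of_real (b n))"
        using bound by (intro always_eventually) auto
    qed
  qed blast
  define g where "g = (\<lambda>s. h s + 1 / (s - 1))"
  have "h holomorphic_on S"
    using h oS by (auto simp: holomorphic_on_open field_differentiable_def)
  then have "g holomorphic_on S"
    unfolding g_def by (intro holomorphic_intros) (auto simp: S_def)
  moreover have "(\<lambda>n. of_real (a_coeff (Suc n)) * of_nat (Suc n) powr (- s)) sums g s"
    if s: "Re s > 1" for s
  proof -
    have s1: "s \<noteq> 1" and sS: "s \<in> S" using s by (auto simp: S_def)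
    have L: "((\<lambda>n. of_nat (Suc n) powr z) \<longlonglongrightarrow> (0::complex))" if "Re z < 0" for z
    proof (rule tendsto_neg_powr_complex_of_nat)
      show "filterlim Suc sequentially sequentially" by (rule filterlim_Suc)
    qed (use that in auto)
    have E: "(\<lambda>n. of_real (eta_sum n) * of_nat (Suc n) powr (- s)) \<longlonglongrightarrow> 0"
    proof (rule Lim_null_comparison)
      show "\<forall>\<^sub>F n in sequentially. norm (of_real (eta_sum n) * of_nat (Suc n) powr (- s))
          \<le> norm (of_nat (Suc n) powr (- s))"
      proof (intro always_eventually allI)
        fix n
        show "norm (of_real (eta_sum n) * of_nat (Suc n) powr (- s))
          \<le> norm (of_nat (Suc n) powr (- s))"
          using eta_sum_cases[of n] by auto
      qed
      show "(\<lambda>n. norm (of_nat (Suc n) powr (- s))) \<longlonglongrightarrow> 0"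
        using L[of "- s"] s by (intro tendsto_norm_zero) auto
    qed
    have Z: "(\<lambda>n. of_nat (Suc n) powr (1 - s) / (1 - s)) \<longlonglongrightarrow> 0"
      using L[of "1 - s"] s by (intro tendsto_divide_zero) auto
    have "(\<lambda>n. (\<Sum>k<n. cont_term k s) + of_real (eta_sum n) * of_nat (Suc n) powr (- s)
        + of_nat (Suc n) powr (1 - s) / (1 - s) + 1 / (s - 1))
      \<longlonglongrightarrow> h s + 0 + 0 + 1 / (s - 1)"
      using h sS by (intro tendsto_add E Z tendsto_const) (auto simp: sums_def)
    then show ?thesis
      unfolding sums_def dirichlet_partial_sum[OF s1] g_def by simp
  qed
  ultimately have "is_continuation g" by (simp add: is_continuation_def S_def)
  then show ?thesis by blast
qed

lemma is_continuation_dirichlet_f: "is_continuation dirichlet_f"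
  unfolding dirichlet_f_def by (rule someI_ex[OF is_continuation_exists])

end

theory Submission
  imports Defs "HOL-Probability.Probability" "HOL-Real_Asymp.Real_Asymp"
begin

text \<open>
  Write \<open>E x\<close> (\<open>remainder\<close> below) for the sum of \<open>a n\<close> over \<open>n \<le> x\<close>, minus \<open>x\<close>. For \<open>0 < \<sigma> < 1\<close> the function
  \<open>f (\<sigma> + i t) / (\<sigma> + i t)\<close> is the Fourier transform of \<open>g u = E (exp u) * exp (- \<sigma> u)\<close>, so the
  Gaussian mean square \<open>J h\<close>, the integral of \<open>\<bar>f (\<sigma> + i t)\<bar>\<^sup>2 * exp (- (h t)\<^sup>2 / 2)\<close> over \<open>t\<close>, can be
  expressed through the increments, the integrals of \<open>(g (u + v) - g u)\<^sup>2\<close> over \<open>u\<close>.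
  If \<open>h\<close> is so small that \<open>1 / h\<close> lies deep inside one block, then \<open>E\<close> can be replaced by a
  sawtooth of period 1 or 2, and averaging over the phase shows that the increment at \<open>v\<close> is
  asymptotic to \<open>v powr (2 \<sigma>)\<close> times a positive constant. The two sawtooths are related by a
  dilation, and their constants differ by the factor \<open>4 powr (1 - \<sigma>)\<close>. Hence
  \<open>h powr (2 - 2 \<sigma>) * J h\<close> has two different limit points, whereas convergence of the given means
  would force it to converge, by an Abelian argument.
\<close>

section \<open>Gaussian mean squares and increments\<close>

text \<open>The condition \<open>s < 1 / 2\<close> decides which scale matters. A jump of
  \<open>E\<close> at \<open>n\<close> contributes about \<open>n * v * n powr (- 2 * s - 1)\<close>
  to the increment at \<open>v\<close>; for \<open>s < 1 / 2\<close> the sum over \<open>n\<close>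
  up to \<open>1 / v\<close> is dominated by \<open>n\<close> of order \<open>1 / v\<close> and has
  order \<open>v powr (2 * s)\<close>. So, to leading order, \<open>J h\<close> sees
  \<open>E\<close> only at arguments of order \<open>1 / h\<close>, and the irregular beginning
  costs a smaller power. In \<open>J h\<close> the autocorrelation of \<open>g\<close> at 0 would
  enter with order \<open>h powr (- 2)\<close>, but it is multiplied by the integral of
  \<open>std_normal_density z * (1 - z^2)\<close>, which is 0. This is why increments, and not
  correlations, give the leading term. Since \<open>M (k + 1)\<close> is the square of
  \<open>M k\<close>, the scale \<open>M k ^ 3\<close> lies between \<open>M (k + 1)\<close> and
  \<open>M (k + 2)\<close>, at ratio \<open>M k\<close> from both. A fixed window of scales around
  it is therefore eventually inside one block, and the parity of \<open>k\<close> selects the kind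
  of block.\<close>

lemma integral_std_normal_cos:
  "(\<integral>z. std_normal_density z * cos (w * z) \<partial>lborel) = exp (- w\<^sup>2 / 2)"
proof -
  have "char std_normal_distribution w = (\<integral>z. std_normal_density z *\<^sub>R iexp (w * z) \<partial>lborel)"
    unfolding char_def by (subst integral_density) auto
  then have "(\<integral>z. std_normal_density z *\<^sub>R iexp (w * z) \<partial>lborel) = of_real (exp (- w\<^sup>2 / 2))"
    by (simp add: char_std_normal_distribution)
  moreover have i: "integrable lborel (\<lambda>z. std_normal_density z *\<^sub>R iexp (w * z))"
    by (rule Bochner_Integration.integrable_bound[OF integrable_std_normal_moment[of 0]]) auto
  ultimately have "(\<integral>z. Re (std_normal_density z *\<^sub>R iexp (w * z)) \<partial>lborel) = exp (- w\<^sup>2 / 2)"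
    by (subst integral_Re) auto
  then show ?thesis
    by (simp add: Re_exp)
qed

lemma integrable_std_normal_moment_cos:
  "integrable lborel (\<lambda>z. std_normal_density z * z ^ k * cos (w * z))"
  by (rule Bochner_Integration.integrable_bound[OF integrable_std_normal_moment[of k]])
     (auto simp: abs_mult intro!: mult_left_le)

text \<open>The function \<open>F\<close> vanishes at both ends of the line, and its two terms are
  weighted so that the sine terms of its derivative cancel. What is left of the derivative relates
  this integral to the one without the square, with no differentiation under the integral.\<close>

lemma integral_std_normal_square_cos:
  "(\<integral>z. std_normal_density z * z\<^sup>2 * cos (w * z) \<partial>lborel) = (1 - w\<^sup>2) * exp (- w\<^sup>2 / 2)"
proof -
  define F where "F = (\<lambda>z. std_normal_density z * (z * cos (w * z) - w * sin (w * z)))"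
  define f where "f = (\<lambda>z. std_normal_density z * cos (w * z) * (1 - z\<^sup>2 - w\<^sup>2))"
  have f_int: "integrable lborel f"
    using Bochner_Integration.integrable_diff[OF integrable_mult_right[OF
        integrable_std_normal_moment_cos[of 0 w], of "1 - w\<^sup>2"] integrable_std_normal_moment_cos[of 2 w]]
    by (simp add: f_def algebra_simps)
  have der: "(F has_vector_derivative f z) (at z)" for z
  proof -
    have "(std_normal_density has_real_derivative - z * std_normal_density z) (at z)"
      unfolding std_normal_density_def
      by (rule derivative_eq_intros refl | simp)+
    then show ?thesis
      unfolding has_real_derivative_iff_has_vector_derivative[symmetric] F_def f_def
      by (auto intro!: derivative_eq_intros simp: algebra_simps power2_eq_square)
  qed
  have bnd: "\<bar>F z\<bar> \<le> std_normal_density z * (\<bar>z\<bar> + \<bar>w\<bar>)" for z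
  proof -
    have "\<bar>z * cos (w * z) - w * sin (w * z)\<bar> \<le> \<bar>z * cos (w * z)\<bar> + \<bar>w * sin (w * z)\<bar>"
      by linarith
    also have "\<dots> \<le> \<bar>z\<bar> + \<bar>w\<bar>"
      by (intro add_mono) (auto simp: abs_mult intro!: mult_left_le)
    finally show ?thesis by (auto simp: F_def abs_mult intro!: mult_left_mono)
  qed
  have lim: "(F \<longlongrightarrow> 0) at_top" "(F \<longlongrightarrow> 0) at_bot"
  proof -
    have "((\<lambda>z. std_normal_density z * (\<bar>z\<bar> + \<bar>w\<bar>)) \<longlongrightarrow> 0) at_top"
      unfolding std_normal_density_def by real_asymp
    then show "(F \<longlongrightarrow> 0) at_top"
      by (rule Lim_null_comparison[rotated]) (use bnd in auto)
    have "((\<lambda>z. std_normal_density z * (\<bar>z\<bar> + \<bar>w\<bar>)) \<longlongrightarrow> 0) at_bot"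
      unfolding std_normal_density_def by real_asymp
    then show "(F \<longlongrightarrow> 0) at_bot"
      by (rule Lim_null_comparison[rotated]) (use bnd in auto)
  qed
  have "(LBINT z=-\<infinity>..\<infinity>. f z) = 0 - 0"
  proof (rule interval_integral_FTC_integrable)
    show "(F has_vector_derivative f z) (at z)" for z by (rule der)
    show "isCont f z" for z
      unfolding f_def std_normal_density_def by (intro continuous_intros) auto
    show "set_integrable lborel (einterval (-\<infinity>) \<infinity>) f"
      using f_int by (simp add: set_integrable_def einterval_def)
    show "((F \<circ> real_of_ereal) \<longlongrightarrow> 0) (at_right (-\<infinity>))"
      using lim by (simp add: ereal_tendsto_simps1)
    show "((F \<circ> real_of_ereal) \<longlongrightarrow> 0) (at_left \<infinity>)"
      using lim by (simp add: ereal_tendsto_simps1)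
  qed auto
  then have "(\<integral>z. f z \<partial>lborel) = 0"
    by (simp add: interval_lebesgue_integral_def set_lebesgue_integral_def einterval_def)
  moreover have "(\<integral>z. f z \<partial>lborel) = (1 - w\<^sup>2) * exp (- w\<^sup>2 / 2) -
     (\<integral>z. std_normal_density z * z\<^sup>2 * cos (w * z) \<partial>lborel)"
  proof -
    have "(\<integral>z. f z \<partial>lborel) = (\<integral>z. (1 - w\<^sup>2) * (std_normal_density z * cos (w * z)) -
       std_normal_density z * z\<^sup>2 * cos (w * z) \<partial>lborel)"
      by (simp add: f_def algebra_simps)
    then show ?thesis
      using integrable_std_normal_moment_cos[of 0 w] integrable_std_normal_moment_cos[of 2 w]
      by (subst (asm) Bochner_Integration.integral_diff) (auto simp: integral_std_normal_cos)
  qed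
  ultimately show ?thesis by simp
qed

lemma integral_gauss_kernel_cos:
  fixes h s v :: real
  assumes h: "h > 0"
  shows "integrable lborel (\<lambda>t. (s\<^sup>2 + t\<^sup>2) * exp (- (h * t)\<^sup>2 / 2))"
    and "(\<integral>t. (s\<^sup>2 + t\<^sup>2) * exp (- (h * t)\<^sup>2 / 2) * cos (t * v) \<partial>lborel) =
      2 * pi / h * (s\<^sup>2 + (1 - (v / h)\<^sup>2) / h\<^sup>2) * std_normal_density (v / h)"
proof -
  have e: "exp (- z\<^sup>2 / 2) = sqrt (2 * pi) * std_normal_density z" for z
    by (simp add: std_normal_density_def)
  \<comment> \<open>The factor \<open>c\<close> is set to 1 for integrability and to a cosine for
    the value; the form \<open>0 + 1 / h * z\<close> matches the affine substitution rule.\<close>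
  have eq: "(s\<^sup>2 + (0 + 1 / h * z)\<^sup>2) * exp (- (h * (0 + 1 / h * z))\<^sup>2 / 2) * c =
      sqrt (2 * pi) * (s\<^sup>2 * (std_normal_density z * c) + 1 / h\<^sup>2 * (std_normal_density z * z\<^sup>2 * c))" for z c
    using h unfolding e[symmetric] std_normal_density_def by (simp add: field_simps)
  have "integrable lborel (\<lambda>z. sqrt (2 * pi) * (s\<^sup>2 * (std_normal_density z * 1) + 1 / h\<^sup>2 * (std_normal_density z * z\<^sup>2 * 1)))"
    using integrable_std_normal_moment[of 0] integrable_std_normal_moment[of 2] by simp
  then have "integrable lborel (\<lambda>z. (s\<^sup>2 + (0 + 1 / h * z)\<^sup>2) * exp (- (h * (0 + 1 / h * z))\<^sup>2 / 2))"
    unfolding eq[of _ 1, symmetric] by simp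
  then show "integrable lborel (\<lambda>t. (s\<^sup>2 + t\<^sup>2) * exp (- (h * t)\<^sup>2 / 2))"
    using lborel_integrable_real_affine_iff[of "1 / h" "\<lambda>t. (s\<^sup>2 + t\<^sup>2) * exp (- (h * t)\<^sup>2 / 2)" 0] h by simp
  have "(\<integral>t. (s\<^sup>2 + t\<^sup>2) * exp (- (h * t)\<^sup>2 / 2) * cos (t * v) \<partial>lborel) =
    \<bar>1 / h\<bar> *\<^sub>R (\<integral>z. (s\<^sup>2 + (0 + 1 / h * z)\<^sup>2) * exp (- (h * (0 + 1 / h * z))\<^sup>2 / 2) * cos ((0 + 1 / h * z) * v) \<partial>lborel)"
    using h by (intro lborel_integral_real_affine) auto
  also have "\<dots> = \<bar>1 / h\<bar> *\<^sub>R (\<integral>z. sqrt (2 * pi) * (s\<^sup>2 * (std_normal_density z * cos (v / h * z)) + 1 / h\<^sup>2 * (std_normal_density z * z\<^sup>2 * cos (v / h * z))) \<partial>lborel)"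
    unfolding eq by (simp add: mult_ac)
  also have "\<dots> = 1 / h * (sqrt (2 * pi) * (s\<^sup>2 * exp (- (v / h)\<^sup>2 / 2) + 1 / h\<^sup>2 * ((1 - (v / h)\<^sup>2) * exp (- (v / h)\<^sup>2 / 2))))"
    using integrable_std_normal_moment_cos[of 0 "v / h"] integrable_std_normal_moment_cos[of 2 "v / h"] h
    by (simp add: integral_std_normal_cos integral_std_normal_square_cos del: times_divide_eq_left)
  also have "\<dots> = 1 / h * (2 * pi * (s\<^sup>2 + (1 - (v / h)\<^sup>2) / h\<^sup>2) * std_normal_density (v / h))"
    unfolding e using h by (simp add: field_simps)
  finally show "(\<integral>t. (s\<^sup>2 + t\<^sup>2) * exp (- (h * t)\<^sup>2 / 2) * cos (t * v) \<partial>lborel) =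
      2 * pi / h * (s\<^sup>2 + (1 - (v / h)\<^sup>2) / h\<^sup>2) * std_normal_density (v / h)"
    by simp
qed

section \<open>Autocorrelation, increments and their Fourier identity\<close>

definition correlation :: "(real \<Rightarrow> real) \<Rightarrow> real \<Rightarrow> real"
  where "correlation g v = (\<integral>u. g u * g (u + v) \<partial>lborel)"

definition increment :: "(real \<Rightarrow> real) \<Rightarrow> real \<Rightarrow> real"
  where "increment g v = (\<integral>u. (g (u + v) - g u)\<^sup>2 \<partial>lborel)"

lemma integrable_shift:
  fixes g :: "real \<Rightarrow> real"
  shows "integrable lborel g \<Longrightarrow> integrable lborel (\<lambda>u. g (u + v))"
  using lborel_integrable_real_affine[of g 1 v] by (simp add: add.commute)

lemma integral_shift:
  fixes g :: "real \<Rightarrow> real"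
  shows "(\<integral>u. g (u + v) \<partial>lborel) = (\<integral>u. g u \<partial>lborel)"
  using lborel_integral_real_affine[of 1 g v] by (simp add: add.commute)

context
  fixes g :: "real \<Rightarrow> real" and B :: real
  assumes g_int: "integrable lborel g" and g_bound: "\<And>u. \<bar>g u\<bar> \<le> B"
begin

lemma borel_measurable_g: "g \<in> borel_measurable borel"
  using borel_measurable_integrable[OF g_int] by simp

lemma integrable_product_shift: "integrable lborel (\<lambda>u. g (u + w) * g (u + v))"
  supply borel_measurable_g [measurable]
proof (rule Bochner_Integration.integrable_bound[OF integrable_mult_right[OF integrable_shift[OF g_int, of w]]])
  show "AE u in lborel. norm (g (u + w) * g (u + v)) \<le> norm (B * g (u + w))"
  proof (intro AE_I2)
    fix u show "norm (g (u + w) * g (u + v)) \<le> norm (B * g (u + w))"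
      using mult_right_mono[OF g_bound[of "u + v"], of "\<bar>g (u + w)\<bar>"] g_bound[of 0]
      by (simp add: abs_mult mult.commute)
  qed
qed simp

lemma integrable_pair: "integrable (lborel \<Otimes>\<^sub>M lborel) (\<lambda>(u, v). g u * g (u + v))"
  supply borel_measurable_g [measurable]
proof (rule lborel_pair.Fubini_integrable)
  have "(\<integral>v. norm (g u * g (u + v)) \<partial>lborel) = (\<integral>v. \<bar>g v\<bar> \<partial>lborel) * \<bar>g u\<bar>" for u
    using integral_shift[of "\<lambda>v. \<bar>g v\<bar>" u] by (simp add: abs_mult add.commute)
  then show "integrable lborel (\<lambda>u. \<integral>v. norm (case (u, v) of (u, v) \<Rightarrow> g u * g (u + v)) \<partial>lborel)"
    using g_int by simp
  show "AE u in lborel. integrable lborel (\<lambda>v. case (u, v) of (u, v) \<Rightarrow> g u * g (u + v))"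
    using integrable_shift[OF g_int] by (auto simp: add.commute)
qed measurable

lemma integrable_correlation: "integrable lborel (correlation g)"
proof -
  have "integrable lborel (\<lambda>v. \<integral>u. (\<lambda>(u, v). g u * g (u + v)) (u, v) \<partial>lborel)"
    by (rule lborel_pair.integrable_snd) (use integrable_pair in simp)
  then show ?thesis by (simp add: correlation_def[abs_def])
qed

lemma correlation_eq: "correlation g v = correlation g 0 - increment g v / 2"
proof -
  have i: "integrable lborel (\<lambda>u. g (u + w) * g (u + v))" for v w by (rule integrable_product_shift)
  have "increment g v = (\<integral>u. g (u + v) * g (u + v) + g (u + 0) * g (u + 0) - 2 * (g (u + 0) * g (u + v)) \<partial>lborel)"
    unfolding increment_def by (simp add: power2_eq_square algebra_simps)
  also have "\<dots> = (\<integral>u. g (u + v) * g (u + v) \<partial>lborel) + correlation g 0 - 2 * correlation g v"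
    using i[of v v] i[of 0 0] i[of 0 v] unfolding correlation_def by simp
  also have "(\<integral>u. g (u + v) * g (u + v) \<partial>lborel) = correlation g 0"
    using integral_shift[of "\<lambda>u. g u * g u" v] by (simp add: correlation_def)
  finally show ?thesis by linarith
qed

lemma abs_correlation_le: "\<bar>correlation g v\<bar> \<le> correlation g 0"
proof -
  have i: "integrable lborel (\<lambda>u. g (u + w) * g (u + v))" for v w by (rule integrable_product_shift)
  have "0 \<le> increment g v" unfolding increment_def by simp
  then have 1: "correlation g v \<le> correlation g 0" by (simp add: correlation_eq[of v])
  have "0 \<le> (\<integral>u. (g (u + v) + g u)\<^sup>2 \<partial>lborel)" by simp
  also have "\<dots> = (\<integral>u. g (u + v) * g (u + v) + g (u + 0) * g (u + 0) + 2 * (g (u + 0) * g (u + v)) \<partial>lborel)"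
    by (simp add: power2_eq_square algebra_simps)
  also have "\<dots> = (\<integral>u. g (u + v) * g (u + v) \<partial>lborel) + correlation g 0 + 2 * correlation g v"
    using i[of v v] i[of 0 0] i[of 0 v] unfolding correlation_def by simp
  also have "(\<integral>u. g (u + v) * g (u + v) \<partial>lborel) = correlation g 0"
    using integral_shift[of "\<lambda>u. g u * g u" v] by (simp add: correlation_def)
  finally show ?thesis using 1 by linarith
qed

text \<open>The squared modulus of a Fourier transform is the transform of the autocorrelation. The
  latter is even, so a cosine transform suffices: after Fubini, the addition formula for
  \<open>cos (t * (w - u))\<close> produces both squares.\<close>

lemma fourier_square_eq:
  "(\<integral>u. g u * cos (t * u) \<partial>lborel)\<^sup>2 + (\<integral>u. g u * sin (t * u) \<partial>lborel)\<^sup>2 =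
    (\<integral>v. correlation g v * cos (t * v) \<partial>lborel)"
proof -
  note [measurable] = borel_measurable_g
  define c where "c = (\<integral>u. g u * cos (t * u) \<partial>lborel)"
  define d where "d = (\<integral>u. g u * sin (t * u) \<partial>lborel)"
  have ic: "integrable lborel (\<lambda>u. g u * cos (t * u))"
    by (rule Bochner_Integration.integrable_bound[OF g_int]) (auto simp: abs_mult intro!: mult_left_le)
  have isn: "integrable lborel (\<lambda>u. g u * sin (t * u))"
    by (rule Bochner_Integration.integrable_bound[OF g_int]) (auto simp: abs_mult intro!: mult_left_le)
  have ip: "integrable (lborel \<Otimes>\<^sub>M lborel) (\<lambda>(u, v). g u * g (u + v) * cos (t * v))"
    by (rule Bochner_Integration.integrable_bound[OF integrable_pair])
       (auto simp: abs_mult intro!: mult_left_le AE_I2)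
  have p: "(\<integral>v. g (u + v) * cos (t * v) \<partial>lborel) = cos (t * u) * c + sin (t * u) * d" for u
  proof -
    have "(\<integral>v. g (u + v) * cos (t * v) \<partial>lborel) = (\<integral>w. g w * cos (t * (w - u)) \<partial>lborel)"
      using integral_shift[of "\<lambda>w. g w * cos (t * (w - u))" u] by (simp add: add.commute)
    also have "\<dots> = (\<integral>w. cos (t * u) * (g w * cos (t * w)) + sin (t * u) * (g w * sin (t * w)) \<partial>lborel)"
      by (simp add: right_diff_distrib cos_diff algebra_simps)
    also have "\<dots> = cos (t * u) * c + sin (t * u) * d"
      using ic isn by (simp add: c_def d_def)
    finally show ?thesis .
  qed
  have "(\<integral>v. correlation g v * cos (t * v) \<partial>lborel) =
      (\<integral>v. (\<integral>u. g u * g (u + v) * cos (t * v) \<partial>lborel) \<partial>lborel)"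
    by (simp add: correlation_def)
  also have "\<dots> = (\<integral>u. (\<integral>v. g u * g (u + v) * cos (t * v) \<partial>lborel) \<partial>lborel)"
    by (rule lborel_pair.Fubini_integral) (use ip in simp)
  also have "\<dots> = (\<integral>u. g u * (cos (t * u) * c + sin (t * u) * d) \<partial>lborel)"
    by (simp add: mult.assoc p)
  also have "\<dots> = (\<integral>u. c * (g u * cos (t * u)) + d * (g u * sin (t * u)) \<partial>lborel)"
    by (simp add: algebra_simps)
  also have "\<dots> = c\<^sup>2 + d\<^sup>2"
    using ic isn by (simp add: c_def[symmetric] d_def[symmetric] power2_eq_square)
  finally show ?thesis by (simp add: c_def d_def)
qed

text \<open>By Fubini the weight is replaced by its own cosine transform, which lives at
  \<open>v = h * z\<close>. The part with \<open>s\<^sup>2\<close> keeps the correlation, because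
  boundedness is enough there; in the part that is larger by \<open>1 / h\<^sup>2\<close> the
  correlation is split into its value at 0 and the increment.\<close>

lemma gauss_mean_square:
  fixes h s :: real
  assumes h: "h > 0"
  defines "S \<equiv> \<lambda>t. (\<integral>u. g u * cos (t * u) \<partial>lborel)\<^sup>2 + (\<integral>u. g u * sin (t * u) \<partial>lborel)\<^sup>2"
  assumes q_int: "integrable lborel (\<lambda>z. std_normal_density z * (z\<^sup>2 - 1) * increment g (h * z))"
  shows "integrable lborel (\<lambda>t. (s\<^sup>2 + t\<^sup>2) * exp (- (h * t)\<^sup>2 / 2) * S t)"
    and "h\<^sup>2 * (\<integral>t. (s\<^sup>2 + t\<^sup>2) * exp (- (h * t)\<^sup>2 / 2) * S t \<partial>lborel) =
      2 * pi * s\<^sup>2 * h\<^sup>2 * (\<integral>z. std_normal_density z * correlation g (h * z) \<partial>lborel) +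
      pi * (\<integral>z. std_normal_density z * (z\<^sup>2 - 1) * increment g (h * z) \<partial>lborel)"
proof -
  define k where "k t = (s\<^sup>2 + t\<^sup>2) * exp (- (h * t)\<^sup>2 / 2)" for t
  have [measurable]: "k \<in> borel_measurable borel" "correlation g \<in> borel_measurable borel"
    using borel_measurable_integrable[OF integrable_correlation] by (auto simp: k_def[abs_def])
  have k: "integrable lborel k" unfolding k_def[abs_def] by (rule integral_gauss_kernel_cos[OF h])
  have ip: "integrable (lborel \<Otimes>\<^sub>M lborel) (\<lambda>(t, v). k t * (correlation g v * cos (t * v)))"
  proof (rule Bochner_Integration.integrable_bound)
    show "integrable (lborel \<Otimes>\<^sub>M lborel) (\<lambda>(t, v). k t * correlation g v)"
      by (rule lborel_pair.Fubini_integrable)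
         (use k integrable_correlation in \<open>auto simp: abs_mult integrable_norm\<close>)
  qed (auto simp: abs_mult mult.assoc[symmetric] intro!: mult_left_le AE_I2)
  have S: "k t * S t = (\<integral>v. k t * (correlation g v * cos (t * v)) \<partial>lborel)" for t
    unfolding S_def fourier_square_eq by simp
  have "integrable lborel (\<lambda>t. \<integral>v. (case (t, v) of (t, v) \<Rightarrow> k t * (correlation g v * cos (t * v))) \<partial>lborel)"
    by (rule lborel_pair.integrable_fst) (use ip in simp)
  then show "integrable lborel (\<lambda>t. (s\<^sup>2 + t\<^sup>2) * exp (- (h * t)\<^sup>2 / 2) * S t)"
    unfolding k_def[symmetric] by (simp only: S prod.case)
  have "(\<integral>t. k t * S t \<partial>lborel) = (\<integral>v. (\<integral>t. k t * (correlation g v * cos (t * v)) \<partial>lborel) \<partial>lborel)"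
    unfolding S by (rule lborel_pair.Fubini_integral[symmetric]) (use ip in simp)
  also have "\<dots> = (\<integral>v. correlation g v * (\<integral>t. k t * cos (t * v) \<partial>lborel) \<partial>lborel)"
    by (simp add: mult.left_commute[of "k _" "correlation g _"])
  also have "\<dots> = (\<integral>v. correlation g v * (2 * pi / h * (s\<^sup>2 + (1 - (v / h)\<^sup>2) / h\<^sup>2) * std_normal_density (v / h)) \<partial>lborel)"
    unfolding k_def integral_gauss_kernel_cos[OF h] ..
  also have "\<dots> = h * (\<integral>z. correlation g (h * z) * (2 * pi / h * (s\<^sup>2 + (1 - z\<^sup>2) / h\<^sup>2) * std_normal_density z) \<partial>lborel)"
    using h lborel_integral_real_affine[of h "\<lambda>v. correlation g v * (2 * pi / h * (s\<^sup>2 + (1 - (v / h)\<^sup>2) / h\<^sup>2) * std_normal_density (v / h))" 0]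
    by simp
  also have "\<dots> = h * (\<integral>z. 2 * pi / h * s\<^sup>2 * (std_normal_density z * correlation g (h * z))
      + 2 * pi / h ^ 3 * correlation g 0 * (std_normal_density z - std_normal_density z * z\<^sup>2)
      + pi / h ^ 3 * (std_normal_density z * (z\<^sup>2 - 1) * increment g (h * z)) \<partial>lborel)" (is "h * ?I = h * ?J")
  proof -
    have id: "(c - i / 2) * (2 * pi / h * (s\<^sup>2 + (1 - z\<^sup>2) / h\<^sup>2) * p) =
      2 * pi / h * s\<^sup>2 * (p * (c - i / 2)) + 2 * pi / h ^ 3 * c * (p - p * z\<^sup>2) + pi / h ^ 3 * (p * (z\<^sup>2 - 1) * i)"
      for p c i z :: real
      using h by (simp add: field_simps power2_eq_square power3_eq_cube)
    have "?I = ?J"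
      by (intro Bochner_Integration.integral_cong refl) (simp only: correlation_eq[of "h * _"] id)
    then show ?thesis by simp
  qed
  also have "?J = 2 * pi / h * s\<^sup>2 * (\<integral>z. std_normal_density z * correlation g (h * z) \<partial>lborel)
      + pi / h ^ 3 * (\<integral>z. std_normal_density z * (z\<^sup>2 - 1) * increment g (h * z) \<partial>lborel)"
  proof -
    have 1: "integrable lborel (\<lambda>z. std_normal_density z * correlation g (h * z))"
      by (rule Bochner_Integration.integrable_bound[OF integrable_mult_left[OF integrable_std_normal_moment[of 0], of "correlation g 0"]])
         (use abs_correlation_le abs_correlation_le[of 0] in \<open>auto simp: abs_mult intro!: mult_left_mono\<close>)
    have 2: "integrable lborel std_normal_density" "integrable lborel (\<lambda>z. std_normal_density z * z\<^sup>2)"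
      using integrable_std_normal_moment[of 0] integrable_std_normal_moment[of 2] by auto
    \<comment> \<open>The zeroth and second moments agree, so the summand carrying
      \<open>correlation g 0\<close> integrates to 0.\<close>
    have 3: "(\<integral>z. std_normal_density z \<partial>lborel) = 1" "(\<integral>z. std_normal_density z * z\<^sup>2 \<partial>lborel) = 1"
      using integral_std_normal_moment_even[of 0] integral_std_normal_moment_even[of 1] by auto
    show ?thesis
      using 1 2 q_int by (simp add: 3)
  qed
  finally have fin: "(\<integral>t. k t * S t \<partial>lborel) = h * (2 * pi / h * s\<^sup>2 * (\<integral>z. std_normal_density z * correlation g (h * z) \<partial>lborel)
      + pi / h ^ 3 * (\<integral>z. std_normal_density z * (z\<^sup>2 - 1) * increment g (h * z) \<partial>lborel))" .
  have "h\<^sup>2 * (h * (2 * pi / h * s\<^sup>2 * X + pi / h ^ 3 * Y)) = 2 * pi * s\<^sup>2 * h\<^sup>2 * X + pi * Y" for X Y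
    using h by (simp add: field_simps power2_eq_square power3_eq_cube)
  then show "h\<^sup>2 * (\<integral>t. (s\<^sup>2 + t\<^sup>2) * exp (- (h * t)\<^sup>2 / 2) * S t \<partial>lborel) =
      2 * pi * s\<^sup>2 * h\<^sup>2 * (\<integral>z. std_normal_density z * correlation g (h * z) \<partial>lborel) +
      pi * (\<integral>z. std_normal_density z * (z\<^sup>2 - 1) * increment g (h * z) \<partial>lborel)"
    unfolding k_def[symmetric] fin .
qed

end

section \<open>From means to Gaussian averages\<close>

text \<open>This writes the Gaussian as a superposition of sharp cutoffs \<open>t \<le> x\<close>,
  which turns a Gaussian average into an average of integrals over \<open>{0..x}\<close>.\<close>

lemma nn_integral_gauss_tail:
  fixes h t :: real
  assumes "h > 0" "t \<ge> 0"
  shows "(\<integral>\<^sup>+x. ennreal (h\<^sup>2 * x * exp (- (h * x)\<^sup>2 / 2)) * indicator {t..} x \<partial>lborel) = ennreal (exp (- (h * t)\<^sup>2 / 2))"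
proof -
  have "(\<integral>\<^sup>+x. ennreal (h\<^sup>2 * x * exp (- (h * x)\<^sup>2 / 2)) * indicator {t..} x \<partial>lborel) = ennreal (0 - - exp (- (h * t)\<^sup>2 / 2))"
  proof (rule nn_integral_FTC_atLeast)
    fix x :: real assume "t \<le> x"
    then show "0 \<le> h\<^sup>2 * x * exp (- (h * x)\<^sup>2 / 2)" using assms by auto
    show "((\<lambda>x. - exp (- (h * x)\<^sup>2 / 2)) has_real_derivative h\<^sup>2 * x * exp (- (h * x)\<^sup>2 / 2)) (at x)"
      by (rule derivative_eq_intros refl | simp add: power2_eq_square)+
  next
    show "((\<lambda>x. - exp (- (h * x)\<^sup>2 / 2)) \<longlongrightarrow> 0) at_top"
      using assms by real_asymp
  qed measurable
  then show ?thesis by simp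
qed

text \<open>Everything is nonnegative, so Tonelli applies without any integrability. Should the
  integrals be infinite, both sides are \<open>enn2real\<close> of infinity, hence 0.\<close>

lemma gauss_average_eq:
  fixes F :: "real \<Rightarrow> real"
  assumes cont: "continuous_on UNIV F" and nonneg: "\<And>t. F t \<ge> 0" and h: "h > 0"
  shows "(\<integral>t. indicator {0..} t * (F t * exp (- (h * t)\<^sup>2 / 2)) \<partial>lborel) =
    (\<integral>x. indicator {0..} x * (x * exp (- x\<^sup>2 / 2)) * integral {0..x / h} F \<partial>lborel)"
proof -
  have [measurable]: "F \<in> borel_measurable borel"
    using cont by (rule borel_measurable_continuous_onI)
  have contI: "continuous_on {0..b} F" for b using cont continuous_on_subset by blast
  define I where "I T = integral {0..T} F" for T
  have I_nonneg: "I T \<ge> 0" for T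
    unfolding I_def using nonneg by (intro integral_nonneg integrable_continuous_interval contI) auto
  have I: "(\<integral>\<^sup>+t. ennreal (F t) * indicator {0..T} t \<partial>lborel) = ennreal (I T)" for T
    unfolding I_def using nonneg
    by (intro nn_integral_has_integral_lebesgue' integrable_integral integrable_continuous_interval contI) auto
  have "mono I"
  proof (rule monoI)
    fix x y :: real assume "x \<le> y"
    then have "ennreal (I x) \<le> ennreal (I y)"
      unfolding I[symmetric] by (intro nn_integral_mono) (auto simp: indicator_def)
    then show "I x \<le> I y" using I_nonneg by simp
  qed
  then have [measurable]: "I \<in> borel_measurable borel" by (rule borel_measurable_mono)
  define k where "k x = h\<^sup>2 * x * exp (- (h * x)\<^sup>2 / 2)" for x
  have [measurable]: "k \<in> borel_measurable borel" by (simp add: k_def[abs_def])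
  have "(\<integral>\<^sup>+t. ennreal (indicator {0..} t * (F t * exp (- (h * t)\<^sup>2 / 2))) \<partial>lborel) =
     (\<integral>\<^sup>+t. (\<integral>\<^sup>+x. (ennreal (F t) * indicator {0..x} t) * (ennreal (k x) * indicator {0..} x) \<partial>lborel) \<partial>lborel)"
  proof (intro nn_integral_cong)
    fix t :: real
    show "ennreal (indicator {0..} t * (F t * exp (- (h * t)\<^sup>2 / 2))) =
      (\<integral>\<^sup>+x. (ennreal (F t) * indicator {0..x} t) * (ennreal (k x) * indicator {0..} x) \<partial>lborel)"
    proof (cases "t \<ge> 0")
      case True
      then have "(\<integral>\<^sup>+x. (ennreal (F t) * indicator {0..x} t) * (ennreal (k x) * indicator {0..} x) \<partial>lborel) =
        (\<integral>\<^sup>+x. ennreal (F t) * (ennreal (k x) * indicator {t..} x) \<partial>lborel)"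
        by (intro nn_integral_cong) (auto simp: indicator_def)
      also have "\<dots> = ennreal (F t) * ennreal (exp (- (h * t)\<^sup>2 / 2))"
        using nn_integral_gauss_tail[OF h True] by (simp add: nn_integral_cmult k_def)
      finally show ?thesis using True nonneg by (simp add: ennreal_mult)
    qed (simp add: indicator_def)
  qed
  also have "\<dots> = (\<integral>\<^sup>+x. (\<integral>\<^sup>+t. (ennreal (F t) * indicator {0..x} t) * (ennreal (k x) * indicator {0..} x) \<partial>lborel) \<partial>lborel)"
  proof (rule lborel_pair.Fubini')
    have "Measurable.pred (borel \<Otimes>\<^sub>M borel) (\<lambda>(x, t). t \<in> {0..x::real})"
      unfolding atLeastAtMost_iff by measurable
    then show "(\<lambda>(x, t). ennreal (F t) * indicator {0..x} t * (ennreal (k x) * indicator {0..} x)) \<in> borel_measurable (lborel \<Otimes>\<^sub>M lborel)"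
      unfolding indicator_def by measurable
  qed
  also have "\<dots> = (\<integral>\<^sup>+x. ennreal (indicator {0..} x * k x * I x) \<partial>lborel)"
  proof (intro nn_integral_cong)
    fix x :: real
    have "(\<integral>\<^sup>+t. (ennreal (F t) * indicator {0..x} t) * (ennreal (k x) * indicator {0..} x) \<partial>lborel) =
        ennreal (I x) * (ennreal (k x) * indicator {0..} x)"
      by (subst nn_integral_multc) (auto simp: I)
    also have "\<dots> = ennreal (indicator {0..} x * k x * I x)"
      using I_nonneg[of x] by (cases "x \<ge> 0") (auto simp: ennreal_mult' mult.commute)
    finally show "(\<integral>\<^sup>+t. (ennreal (F t) * indicator {0..x} t) * (ennreal (k x) * indicator {0..} x) \<partial>lborel) =
        ennreal (indicator {0..} x * k x * I x)" .
  qed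
  also have "\<dots> = ennreal (1 / h) * (\<integral>\<^sup>+x. ennreal (indicator {0..} (0 + 1 / h * x) * k (0 + 1 / h * x) * I (0 + 1 / h * x)) \<partial>lborel)"
    using h nn_integral_real_affine[of "\<lambda>x. ennreal (indicator {0..} x * k x * I x)" "1 / h" 0] by simp
  also have "\<dots> = (\<integral>\<^sup>+x. ennreal (1 / h) * ennreal (indicator {0..} (0 + 1 / h * x) * k (0 + 1 / h * x) * I (0 + 1 / h * x)) \<partial>lborel)"
    by (rule nn_integral_cmult[symmetric]) measurable
  also have "\<dots> = (\<integral>\<^sup>+x. ennreal (indicator {0..} x * (x * exp (- x\<^sup>2 / 2)) * I (x / h)) \<partial>lborel)"
  proof (intro nn_integral_cong)
    fix x :: real
    have "1 / h * (indicator {0..} (0 + 1 / h * x) * k (0 + 1 / h * x) * I (0 + 1 / h * x)) =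
      indicator {0..} x * (x * exp (- x\<^sup>2 / 2)) * I (x / h)"
      using h by (auto simp: k_def indicator_def field_simps power2_eq_square)
    then show "ennreal (1 / h) * ennreal (indicator {0..} (0 + 1 / h * x) * k (0 + 1 / h * x) * I (0 + 1 / h * x)) = ennreal (indicator {0..} x * (x * exp (- x\<^sup>2 / 2)) * I (x / h))"
      using h by (subst ennreal_mult'[symmetric]) auto
  qed
  finally have eq: "(\<integral>\<^sup>+t. ennreal (indicator {0..} t * (F t * exp (- (h * t)\<^sup>2 / 2))) \<partial>lborel) =
      (\<integral>\<^sup>+x. ennreal (indicator {0..} x * (x * exp (- x\<^sup>2 / 2)) * I (x / h)) \<partial>lborel)" .
  have "(\<integral>t. indicator {0..} t * (F t * exp (- (h * t)\<^sup>2 / 2)) \<partial>lborel) =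
      enn2real (\<integral>\<^sup>+t. ennreal (indicator {0..} t * (F t * exp (- (h * t)\<^sup>2 / 2))) \<partial>lborel)"
    using nonneg by (intro integral_eq_nn_integral) auto
  also have "\<dots> = (\<integral>x. indicator {0..} x * (x * exp (- x\<^sup>2 / 2)) * I (x / h) \<partial>lborel)"
    unfolding eq using I_nonneg by (intro integral_eq_nn_integral[symmetric] AE_I2) (auto simp: indicator_def)
  finally show ?thesis by (simp add: I_def)
qed

text \<open>The Abelian step: \<open>h powr p * I (x / h)\<close> tends to
  \<open>L * x powr p\<close> for each \<open>x > 0\<close>, and dominated convergence does the
  rest. The bound \<open>C * (1 + T powr p)\<close> comes from the limit for large \<open>T\<close>
  and from monotonicity below; \<open>p \<le> 2\<close> makes Gaussian moments up to the third
  sufficient as majorant.\<close>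

lemma gauss_average_tendsto:
  fixes F :: "real \<Rightarrow> real" and h :: "nat \<Rightarrow> real"
  assumes cont: "continuous_on UNIV F" and nonneg: "\<And>t. F t \<ge> 0"
    and p: "0 < p" "p \<le> 2"
    and lim: "((\<lambda>T. 1 / T powr p * integral {0..T} F) \<longlongrightarrow> L) at_top"
    and h: "\<And>j. h j > 0" "h \<longlonglongrightarrow> 0"
  shows "(\<lambda>j. h j powr p * (\<integral>t. indicator {0..} t * (F t * exp (- (h j * t)\<^sup>2 / 2)) \<partial>lborel)) \<longlonglongrightarrow>
    (\<integral>x. indicator {0..} x * (x * exp (- x\<^sup>2 / 2)) * (L * x powr p) \<partial>lborel)"
proof -
  have contI: "continuous_on {0..b} F" for b using cont continuous_on_subset by blast
  define I where "I T = integral {0..T} F" for T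
  have I_nonneg: "I T \<ge> 0" for T
    unfolding I_def using nonneg by (intro integral_nonneg integrable_continuous_interval contI) auto
  have I_mono: "I x \<le> I y" if "x \<le> y" for x y
    unfolding I_def using nonneg that by (intro integral_subset_le integrable_continuous_interval contI) auto
  then have [measurable]: "I \<in> borel_measurable borel" by (intro borel_measurable_mono monoI)
  obtain T0 where T0: "\<And>T. T \<ge> T0 \<Longrightarrow> 1 / T powr p * I T \<le> L + 1"
    using order_tendstoD(2)[OF lim, of "L + 1"] unfolding eventually_at_top_linorder I_def
    by (metis less_add_one less_imp_le)
  define C where "C = \<bar>L + 1\<bar> + I (max T0 1)"
  have C_nonneg: "C \<ge> 0" using I_nonneg by (simp add: C_def)
  have I_le: "I T \<le> C * (1 + T powr p)" if "T \<ge> 0" for T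
  proof (cases "T \<ge> max T0 1")
    case True
    then have "I T \<le> (L + 1) * T powr p" using T0[of T] by (simp add: field_simps)
    also have "\<dots> \<le> C * T powr p"
      using I_nonneg by (intro mult_right_mono) (auto simp: C_def intro: add_increasing2)
    finally show ?thesis using C_nonneg by (simp add: algebra_simps)
  next
    case False
    then have "I T \<le> C" using I_mono[of T "max T0 1"] by (simp only: C_def) linarith
    also have "\<dots> \<le> C * (1 + T powr p)" using C_nonneg by (simp add: algebra_simps)
    finally show ?thesis .
  qed
  \<comment> \<open>The majorant needs \<open>h j powr p \<le> 1\<close>, which is only available
    from some index on; hence the shift by \<open>j0\<close>.\<close>
  obtain j0 where j0: "\<And>j. j \<ge> j0 \<Longrightarrow> h j < 1"
    using order_tendstoD(2)[OF h(2), of 1] unfolding eventually_sequentially by auto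
  have eq: "h j powr p * (\<integral>t. indicator {0..} t * (F t * exp (- (h j * t)\<^sup>2 / 2)) \<partial>lborel) =
     (\<integral>x. indicator {0..} x * (x * exp (- x\<^sup>2 / 2)) * (h j powr p * I (x / h j)) \<partial>lborel)" for j
  proof -
    have "(\<integral>x. indicator {0..} x * (x * exp (- x\<^sup>2 / 2)) * (h j powr p * I (x / h j)) \<partial>lborel) =
       (\<integral>x. h j powr p * (indicator {0..} x * (x * exp (- x\<^sup>2 / 2)) * I (x / h j)) \<partial>lborel)"
      by (simp add: mult_ac)
    then show ?thesis
      unfolding gauss_average_eq[OF cont nonneg h(1)] I_def by simp
  qed
  define w where "w x = C * (2 * (std_normal_density x * \<bar>x\<bar> ^ 1) + std_normal_density x * \<bar>x\<bar> ^ 3) * sqrt (2 * pi)" for x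
  have "(\<lambda>j. \<integral>x. indicator {0..} x * (x * exp (- x\<^sup>2 / 2)) * (h (j + j0) powr p * I (x / h (j + j0))) \<partial>lborel)
     \<longlonglongrightarrow> (\<integral>x. indicator {0..} x * (x * exp (- x\<^sup>2 / 2)) * (L * x powr p) \<partial>lborel)"
  proof (rule integral_dominated_convergence[where w = w])
    show "integrable lborel w"
      unfolding w_def
      by (intro integrable_mult_left integrable_mult_right Bochner_Integration.integrable_add integrable_std_normal_moment_abs)
    show "AE x in lborel. (\<lambda>j. indicator {0..} x * (x * exp (- x\<^sup>2 / 2)) * (h (j + j0) powr p * I (x / h (j + j0))))
      \<longlonglongrightarrow> indicator {0..} x * (x * exp (- x\<^sup>2 / 2)) * (L * x powr p)"
    proof (intro AE_I2)
      fix x :: real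
      show "(\<lambda>j. indicator {0..} x * (x * exp (- x\<^sup>2 / 2)) * (h (j + j0) powr p * I (x / h (j + j0))))
      \<longlonglongrightarrow> indicator {0..} x * (x * exp (- x\<^sup>2 / 2)) * (L * x powr p)"
      proof (cases "x > 0")
        case True
        have h0: "filterlim (\<lambda>j. h (j + j0)) (at_right 0) sequentially"
          using LIMSEQ_ignore_initial_segment[OF h(2)] less_imp_neq[OF h(1)] by (auto simp: filterlim_at h(1) intro!: always_eventually)
        have "filterlim (\<lambda>j. x / h (j + j0)) at_top sequentially"
          unfolding divide_inverse
          by (rule filterlim_tendsto_pos_mult_at_top[OF tendsto_const True
             filterlim_compose[OF filterlim_inverse_at_top_right h0]])
        from filterlim_compose[OF lim this]
        have "(\<lambda>j. 1 / (x / h (j + j0)) powr p * I (x / h (j + j0)) * x powr p) \<longlonglongrightarrow> L * x powr p"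
          unfolding I_def by (intro tendsto_mult_right)
        moreover have "1 / (x / h j) powr p * I (x / h j) * x powr p = h j powr p * I (x / h j)" for j
          using h(1)[of j] True by (simp add: powr_divide)
        ultimately show ?thesis by (intro tendsto_mult_left) simp
      qed (cases "x = 0"; simp add: indicator_def)
    qed
    show "AE x in lborel. norm (indicator {0..} x * (x * exp (- x\<^sup>2 / 2)) * (h (j + j0) powr p * I (x / h (j + j0)))) \<le> w x" for j
    proof (intro AE_I2)
      fix x :: real
      show "norm (indicator {0..} x * (x * exp (- x\<^sup>2 / 2)) * (h (j + j0) powr p * I (x / h (j + j0)))) \<le> w x"
      proof (cases "x \<ge> 0")
        case True
        let ?h = "h (j + j0)"
        have hj: "0 < ?h" "?h < 1" using h(1) j0 by auto
        have "?h powr p * I (x / ?h) \<le> ?h powr p * (C * (1 + (x / ?h) powr p))"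
          using hj True by (intro mult_left_mono I_le) auto
        also have "\<dots> = C * (?h powr p + x powr p)"
          using hj True by (simp add: powr_divide algebra_simps)
        also have "\<dots> \<le> C * (1 + (1 + x\<^sup>2))"
        proof (intro mult_left_mono add_mono C_nonneg)
          show "?h powr p \<le> 1" using hj p by (simp add: powr_le1)
          show "x powr p \<le> 1 + x\<^sup>2"
          proof (cases "x \<le> 1")
            case True
            then have "x powr p \<le> 1" using \<open>x \<ge> 0\<close> p by (simp add: powr_le1)
            then show ?thesis by (simp add: add_increasing2)
          next
            case False
            then have "x powr p \<le> x powr 2" using p by (intro powr_mono) auto
            then show ?thesis using False by simp
          qed
        qed
        finally have 1: "?h powr p * I (x / ?h) \<le> C * (1 + (1 + x\<^sup>2))" .
        have "norm (indicator {0..} x * (x * exp (- x\<^sup>2 / 2)) * (?h powr p * I (x / ?h))) = x * exp (- x\<^sup>2 / 2) * (?h powr p * I (x / ?h))"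
          using True I_nonneg by (simp add: abs_mult)
        also have "\<dots> \<le> x * exp (- x\<^sup>2 / 2) * (C * (1 + (1 + x\<^sup>2)))"
          using 1 True by (intro mult_left_mono) auto
        also have "\<dots> = w x"
          using True by (simp add: w_def std_normal_density_def field_simps power2_eq_square power3_eq_cube)
        finally show ?thesis .
      next
        case False
        have "0 \<le> w x" unfolding w_def by (intro mult_nonneg_nonneg add_nonneg_nonneg C_nonneg) auto
        then show ?thesis using False by simp
      qed
    qed
  qed measurable
  then show ?thesis
    unfolding eq by (rule LIMSEQ_offset)
qed

section \<open>The Dirichlet series as a Fourier transform\<close>

text \<open>\<open>dirichlet_f\<close> is given only by a choice. The series itself is therefore
  shown to be a continuation, and uniqueness carries its value over to the whole punctured
  half-plane.\<close>

lemma cont_term_sums: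
  assumes s: "Re s > 0" "s \<noteq> 1"
  shows "(\<lambda>k. cont_term k s) sums (dirichlet_f s - 1 / (s - 1))"
proof -
  define S where "S = {s. Re s > 0} - {1 :: complex}"
  have oS: "open S"
    unfolding S_def by (intro open_Diff open_halfspace_Re_gt) auto
  have sm: "summable (\<lambda>k. norm (cont_term k s))" if "s \<in> S" for s
  proof (rule summable_comparison_test)
    have "summable (\<lambda>k. real (Suc k) powr (- Re s - 1))"
      using that by (subst summable_Suc_iff) (simp add: summable_real_powr_iff S_def)
    then show "summable (\<lambda>k. 2 * norm s * real (Suc k) powr (- Re s - 1))"
      by (rule summable_mult)
    show "\<exists>N. \<forall>k\<ge>N. norm (norm (cont_term k s)) \<le> 2 * norm s * real (Suc k) powr (- Re s - 1)"
      using norm_cont_term_le[of s] that by (auto simp: S_def simp del: of_nat_Suc)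
  qed
  define g where "g s = (\<Sum>k. cont_term k s) + 1 / (s - 1)" for s
  have "(\<lambda>s. \<Sum>k. cont_term k s) holomorphic_on S"
  proof (rule holomorphic_uniform_sequence[OF oS, where f = "\<lambda>n s. \<Sum>k<n. cont_term k s"])
    show "(\<lambda>s. \<Sum>k<n. cont_term k s) holomorphic_on S" for n
      unfolding cont_term_def S_def by (intro holomorphic_intros) auto
  next
    fix x assume "x \<in> S"
    then obtain d where d: "d > 0" "cball x d \<subseteq> S"
      using oS open_contains_cball by blast
    \<comment> \<open>The leftmost point of the disc lies in the half-plane, so real parts stay
      above \<open>Re x - d > 0\<close> on the whole disc; this is the exponent in the uniform
      majorant.\<close>
    have pos: "Re x > d"
    proof -
      have "x - of_real d \<in> S" using d by (intro subsetD[OF d(2)]) (auto simp: dist_norm)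
      then show ?thesis by (simp add: S_def)
    qed
    define e where "e = Re x - d"
    have "uniform_limit (cball x d) (\<lambda>n s. \<Sum>k<n. cont_term k s) (\<lambda>s. \<Sum>k. cont_term k s) sequentially"
    proof (rule Weierstrass_m_test)
      show "summable (\<lambda>k. 2 * (norm x + d) * real (Suc k) powr (- e - 1))"
        using pos by (intro summable_mult, subst summable_Suc_iff) (simp add: summable_real_powr_iff e_def)
      fix k y assume y: "y \<in> cball x d"
      have "\<bar>Re (x - y)\<bar> \<le> norm (x - y)" by (rule abs_Re_le_cmod)
      then have Re: "Re y \<ge> e" using y by (auto simp: e_def dist_norm)
      have ny: "norm y \<le> norm x + d"
        using y norm_triangle_sub[of y x] by (simp add: dist_norm norm_minus_commute)
      have "norm (cont_term k y) \<le> 2 * norm y * real (Suc k) powr (- Re y - 1)"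
        using d y by (intro norm_cont_term_le) (auto simp: S_def)
      also have "\<dots> \<le> 2 * (norm x + d) * real (Suc k) powr (- e - 1)"
        using Re ny d by (intro mult_mono powr_mono) auto
      finally show "norm (cont_term k y) \<le> 2 * (norm x + d) * real (Suc k) powr (- e - 1)" .
    qed
    then show "\<exists>d>0. cball x d \<subseteq> S \<and>
      uniform_limit (cball x d) (\<lambda>n s. \<Sum>k<n. cont_term k s) (\<lambda>s. \<Sum>k. cont_term k s) sequentially"
      using d by blast
  qed
  then have hol: "g holomorphic_on S"
    unfolding g_def by (intro holomorphic_intros) (auto simp: S_def)
  have "(\<lambda>n. of_real (a_coeff (Suc n)) * of_nat (Suc n) powr (- s)) sums g s"
    if s: "Re s > 1" for s
  proof -
    have s1: "s \<noteq> 1" and sS: "s \<in> S" using s by (auto simp: S_def)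
    have L: "((\<lambda>n. of_nat (Suc n) powr z) \<longlonglongrightarrow> (0::complex))" if "Re z < 0" for z
      by (rule tendsto_neg_powr_complex_of_nat[OF filterlim_Suc that])
    have E: "(\<lambda>n. of_real (eta_sum n) * of_nat (Suc n) powr (- s)) \<longlonglongrightarrow> 0"
    proof (rule Lim_null_comparison)
      show "\<forall>\<^sub>F n in sequentially. norm (of_real (eta_sum n) * of_nat (Suc n) powr (- s))
          \<le> norm (of_nat (Suc n) powr (- s))"
      proof (intro always_eventually allI)
        fix n
        show "norm (of_real (eta_sum n) * of_nat (Suc n) powr (- s)) \<le> norm (of_nat (Suc n) powr (- s))"
          using eta_sum_cases[of n] by auto
      qed
      show "(\<lambda>n. norm (of_nat (Suc n) powr (- s))) \<longlonglongrightarrow> 0"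
        using L[of "- s"] s by (intro tendsto_norm_zero) auto
    qed
    have Z: "(\<lambda>n. of_nat (Suc n) powr (1 - s) / (1 - s)) \<longlonglongrightarrow> 0"
      using L[of "1 - s"] s by (intro tendsto_divide_zero) auto
    have "(\<lambda>k. cont_term k s) sums (\<Sum>k. cont_term k s)"
      using sm[OF sS] by (intro summable_sums) (rule summable_norm_cancel)
    then have "(\<lambda>n. (\<Sum>k<n. cont_term k s) + of_real (eta_sum n) * of_nat (Suc n) powr (- s)
        + of_nat (Suc n) powr (1 - s) / (1 - s) + 1 / (s - 1))
      \<longlonglongrightarrow> (\<Sum>k. cont_term k s) + 0 + 0 + 1 / (s - 1)"
      unfolding sums_def by (intro tendsto_add E Z tendsto_const)
    then show ?thesis
      unfolding sums_def dirichlet_partial_sum[OF s1] g_def by simp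
  qed
  then have "is_continuation g"
    using hol by (simp add: is_continuation_def S_def)
  then have "dirichlet_f s = g s"
    using is_continuation_unique is_continuation_dirichlet_f s by blast
  moreover have "(\<lambda>k. cont_term k s) sums (\<Sum>k. cont_term k s)"
    using s sm[of s] by (intro summable_sums) (rule summable_norm_cancel, simp add: S_def)
  ultimately show ?thesis by (simp add: g_def)
qed

section \<open>The error term of the coefficient sums and its exponential rescaling\<close>

definition remainder :: "real \<Rightarrow> real"
  where "remainder x = of_int \<lfloor>x\<rfloor> + eta_sum (nat \<lfloor>x\<rfloor>) - x"

lemma remainder_measurable [measurable]: "remainder \<in> borel_measurable borel"
  unfolding remainder_def[abs_def] by measurable

lemma eta_sum_0 [simp]: "eta_sum 0 = 0"
  by (simp add: eta_sum_def)

lemma abs_remainder_le: "\<bar>remainder x\<bar> \<le> 1"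
  using eta_sum_cases[of "nat \<lfloor>x\<rfloor>"] unfolding remainder_def by linarith

lemma remainder_less_1: "0 \<le> x \<Longrightarrow> x < 1 \<Longrightarrow> remainder x = - x"
  by (simp add: remainder_def floor_eq_iff[THEN iffD2])

lemma abs_remainder_le_self: "0 \<le> x \<Longrightarrow> \<bar>remainder x\<bar> \<le> x"
  using abs_remainder_le[of x] by (cases "x < 1") (auto simp: remainder_less_1)

lemma integrable_exp_abs:
  fixes c :: real
  assumes c: "c > 0"
  shows "integrable lborel (\<lambda>u. exp (- c * \<bar>u\<bar>))"
proof -
  have i: "integrable lborel (\<lambda>x. exp (- x) * indicator {0<..} x :: real)"
    using has_bochner_integral_I0i_power_exp_m[of 0] by (simp add: has_bochner_integral_iff)
  have 1: "integrable lborel (\<lambda>x. exp (- (0 + c * x)) * indicator {0<..} (0 + c * x) :: real)"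
    using c by (intro lborel_integrable_real_affine[OF i]) auto
  have 2: "integrable lborel (\<lambda>x. exp (- (0 + (- c) * x)) * indicator {0<..} (0 + (- c) * x) :: real)"
    using c by (intro lborel_integrable_real_affine[OF i]) auto
  show ?thesis
  proof (rule Bochner_Integration.integrable_bound[OF Bochner_Integration.integrable_add[OF 1 2]])
    show "AE u in lborel. norm (exp (- c * \<bar>u\<bar>)) \<le>
      norm (exp (- (0 + c * u)) * indicator {0<..} (0 + c * u) + exp (- (0 + (- c) * u)) * indicator {0<..} (0 + (- c) * u))"
      using AE_lborel_singleton[of 0]
    proof eventually_elim
      case (elim u)
      then show ?case using c
        by (cases "u > 0") (auto simp: indicator_def zero_less_mult_iff mult_less_0_iff)
    qed
  qed simp
qed

definition scaled_remainder :: "real \<Rightarrow> real \<Rightarrow> real"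
  where "scaled_remainder s u = remainder (exp u) * exp (- s * u)"

lemma scaled_remainder_measurable [measurable]: "scaled_remainder s \<in> borel_measurable borel"
  unfolding scaled_remainder_def[abs_def] by measurable

text \<open>For \<open>u < 0\<close> the remainder is at most \<open>exp u\<close> in size, which
  gives the decay rate \<open>1 - s\<close>. As \<open>s < 1 / 2\<close>, this is at least
  \<open>s\<close>, so one rate serves both half-lines.\<close>

lemma abs_scaled_remainder_le:
  assumes s: "0 < s" "s < 1 / 2"
  shows "\<bar>scaled_remainder s u\<bar> \<le> exp (- s * \<bar>u\<bar>)"
proof (cases "u \<ge> 0")
  case True
  then show ?thesis
    using mult_right_mono[OF abs_remainder_le[of "exp u"], of "exp (- s * u)"]
    by (simp add: scaled_remainder_def abs_mult)
next
  case False
  have "\<bar>scaled_remainder s u\<bar> \<le> exp u * exp (- s * u)"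
    using mult_right_mono[OF abs_remainder_le_self[of "exp u"], of "exp (- s * u)"]
    by (simp add: scaled_remainder_def abs_mult)
  also have "\<dots> = exp (u - s * u)" by (simp add: exp_add[symmetric])
  also have "\<dots> \<le> exp (s * u)"
    using False mult_right_mono_neg[of "2 * s" 1 u] s by simp
  finally show ?thesis using False by simp
qed

lemma abs_scaled_remainder_le_1:
  assumes s: "0 < s" "s < 1 / 2"
  shows "\<bar>scaled_remainder s u\<bar> \<le> 1"
  by (rule order_trans[OF abs_scaled_remainder_le[OF s]]) (use s in simp)

lemma integrable_scaled_remainder:
  assumes s: "0 < s" "s < 1 / 2"
  shows "integrable lborel (scaled_remainder s)"
  by (rule Bochner_Integration.integrable_bound[OF integrable_exp_abs[OF s(1)]])
     (use abs_scaled_remainder_le[OF s] in auto)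

lemma exp_ln_powr: "n > 0 \<Longrightarrow> exp (z * of_real (ln (real n))) = of_nat n powr (z :: complex)"
  by (simp add: powr_def Ln_of_nat)

text \<open>Between consecutive logarithms of integers the remainder is a constant minus
  \<open>exp u\<close>, so a primitive is explicit. The floor jumps at the right endpoint, which is
  removed as a spike.\<close>

lemma has_integral_remainder_block:
  fixes s :: complex and n :: nat
  assumes s: "s \<noteq> 0" "s \<noteq> 1" and n: "n > 0"
  shows "((\<lambda>u. of_real (remainder (exp u)) * exp (- s * of_real u)) has_integral
    (of_nat n + of_real (eta_sum n)) * (of_nat n powr (- s) - of_nat (Suc n) powr (- s)) / s
      - (of_nat (Suc n) powr (1 - s) - of_nat n powr (1 - s)) / (1 - s)) {ln n..ln (Suc n)}"
proof (rule has_integral_spike_finite[where S = "{ln (Suc n)}"])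
  define A where "A = (of_nat n + of_real (eta_sum n) :: complex)"
  define F where "F = (\<lambda>z. - A * exp (- s * z) / s - exp ((1 - s) * z) / (1 - s))"
  have "((\<lambda>u. (A - exp (of_real u)) * exp (- s * of_real u)) has_integral
    F (of_real (ln (Suc n))) - F (of_real (ln n))) {ln n..ln (Suc n)}"
  proof (rule fundamental_theorem_of_calculus)
    fix u :: real
    have "(F has_field_derivative A * exp (- s * of_real u) - exp ((1 - s) * of_real u)) (at (of_real u))"
      unfolding F_def using s by (auto intro!: derivative_eq_intros)
    then have "((\<lambda>u. F (of_real u)) has_vector_derivative A * exp (- s * of_real u) - exp ((1 - s) * of_real u)) (at u within {ln n..ln (Suc n)})"
      by (rule has_vector_derivative_real_field)
    then show "((\<lambda>u. F (of_real u)) has_vector_derivative (A - exp (of_real u)) * exp (- s * of_real u)) (at u within {ln n..ln (Suc n)})"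
      by (simp add: algebra_simps exp_add[symmetric])
  qed (use n in simp)
  also have "F (of_real (ln (Suc n))) - F (of_real (ln n)) =
     A * (of_nat n powr (- s) - of_nat (Suc n) powr (- s)) / s
      - (of_nat (Suc n) powr (1 - s) - of_nat n powr (1 - s)) / (1 - s)"
    unfolding F_def using n
    by (subst (1 2 3 4) exp_ln_powr) (auto simp: diff_divide_distrib algebra_simps)
  finally show "((\<lambda>u. (A - exp (of_real u)) * exp (- s * of_real u)) has_integral
    (of_nat n + of_real (eta_sum n)) * (of_nat n powr (- s) - of_nat (Suc n) powr (- s)) / s
      - (of_nat (Suc n) powr (1 - s) - of_nat n powr (1 - s)) / (1 - s)) {ln n..ln (Suc n)}"
    by (simp add: A_def)
  fix u assume u: "u \<in> {ln (real n)..ln (real (Suc n))} - {ln (real (Suc n))}"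
  have "real n \<le> exp u" using u n exp_le_cancel_iff[of "ln n" u] by simp
  moreover have "exp u < real (Suc n)"
    using u exp_less_mono[of u "ln (Suc n)"] by simp
  ultimately have "\<lfloor>exp u\<rfloor> = int n" by (simp add: floor_eq_iff)
  then show "of_real (remainder (exp u)) * exp (- s * of_real u) = (A - exp (of_real u)) * exp (- s * of_real u)"
    by (simp add: remainder_def A_def exp_of_real)
qed simp

text \<open>The half-line \<open>u < 0\<close> corresponds to \<open>0 < x < 1\<close>, where the
  remainder is \<open>- x\<close>. As \<open>b\<close> grows the value tends to
  \<open>1 / (s - 1)\<close>, which will account for the pole.\<close>

lemma has_integral_remainder_initial:
  fixes s :: complex
  assumes s: "s \<noteq> 1" and b: "b \<ge> 0"
  shows "((\<lambda>u. of_real (remainder (exp u)) * exp (- s * of_real u)) has_integral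
    (exp (- ((1 - s) * of_real b)) - 1) / (1 - s)) {- b..0}"
proof (rule has_integral_spike_finite[where S = "{0}"])
  define F where "F = (\<lambda>z. - exp ((1 - s) * z) / (1 - s))"
  have "((\<lambda>u. - exp ((1 - s) * of_real u)) has_integral F (of_real 0) - F (of_real (- b))) {- b..0}"
  proof (rule fundamental_theorem_of_calculus)
    fix u :: real
    have "(F has_field_derivative - exp ((1 - s) * of_real u)) (at (of_real u))"
      unfolding F_def using s by (auto intro!: derivative_eq_intros)
    then show "((\<lambda>u. F (of_real u)) has_vector_derivative - exp ((1 - s) * of_real u)) (at u within {- b..0})"
      by (rule has_vector_derivative_real_field)
  qed (use b in simp)
  then show "((\<lambda>u. - exp ((1 - s) * of_real u)) has_integral (exp (- ((1 - s) * of_real b)) - 1) / (1 - s)) {- b..0}"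
    by (simp add: F_def diff_divide_distrib)
  fix u assume u: "u \<in> {- b..0} - {0}"
  then show "of_real (remainder (exp u)) * exp (- s * of_real u) = - exp ((1 - s) * of_real u)"
    by (simp add: remainder_less_1 exp_of_real[symmetric] exp_add[symmetric] algebra_simps)
qed simp

text \<open>Up to a telescoping difference, a block integral is the summand of the known series; the
  link is that \<open>n powr (1 - s)\<close> equals \<open>n * n powr (- s)\<close>.\<close>

lemma s_times_block_eq_cont_term:
  fixes s :: complex
  assumes s: "s \<noteq> 0" "s \<noteq> 1"
  shows "s * ((of_nat (Suc k) + of_real (eta_sum (Suc k))) * (of_nat (Suc k) powr (- s) - of_nat (Suc (Suc k)) powr (- s)) / s
      - (of_nat (Suc (Suc k)) powr (1 - s) - of_nat (Suc k) powr (1 - s)) / (1 - s)) =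
    cont_term k s + (of_nat (Suc (Suc k)) powr (- s) - of_nat (Suc k) powr (- s))"
proof -
  have p: "of_nat n powr (1 - s) = of_nat n * of_nat n powr (- s)" if "n > 0" for n
    using that powr_add[of "of_nat n" 1 "- s"] by simp
  have "1 - s \<noteq> 0" using s by simp
  then show ?thesis
    unfolding cont_term_def p[OF zero_less_Suc] using s
    by (simp add: divide_simps) (simp add: algebra_simps)
qed

text \<open>This is the Mellin representation of \<open>f\<close>, in the variable
  \<open>u = ln x\<close>. The integral over \<open>{- n..ln (n + 1)}\<close> is exact; in the limit
  the initial piece gives \<open>s / (s - 1)\<close>, the series gives
  \<open>f s - 1 / (s - 1)\<close>, the telescoping sum gives \<open>- 1\<close>, and the three
  elementary terms cancel. Absolute integrability extends the windows to the line.\<close>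

lemma dirichlet_f_eq_integral:
  assumes s: "0 < Re s" "Re s < 1 / 2"
  shows "dirichlet_f s = s * (\<integral>u. of_real (scaled_remainder (Re s) u) * cis (- Im s * u) \<partial>lborel)"
proof -
  have s01: "s \<noteq> 0" "s \<noteq> 1" using s by auto
  define G where "G = (\<lambda>u. of_real (remainder (exp u)) * exp (- s * of_real u))"
  have G_eq: "G u = of_real (scaled_remainder (Re s) u) * cis (- Im s * u)" for u
    by (simp add: G_def scaled_remainder_def exp_eq_polar[of "- (s * of_real u)"])
  have [measurable]: "G \<in> borel_measurable borel" by (simp add: G_def)
  have G_int: "integrable lborel G"
    by (rule Bochner_Integration.integrable_bound[OF integrable_scaled_remainder[OF s]]) (auto simp: G_eq norm_mult)
  define P where "P k = (of_nat (Suc k) + of_real (eta_sum (Suc k))) * (of_nat (Suc k) powr (- s) - of_nat (Suc (Suc k)) powr (- s)) / s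
      - (of_nat (Suc (Suc k)) powr (1 - s) - of_nat (Suc k) powr (1 - s)) / (1 - s)" for k
  have pos: "(G has_integral (\<Sum>k<n. P k)) {0..ln (Suc n)}" for n
  proof (induction n)
    case 0
    show ?case using has_integral_null_real[of 0 0 G] by simp
  next
    case (Suc n)
    have "(G has_integral P n) {ln (Suc n)..ln (Suc (Suc n))}"
      unfolding G_def P_def by (rule has_integral_remainder_block[OF s01]) simp
    with Suc show ?case
      unfolding sum.lessThan_Suc by (intro has_integral_combine) auto
  qed
  define R where "R n = (exp (- ((1 - s) * of_nat n)) - 1) / (1 - s) + (\<Sum>k<n. P k)" for n
  have all: "(G has_integral R n) {- real n..ln (Suc n)}" for n
    unfolding R_def using has_integral_remainder_initial[OF s01(2), of "real n"] pos[of n]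
    by (intro has_integral_combine[where c = 0]) (auto simp: G_def)
  have "(\<lambda>n. \<integral>u. indicator {- real n..ln (Suc n)} u *\<^sub>R G u \<partial>lborel) \<longlonglongrightarrow> (\<integral>u. G u \<partial>lborel)"
  proof (rule integral_dominated_convergence[where w = "\<lambda>u. norm (G u)"])
    show "AE u in lborel. (\<lambda>n. indicator {- real n..ln (Suc n)} u *\<^sub>R G u) \<longlonglongrightarrow> G u"
    proof (intro AE_I2 tendsto_eventually)
      fix u :: real
      have "filterlim (\<lambda>n. ln (real (Suc n))) at_top sequentially" by real_asymp
      then have "\<forall>\<^sub>F n in sequentially. u \<le> ln (real (Suc n))"
        by (simp add: filterlim_at_top)
      moreover have "filterlim (\<lambda>n. - real n) at_bot sequentially" by real_asymp
      then have "\<forall>\<^sub>F n in sequentially. - real n \<le> u"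
        by (simp add: filterlim_at_bot)
      ultimately show "\<forall>\<^sub>F n in sequentially. indicator {- real n..ln (Suc n)} u *\<^sub>R G u = G u"
        by eventually_elim simp
    qed
  qed (use G_int in \<open>auto simp: indicator_def\<close>)
  moreover have "(\<integral>u. indicator {- real n..ln (Suc n)} u *\<^sub>R G u \<partial>lborel) = R n" for n
  proof -
    have "set_integrable lborel {- real n..ln (Suc n)} G"
      using G_int by (simp add: set_integrable_def integrable_mult_indicator)
    from set_borel_integral_eq_integral(2)[OF this] all[of n] show ?thesis
      by (simp add: set_lebesgue_integral_def integral_unique)
  qed
  ultimately have lim1: "(\<lambda>n. s * R n) \<longlonglongrightarrow> s * (\<integral>u. G u \<partial>lborel)"
    by (simp add: tendsto_mult_left)
  have sR: "s * R n = s * (exp (- ((1 - s) * of_nat n)) - 1) / (1 - s) + (\<Sum>k<n. cont_term k s) + (of_nat (Suc n) powr (- s) - 1)" for n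
  proof -
    have "s * (\<Sum>k<n. P k) = (\<Sum>k<n. cont_term k s) + (\<Sum>k<n. of_nat (Suc (Suc k)) powr (- s) - of_nat (Suc k) powr (- s))"
      unfolding sum_distrib_left P_def s_times_block_eq_cont_term[OF s01] by (rule sum.distrib)
    also have "(\<Sum>k<n. of_nat (Suc (Suc k)) powr (- s) - of_nat (Suc k) powr (- s)) = of_nat (Suc n) powr (- s) - 1"
      by (subst sum_lessThan_telescope) simp
    finally show ?thesis by (simp add: R_def algebra_simps)
  qed
  have e0: "(\<lambda>n. exp (- ((1 - s) * of_nat n))) \<longlonglongrightarrow> 0"
  proof (rule tendsto_norm_zero_cancel)
    have "(\<lambda>n. exp (- ((1 - Re s) * real n))) \<longlonglongrightarrow> 0"
      using s by real_asymp
    then show "(\<lambda>n. norm (exp (- ((1 - s) * of_nat n)))) \<longlonglongrightarrow> 0" by simp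
  qed
  have p0: "(\<lambda>n. of_nat (Suc n) powr (- s)) \<longlonglongrightarrow> 0"
    by (rule tendsto_neg_powr_complex_of_nat[OF filterlim_Suc]) (use s in simp)
  have cs: "(\<lambda>n. \<Sum>k<n. cont_term k s) \<longlonglongrightarrow> dirichlet_f s - 1 / (s - 1)"
    using cont_term_sums[of s] s s01 by (simp add: sums_def)
  have "(\<lambda>n. s * R n) \<longlonglongrightarrow> s * (0 - 1) / (1 - s) + (dirichlet_f s - 1 / (s - 1)) + (0 - 1)"
    unfolding sR using s01 by (intro tendsto_intros e0 p0 cs) auto
  then have "s * (\<integral>u. G u \<partial>lborel) = s * (0 - 1) / (1 - s) + (dirichlet_f s - 1 / (s - 1)) + (0 - 1)"
    using lim1 LIMSEQ_unique by blast
  also have "\<dots> = dirichlet_f s"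
  proof -
    have "1 - s \<noteq> 0" "s - 1 \<noteq> 0" using s01 by auto
    then show ?thesis by (simp add: divide_simps) (simp add: algebra_simps)
  qed
  finally show ?thesis by (simp add: G_eq)
qed

lemma norm_dirichlet_f_square:
  assumes s: "0 < s" "s < 1 / 2"
  shows "(norm (dirichlet_f (Complex s t)))\<^sup>2 = (s\<^sup>2 + t\<^sup>2) *
    ((\<integral>u. scaled_remainder s u * cos (t * u) \<partial>lborel)\<^sup>2 + (\<integral>u. scaled_remainder s u * sin (t * u) \<partial>lborel)\<^sup>2)"
proof -
  define J where "J = (\<integral>u. of_real (scaled_remainder s u) * cis (- t * u) \<partial>lborel)"
  have [measurable]: "(\<lambda>u. cis (- (t * u))) \<in> borel_measurable borel"
    by (intro borel_measurable_continuous_onI continuous_intros)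
  have i: "integrable lborel (\<lambda>u. of_real (scaled_remainder s u) * cis (- t * u))"
    by (rule Bochner_Integration.integrable_bound[OF integrable_scaled_remainder[OF s]]) (auto simp: norm_mult)
  have "Re J = (\<integral>u. Re (of_real (scaled_remainder s u) * cis (- t * u)) \<partial>lborel)"
    unfolding J_def by (rule integral_Re[OF i, symmetric])
  then have Re: "Re J = (\<integral>u. scaled_remainder s u * cos (t * u) \<partial>lborel)" by simp
  have "Im J = (\<integral>u. Im (of_real (scaled_remainder s u) * cis (- t * u)) \<partial>lborel)"
    unfolding J_def by (rule integral_Im[OF i, symmetric])
  then have Im: "Im J = - (\<integral>u. scaled_remainder s u * sin (t * u) \<partial>lborel)" by simp
  have "(norm (dirichlet_f (Complex s t)))\<^sup>2 = (norm (Complex s t))\<^sup>2 * (norm J)\<^sup>2"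
    using dirichlet_f_eq_integral[of "Complex s t"] s by (simp add: J_def norm_mult power_mult_distrib)
  then show ?thesis
    by (simp add: cmod_power2 Re Im)
qed

section \<open>Increments of the remainder\<close>

text \<open>With \<open>x = exp u\<close>, this is the difference of
  \<open>scaled_remainder s\<close> at \<open>u + v\<close> and \<open>u\<close>, freed from the
  common factor \<open>x powr (- s)\<close>.\<close>

definition dilation_diff :: "real \<Rightarrow> real \<Rightarrow> real \<Rightarrow> real"
  where "dilation_diff s v x = remainder (x * exp v) * exp (- s * v) - remainder x"

lemma dilation_diff_measurable [measurable]: "dilation_diff s v \<in> borel_measurable borel"
  unfolding dilation_diff_def[abs_def] by measurable

text \<open>The substitution \<open>x = exp u\<close>, whose Jacobian lowers the exponent by 1.
  Extended nonnegative values let the later decompositions proceed without integrability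
  conditions.\<close>

lemma ennreal_increment_eq:
  assumes s: "0 < s" "s < 1 / 2"
  shows "ennreal (increment (scaled_remainder s) v) =
    (\<integral>\<^sup>+x\<in>{0<..}. ennreal ((dilation_diff s v x)\<^sup>2 * x powr (- 2 * s - 1)) \<partial>lborel)"
proof -
  define g where "g = scaled_remainder s"
  have g_int: "integrable lborel g" and g_le: "\<bar>g u\<bar> \<le> 1" for u
    unfolding g_def using integrable_scaled_remainder[OF s] abs_scaled_remainder_le_1[OF s] by auto
  have [measurable]: "g \<in> borel_measurable borel" by (simp add: g_def)
  define \<Psi> where "\<Psi> x = (dilation_diff s v x)\<^sup>2 * x powr (- 2 * s - 1)" for x
  have [measurable]: "\<Psi> \<in> borel_measurable borel" unfolding \<Psi>_def[abs_def] by measurable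
  have \<Psi>_nonneg: "\<Psi> x \<ge> 0" for x by (simp add: \<Psi>_def)
  have eq: "(g (u + v) - g u)\<^sup>2 = \<bar>exp u\<bar> *\<^sub>R \<Psi> (exp u)" for u
  proof -
    have "g (u + v) - g u = exp (- s * u) * dilation_diff s v (exp u)"
      by (simp add: g_def scaled_remainder_def dilation_diff_def exp_add algebra_simps exp_minus exp_diff divide_simps)
    moreover have "exp u * exp u powr (- 2 * s - 1) = (exp (- s * u))\<^sup>2"
      by (simp add: powr_def exp_add[symmetric] power2_eq_square algebra_simps)
    ultimately show ?thesis
      by (simp add: \<Psi>_def power_mult_distrib mult_ac)
  qed
  have "integrable lborel (\<lambda>u. (g (u + v) - g u)\<^sup>2)"
  proof (rule Bochner_Integration.integrable_bound)
    show "integrable lborel (\<lambda>u. 2 * (\<bar>g (u + v)\<bar> + \<bar>g u\<bar>))"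
      using integrable_shift[OF g_int] g_int by simp
    have "(g (u + v) - g u)\<^sup>2 \<le> 2 * (\<bar>g (u + v)\<bar> + \<bar>g u\<bar>)" for u
    proof -
      have "\<bar>g (u + v) - g u\<bar> \<le> 2" "\<bar>g (u + v) - g u\<bar> \<le> \<bar>g (u + v)\<bar> + \<bar>g u\<bar>"
        using g_le[of u] g_le[of "u + v"] by linarith+
      then have "\<bar>g (u + v) - g u\<bar> * \<bar>g (u + v) - g u\<bar> \<le> 2 * (\<bar>g (u + v)\<bar> + \<bar>g u\<bar>)"
        by (intro mult_mono) auto
      then show ?thesis by (simp add: power2_eq_square)
    qed
    then show "AE u in lborel. norm ((g (u + v) - g u)\<^sup>2) \<le> norm (2 * (\<bar>g (u + v)\<bar> + \<bar>g u\<bar>))"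
      by simp
  qed simp
  from has_integral_integral_lborel[OF this] have "((\<lambda>u. (g (u + v) - g u)\<^sup>2) has_integral increment g v) UNIV"
    by (simp add: increment_def)
  then have hi: "((\<lambda>u. \<bar>exp u\<bar> *\<^sub>R \<Psi> (exp u)) has_integral increment g v) UNIV"
    unfolding eq .
  moreover have "(\<lambda>u. \<bar>exp u\<bar> *\<^sub>R \<Psi> (exp u)) absolutely_integrable_on UNIV"
    using hi by (intro nonnegative_absolutely_integrable_1) (auto simp: \<Psi>_def has_integral_integrable_integral)
  ultimately have "\<Psi> absolutely_integrable_on (exp ` UNIV) \<and> integral (exp ` UNIV) \<Psi> = increment g v"
    by (subst has_absolute_integral_change_of_variables_real[where h = exp, symmetric])
       (auto intro!: has_field_derivative_at_within DERIV_exp inj_onI simp: integral_unique)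
  moreover have "exp ` UNIV = {0::real<..}"
  proof safe
    fix x :: real assume "x > 0"
    then have "x = exp (ln x)" by simp
    then show "x \<in> range exp" by blast
  qed simp
  ultimately have "(\<Psi> has_integral increment g v) {0<..}"
    by (metis absolutely_integrable_on_def integrable_integral)
  then have "(\<integral>\<^sup>+x\<in>{0<..}. ennreal (\<Psi> x) \<partial>lborel) = ennreal (increment g v)"
    using \<Psi>_nonneg by (intro nn_integral_has_integral_lebesgue') auto
  then show ?thesis by (simp add: g_def \<Psi>_def)
qed

lemma dilation_diff_square_le_4:
  assumes "0 \<le> s" "0 \<le> v"
  shows "(dilation_diff s v x)\<^sup>2 \<le> 4"
proof -
  have "\<bar>remainder (x * exp v) * exp (- s * v)\<bar> \<le> 1 * 1"
    unfolding abs_mult using assms by (intro mult_mono abs_remainder_le) auto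
  then have "\<bar>dilation_diff s v x\<bar> \<le> 2"
    using abs_remainder_le[of x] unfolding dilation_diff_def by linarith
  then have "\<bar>dilation_diff s v x\<bar>\<^sup>2 \<le> 2\<^sup>2" by (intro power_mono) auto
  then show ?thesis by simp
qed

lemma exp_minus_1_le: "0 \<le> v \<Longrightarrow> v \<le> 1 \<Longrightarrow> exp v - 1 \<le> 2 * (v::real)"
proof -
  assume v: "0 \<le> v" "v \<le> 1"
  have "exp v \<le> 1 + v + v\<^sup>2" using v by (rule exp_bound)
  moreover have "v\<^sup>2 \<le> v" using v by (simp add: power2_eq_square mult_left_le)
  ultimately show ?thesis by linarith
qed

text \<open>Away from the jumps the difference is of order \<open>x * v\<close>; a jump between \<open>x\<close> and
  \<open>x * exp v\<close> forces \<open>1 - frac x \<le> 2 * x * v\<close>.\<close>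

lemma dilation_diff_square_le:
  assumes s: "0 < s" "s < 1 / 2" and v: "0 < v" "v \<le> 1" and x: "x > 0"
    and c: "0 \<le> c" "c \<le> 1"
  shows "(dilation_diff s v x)\<^sup>2 \<le> 8 * (x * v / (1 - frac x)) powr c"
proof -
  define b where "b = 1 - frac x"
  have b: "0 < b" "b \<le> 1" by (auto simp: b_def frac_lt_1 algebra_simps frac_ge_0)
  have ev: "v \<le> exp v - 1" "exp v - 1 \<le> 2 * v"
    using exp_minus_1_le[of v] v exp_ge_add_one_self[of v] by linarith+
  show ?thesis
  proof (cases "x * (exp v - 1) < b")
    case True
    have "x \<le> x * exp v" using x v by simp
    moreover have "x * exp v < of_int \<lfloor>x\<rfloor> + 1"
      using True by (simp add: b_def frac_def algebra_simps)
    ultimately have "\<lfloor>x * exp v\<rfloor> = \<lfloor>x\<rfloor>" by linarith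
    then have eq: "dilation_diff s v x = remainder x * (exp (- s * v) - 1) - x * (exp v - 1) * exp (- s * v)"
      by (simp add: dilation_diff_def remainder_def algebra_simps)
    have e: "\<bar>exp (- s * v) - 1\<bar> \<le> v / 2" "exp (- s * v) \<le> 1"
    proof -
      have "1 + (- s * v) \<le> exp (- s * v)" by (rule exp_ge_add_one_self)
      moreover have "s * v \<le> v / 2" using s v by simp
      moreover show "exp (- s * v) \<le> 1" using s v by simp
      ultimately show "\<bar>exp (- s * v) - 1\<bar> \<le> v / 2" by linarith
    qed
    have "\<bar>dilation_diff s v x\<bar> \<le> \<bar>remainder x\<bar> * \<bar>exp (- s * v) - 1\<bar> + x * (exp v - 1) * exp (- s * v)"
      unfolding eq using x ev v by (intro order_trans[OF abs_triangle_ineq4]) (simp add: abs_mult)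
    also have "\<dots> \<le> x * (v / 2) + x * (2 * v) * 1"
      using x ev v e abs_remainder_le_self[of x] by (intro add_mono mult_mono) auto
    finally have "\<bar>dilation_diff s v x\<bar> \<le> 5 / 2 * (x * v)" by (simp add: mult_ac)
    then have "\<bar>dilation_diff s v x\<bar>\<^sup>2 \<le> (5 / 2 * (x * v))\<^sup>2" by (intro power_mono) auto
    then have 1: "(dilation_diff s v x)\<^sup>2 \<le> 25 / 4 * (x * v)\<^sup>2" by (simp add: power_mult_distrib power2_eq_square)
    have xv: "x * v < b" "0 < x * v"
      using order_le_less_trans[OF mult_left_mono[OF ev(1), of x] True] x v by simp_all
    have "(x * v)\<^sup>2 \<le> x * v" using xv b by (simp add: power2_eq_square mult_left_le)
    also have "\<dots> \<le> x * v / b" using xv b by (simp add: le_divide_eq mult_left_le)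
    also have "\<dots> = (x * v / b) powr 1" using xv b by simp
    also have "\<dots> \<le> (x * v / b) powr c" using xv b c by (intro powr_mono') auto
    finally have "25 / 4 * (x * v)\<^sup>2 \<le> 8 * (x * v / b) powr c"
      using powr_ge_zero[of "x * v / b" c] by linarith
    then show ?thesis using 1 by (simp add: b_def)
  next
    case False
    then have "b \<le> x * (2 * v)" using mult_left_mono[OF ev(2), of x] x by linarith
    then have "1 / 2 \<le> x * v / b" using b by (simp add: field_simps)
    then have "(1 / 2) powr c \<le> (x * v / b) powr c" using c by (intro powr_mono2) auto
    moreover have "(1 / 2) powr 1 \<le> (1 / 2 :: real) powr c" using c by (intro powr_mono') auto
    \<comment> \<open>The factor 8 is fixed by the two cases: without a jump 25/4 is needed, and
      with a jump the ratio is at least 1/2, so 8 times its power still exceeds the trivial bound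
      4.\<close>
    ultimately have "4 \<le> 8 * (x * v / b) powr c" by simp
    then show ?thesis
      using dilation_diff_square_le_4[of s v x] s v by (simp add: b_def)
  qed
qed

section \<open>Power singularities and decomposition into blocks of length two\<close>

lemma integrable_abs_powr_Icc:
  fixes c p :: real
  assumes c: "0 \<le> c" "c \<le> 2" and p: "p < 1"
  shows "integrable lborel (\<lambda>x. indicator {0..2} x * \<bar>x - c\<bar> powr (- p))"
proof -
  define P where "P x = indicator {0..2} x * x powr (- p)" for x :: real
  have "((\<lambda>x. x powr (- p)) has_integral 2 powr (- p + 1) / (- p + 1)) {0..2}"
    using p by (intro has_integral_powr_from_0) auto
  then have "set_integrable lebesgue {0..2} (\<lambda>x. x powr (- p))"
    by (intro nonnegative_absolutely_integrable_1) auto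
  then have P: "integrable lborel P"
    unfolding P_def[abs_def] set_integrable_def by (subst (asm) integrable_completion) auto
  have 1: "integrable lborel (\<lambda>x. P (- c + 1 * x))" "integrable lborel (\<lambda>x. P (c + (-1) * x))"
    by (rule lborel_integrable_real_affine[OF P]; simp)+
  show ?thesis
    by (rule Bochner_Integration.integrable_bound[OF Bochner_Integration.integrable_add[OF 1]])
       (use c in \<open>auto simp: P_def indicator_def abs_if\<close>)
qed

text \<open>Turns a series into an integral over a continuous variable, so that rescaling the
  summation index becomes a substitution.\<close>

lemma nn_integral_ceiling:
  fixes H :: "nat \<Rightarrow> ennreal"
  shows "(\<integral>\<^sup>+y\<in>{0::real<..}. H (nat \<lceil>y\<rceil>) \<partial>lborel) = (\<Sum>n. H (Suc n))"
proof -
  have U: "(\<Union>n. {real n<..real (Suc n)}) = {0<..}"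
  proof safe
    fix y :: real assume "y > 0"
    then have "real (nat \<lceil>y\<rceil> - 1) < y" "y \<le> real (Suc (nat \<lceil>y\<rceil> - 1))" by linarith+
    then have "y \<in> {real (nat \<lceil>y\<rceil> - 1)<..real (Suc (nat \<lceil>y\<rceil> - 1))}" by simp
    then show "y \<in> (\<Union>n. {real n<..real (Suc n)})" by blast
  qed auto
  have "(\<integral>\<^sup>+y\<in>(\<Union>n. {real n<..real (Suc n)}). H (nat \<lceil>y\<rceil>) \<partial>lborel) =
      (\<Sum>n. \<integral>\<^sup>+y\<in>{real n<..real (Suc n)}. H (nat \<lceil>y\<rceil>) \<partial>lborel)"
  proof (rule nn_integral_disjoint_family)
    show "disjoint_family (\<lambda>n. {real n<..real (Suc n)})"
      by (auto simp: disjoint_family_on_def)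
  qed measurable
  moreover have "(\<integral>\<^sup>+y\<in>{real n<..real (Suc n)}. H (nat \<lceil>y\<rceil>) \<partial>lborel) = H (Suc n)" for n
  proof -
    have "nat \<lceil>y\<rceil> = Suc n" if "real n < y" "y \<le> real (Suc n)" for y
      using that by (simp add: ceiling_eq_iff[of y "int n + 1", THEN iffD2])
    then have "(\<integral>\<^sup>+y\<in>{real n<..real (Suc n)}. H (nat \<lceil>y\<rceil>) \<partial>lborel) =
       (\<integral>\<^sup>+y. H (Suc n) * indicator {real n<..real (Suc n)} y \<partial>lborel)"
      by (intro nn_integral_cong) (auto simp: indicator_def)
    then show ?thesis by (simp add: nn_integral_cmult_indicator)
  qed
  ultimately show ?thesis by (simp only: U)
qed

text \<open>The length 2 is a common period of the two limiting sawtooths. The block at 0 is left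
  out, because the weight in \<open>x\<close> is singular there and needs its own estimate.\<close>

lemma nn_integral_blocks:
  fixes h :: "real \<Rightarrow> ennreal"
  assumes [measurable]: "h \<in> borel_measurable borel"
  shows "(\<integral>\<^sup>+x\<in>{2..}. h x \<partial>lborel) = (\<Sum>n. \<integral>\<^sup>+a\<in>{0..<2}. h (2 * real (Suc n) + a) \<partial>lborel)"
proof -
  have U: "(\<Union>n. {2 * real (Suc n)..<2 * real (Suc n) + 2}) = {2..}"
  proof safe
    fix x :: real assume x: "x \<ge> 2"
    define n where "n = nat \<lfloor>x / 2\<rfloor> - 1"
    have "1 \<le> \<lfloor>x / 2\<rfloor>" using x by linarith
    then have n: "real (Suc n) = of_int \<lfloor>x / 2\<rfloor>" unfolding n_def by simp
    have "2 * real (Suc n) \<le> x" "x < 2 * real (Suc n) + 2" unfolding n by linarith+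
    then have "x \<in> {2 * real (Suc n)..<2 * real (Suc n) + 2}" by simp
    then show "x \<in> (\<Union>n. {2 * real (Suc n)..<2 * real (Suc n) + 2})" by blast
  qed auto
  have "(\<integral>\<^sup>+x\<in>(\<Union>n. {2 * real (Suc n)..<2 * real (Suc n) + 2}). h x \<partial>lborel) =
      (\<Sum>n. \<integral>\<^sup>+x\<in>{2 * real (Suc n)..<2 * real (Suc n) + 2}. h x \<partial>lborel)"
  proof (rule nn_integral_disjoint_family)
    show "disjoint_family (\<lambda>n. {2 * real (Suc n)..<2 * real (Suc n) + 2})"
      by (auto simp: disjoint_family_on_def)
  qed measurable
  moreover have "(\<integral>\<^sup>+x\<in>{2 * real (Suc n)..<2 * real (Suc n) + 2}. h x \<partial>lborel) =
      (\<integral>\<^sup>+a\<in>{0..<2}. h (2 * real (Suc n) + a) \<partial>lborel)" for n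
  proof -
    have "(\<integral>\<^sup>+x\<in>{2 * real (Suc n)..<2 * real (Suc n) + 2}. h x \<partial>lborel) =
       ennreal \<bar>1\<bar> * (\<integral>\<^sup>+a. h (2 * real (Suc n) + 1 * a) * indicator {2 * real (Suc n)..<2 * real (Suc n) + 2} (2 * real (Suc n) + 1 * a) \<partial>lborel)"
      by (rule nn_integral_real_affine) auto
    also have "\<dots> = (\<integral>\<^sup>+a\<in>{0..<2}. h (2 * real (Suc n) + a) \<partial>lborel)"
      by (auto simp: indicator_def intro!: nn_integral_cong)
    finally show ?thesis .
  qed
  ultimately show ?thesis by (simp only: U)
qed

text \<open>Separates the position in the block, \<open>a\<close>, from the scale, \<open>y\<close>.
  With \<open>c = 1 / (2 * v)\<close> the block at scale \<open>y\<close> starts near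
  \<open>y / v\<close>, so that scale and phase decouple as \<open>v\<close> tends to 0.\<close>

lemma nn_integral_average:
  fixes h :: "real \<Rightarrow> ennreal"
  assumes [measurable]: "h \<in> borel_measurable borel" and c: "c > 0"
  shows "(\<integral>\<^sup>+x\<in>{2..}. h x \<partial>lborel) =
    ennreal c * (\<integral>\<^sup>+y\<in>{0::real<..}. (\<integral>\<^sup>+a\<in>{0..<2}. h (2 * real (nat \<lceil>c * y\<rceil>) + a) \<partial>lborel) \<partial>lborel)"
proof -
  have "(\<integral>\<^sup>+x\<in>{2..}. h x \<partial>lborel) =
     (\<integral>\<^sup>+y\<in>{0::real<..}. (\<integral>\<^sup>+a\<in>{0..<2}. h (2 * real (nat \<lceil>y\<rceil>) + a) \<partial>lborel) \<partial>lborel)"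
    unfolding nn_integral_blocks[OF assms(1)] by (rule nn_integral_ceiling[symmetric])
  also have "\<dots> = ennreal \<bar>c\<bar> * (\<integral>\<^sup>+y. (\<integral>\<^sup>+a\<in>{0..<2}. h (2 * real (nat \<lceil>0 + c * y\<rceil>) + a) \<partial>lborel) * indicator {0<..} (0 + c * y) \<partial>lborel)"
    using c by (intro nn_integral_real_affine) auto
  also have "\<dots> = ennreal c * (\<integral>\<^sup>+y\<in>{0::real<..}. (\<integral>\<^sup>+a\<in>{0..<2}. h (2 * real (nat \<lceil>c * y\<rceil>) + a) \<partial>lborel) \<partial>lborel)"
    using c by (intro arg_cong2[where f = "(*)"] nn_integral_cong) (auto simp: indicator_def zero_less_mult_iff)
  finally show ?thesis .
qed

text \<open>An integrable majorant on \<open>{0..2}\<close> for \<open>(1 - frac x) powr (- p)\<close> and \<open>x powr (- p) * (1 - frac x) powr (- p)\<close>.\<close>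

definition singular_weight :: "real \<Rightarrow> real \<Rightarrow> real"
  where "singular_weight p x = (\<Sum>c\<in>{0, 1, 2}. \<bar>x - c\<bar> powr (- p))"

lemma singular_weight_measurable [measurable]: "singular_weight p \<in> borel_measurable borel"
  unfolding singular_weight_def[abs_def] by measurable

lemma singular_weight_nonneg: "singular_weight p x \<ge> 0"
  by (simp add: singular_weight_def)

lemma integrable_singular_weight:
  assumes "p < 1"
  shows "integrable lborel (\<lambda>x. indicator {0..2} x * singular_weight p x)"
  unfolding singular_weight_def sum_distrib_left
  using assms by (intro Bochner_Integration.integrable_sum integrable_abs_powr_Icc) auto

lemma nn_integral_singular_weight_finite:
  assumes "p < 1"
  shows "(\<integral>\<^sup>+x\<in>{0..<2}. ennreal (singular_weight p x) \<partial>lborel) < \<infinity>"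
proof -
  have "(\<integral>\<^sup>+x\<in>{0..<2}. ennreal (singular_weight p x) \<partial>lborel) \<le> (\<integral>\<^sup>+x. ennreal (norm (indicator {0..2} x * singular_weight p x)) \<partial>lborel)"
    by (intro nn_integral_mono) (auto simp: indicator_def singular_weight_nonneg)
  also have "\<dots> < \<infinity>"
    using integrable_singular_weight[OF assms] unfolding integrable_iff_bounded by blast
  finally show ?thesis .
qed

lemma powr_one_minus_frac_le:
  assumes "0 \<le> a" "a < 2"
  shows "(1 - frac a) powr (- p) \<le> singular_weight p a"
proof (cases "a < 1")
  case True
  then have "frac a = a" using assms by (simp add: frac_eq)
  then show ?thesis using True by (simp add: singular_weight_def)
next
  case False
  then have "frac a = a - 1" using assms by (simp add: frac_unique_iff)
  then show ?thesis using False assms by (simp add: singular_weight_def)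
qed

text \<open>Below 1 the singularities of the two factors lie at distance 1 from each other, so at
  least one factor has a base of at least 1/2 and is at most 2. From 1 on the first factor is at
  most 1.\<close>

lemma powr_frac_powr_le:
  assumes x: "0 < x" "x < 2" and p: "0 \<le> p" "p \<le> 1"
  shows "x powr (- p) * (1 - frac x) powr (- p) \<le> 2 * singular_weight p x"
proof (cases "x < 1")
  case True
  then have f: "frac x = x" using x by (simp add: frac_eq)
  have half: "y powr (- p) \<le> 2" if "1 / 2 \<le> y" for y :: real
  proof -
    have "y powr (- p) \<le> (1 / 2) powr (- p)" using that p by (intro powr_mono2') auto
    also have "\<dots> \<le> (1 / 2) powr (- 1)" using p by (intro powr_mono') auto
    finally show ?thesis by (simp add: powr_minus)
  qed
  have w: "x powr (- p) \<le> singular_weight p x" "(1 - x) powr (- p) \<le> singular_weight p x"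
    using x True by (auto simp: singular_weight_def)
  show ?thesis
  proof (cases "x \<le> 1 / 2")
    case True
    then have "x powr (- p) * (1 - x) powr (- p) \<le> singular_weight p x * 2"
      using w by (intro mult_mono half singular_weight_nonneg) auto
    then show ?thesis by (simp add: f)
  next
    case False
    then have "x powr (- p) * (1 - x) powr (- p) \<le> 2 * singular_weight p x"
      using w by (intro mult_mono half singular_weight_nonneg) auto
    then show ?thesis by (simp add: f)
  qed
next
  case False
  then have "x powr (- p) \<le> 1" using p by (subst powr_minus) (simp add: inverse_le_1_iff ge_one_powr_ge_zero)
  then have "x powr (- p) * (1 - frac x) powr (- p) \<le> 1 * singular_weight p x"
    using powr_one_minus_frac_le[of x p] x by (intro mult_mono) (auto simp: singular_weight_nonneg)
  also have "\<dots> \<le> 2 * singular_weight p x" using singular_weight_nonneg[of p x] by simp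
  finally show ?thesis .
qed

lemma nn_integral_powr_tail_finite:
  fixes p r :: real
  assumes "p < 1" "r > 1"
  shows "(\<integral>\<^sup>+y\<in>{0<..}. ennreal (if y \<le> 1 then y powr (- p) else y powr (- r)) \<partial>lborel) < \<infinity>"
proof -
  have 1: "((\<lambda>y. y powr (- p)) has_integral 1 powr (- p + 1) / (- p + 1)) {0..1::real}"
    using assms by (intro has_integral_powr_from_0) auto
  have 2: "((\<lambda>y. y powr (- r)) has_integral - (1 powr (- r + 1)) / (- r + 1)) {1::real..}"
    using assms by (intro has_integral_powr_to_inf) auto
  have "(\<integral>\<^sup>+y\<in>{0<..}. ennreal (if y \<le> 1 then y powr (- p) else y powr (- r)) \<partial>lborel) \<le>
    (\<integral>\<^sup>+y. ennreal (y powr (- p)) * indicator {0..1} y + ennreal (y powr (- r)) * indicator {1..} y \<partial>lborel)"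
    by (intro nn_integral_mono) (auto simp: indicator_def)
  also have "\<dots> = (\<integral>\<^sup>+y\<in>{0..1}. ennreal (y powr (- p)) \<partial>lborel) + (\<integral>\<^sup>+y\<in>{1..}. ennreal (y powr (- r)) \<partial>lborel)"
    by (rule nn_integral_add) measurable
  also have "\<dots> < \<infinity>"
    using nn_integral_has_integral_lebesgue'[OF _ 1] nn_integral_has_integral_lebesgue'[OF _ 2] by simp
  finally show ?thesis .
qed

text \<open>The exponent \<open>s + 1 / 2\<close> is the midpoint between \<open>2 * s\<close> and
  1. Above \<open>2 * s\<close> it makes this part negligible against \<open>v powr (2 * s)\<close>;
  below 1 it keeps the singularity at each jump integrable; and it leaves the same exponent, with a
  minus sign, on \<open>x\<close> at 0.\<close>

lemma dilation_diff_near_0: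
  assumes s: "0 < s" "s < 1 / 2" and v: "0 < v" "v \<le> 1"
  shows "(\<integral>\<^sup>+x\<in>{0<..<2}. ennreal ((dilation_diff s v x)\<^sup>2 * x powr (- 2 * s - 1)) \<partial>lborel) \<le>
    ennreal (16 * v powr (s + 1 / 2)) * (\<integral>\<^sup>+x\<in>{0..<2}. ennreal (singular_weight (s + 1 / 2) x) \<partial>lborel)"
proof -
  have "(dilation_diff s v x)\<^sup>2 * x powr (- 2 * s - 1) \<le> 16 * v powr (s + 1 / 2) * singular_weight (s + 1 / 2) x"
    if x: "0 < x" "x < 2" for x
  proof -
    have b: "1 - frac x > 0" by (simp add: frac_lt_1)
    have "(dilation_diff s v x)\<^sup>2 * x powr (- 2 * s - 1) \<le> 8 * (x * v / (1 - frac x)) powr (s + 1 / 2) * x powr (- 2 * s - 1)"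
      using dilation_diff_square_le[OF s v x(1), of "s + 1 / 2"] s by (intro mult_right_mono) auto
    also have "\<dots> = 8 * v powr (s + 1 / 2) * ((x powr (s + 1 / 2) * x powr (- 2 * s - 1)) * (1 - frac x) powr (- (s + 1 / 2)))"
      using x v b unfolding powr_minus_divide[of "1 - frac x" "s + 1 / 2"] by (simp add: powr_mult powr_divide)
    also have "x powr (s + 1 / 2) * x powr (- 2 * s - 1) = x powr (- (s + 1 / 2))"
      by (simp add: powr_add[symmetric])
    also have "8 * v powr (s + 1 / 2) * (x powr (- (s + 1 / 2)) * (1 - frac x) powr (- (s + 1 / 2))) \<le>
      8 * v powr (s + 1 / 2) * (2 * singular_weight (s + 1 / 2) x)"
      using x s by (intro mult_left_mono powr_frac_powr_le) auto
    finally show ?thesis by simp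
  qed
  then have "(\<integral>\<^sup>+x\<in>{0<..<2}. ennreal ((dilation_diff s v x)\<^sup>2 * x powr (- 2 * s - 1)) \<partial>lborel) \<le>
    (\<integral>\<^sup>+x. ennreal (16 * v powr (s + 1 / 2)) * (ennreal (singular_weight (s + 1 / 2) x) * indicator {0..<2} x) \<partial>lborel)"
    by (intro nn_integral_mono)
       (auto simp: indicator_def ennreal_mult[symmetric] singular_weight_nonneg)
  also have "\<dots> = ennreal (16 * v powr (s + 1 / 2)) * (\<integral>\<^sup>+x\<in>{0..<2}. ennreal (singular_weight (s + 1 / 2) x) \<partial>lborel)"
    by (rule nn_integral_cmult) measurable
  finally show ?thesis .
qed

section \<open>Block coordinates: scale \<open>y\<close> and phase \<open>a\<close>\<close>

definition block_point :: "real \<Rightarrow> real \<Rightarrow> real \<Rightarrow> real"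
  where "block_point v y a = 2 * real (nat \<lceil>1 / (2 * v) * y\<rceil>) + a"

text \<open>The integrand of the increment in the coordinates \<open>y\<close> and \<open>a\<close>,
  multiplied by \<open>v powr (- 2 * s - 1)\<close>, so that the power is taken of
  \<open>x * v\<close>, a quantity close to \<open>y\<close>.\<close>

definition block_integrand :: "real \<Rightarrow> real \<Rightarrow> real \<Rightarrow> real \<Rightarrow> real"
  where "block_integrand s v y a =
    (block_point v y a * v) powr (- 2 * s - 1) * (dilation_diff s v (block_point v y a))\<^sup>2"

lemma block_integrand_measurable [measurable]:
  "(\<lambda>(y, a). block_integrand s v y a) \<in> borel_measurable (borel \<Otimes>\<^sub>M borel)"
  unfolding block_integrand_def block_point_def by measurable

text \<open>Rounding the block number up makes \<open>y\<close> a lower bound, so negative powers of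
  \<open>x * v\<close> are dominated by those of \<open>y\<close>. The rounding and the phase each
  cost at most \<open>2 * v\<close>.\<close>

lemma block_point_bounds:
  assumes "0 < v" "0 < y" "0 \<le> a" "a < 2"
  shows "y \<le> block_point v y a * v" "block_point v y a * v \<le> y + 4 * v"
proof -
  have "1 / (2 * v) * y > 0" using assms by simp
  then have "1 / (2 * v) * y \<le> real (nat \<lceil>1 / (2 * v) * y\<rceil>)" "real (nat \<lceil>1 / (2 * v) * y\<rceil>) \<le> 1 / (2 * v) * y + 1"
    by linarith+
  then have "(1 / (2 * v) * y) * (2 * v) \<le> real (nat \<lceil>1 / (2 * v) * y\<rceil>) * (2 * v)"
    "real (nat \<lceil>1 / (2 * v) * y\<rceil>) * (2 * v) \<le> (1 / (2 * v) * y + 1) * (2 * v)"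
    using assms by (intro mult_right_mono; simp)+
  then have 1: "y \<le> real (nat \<lceil>1 / (2 * v) * y\<rceil>) * (2 * v)" "real (nat \<lceil>1 / (2 * v) * y\<rceil>) * (2 * v) \<le> y + 2 * v"
    using assms by (simp_all add: algebra_simps)
  moreover have "0 \<le> a * v" "a * v \<le> 2 * v" using assms by auto
  moreover have "block_point v y a * v = real (nat \<lceil>1 / (2 * v) * y\<rceil>) * (2 * v) + a * v"
    by (simp add: block_point_def algebra_simps)
  ultimately show "y \<le> block_point v y a * v" "block_point v y a * v \<le> y + 4 * v" by linarith+
qed

lemma frac_block_point: "frac (block_point v y a) = frac a"
proof -
  have "block_point v y a = of_int (2 * int (nat \<lceil>1 / (2 * v) * y\<rceil>)) + a"
    by (simp add: block_point_def)
  then show ?thesis by (metis frac_add_of_int_left)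
qed

text \<open>The exponent is below 1 near 0 and above 1 at infinity, so both ends are integrable. The
  first branch comes from the bound with the power \<open>s + 1 / 2\<close>, the second from the
  trivial bound 4.\<close>

definition majorant :: "real \<Rightarrow> real \<Rightarrow> real"
  where "majorant s y = (if y \<le> 1 then y powr (- (s + 1 / 2)) else y powr (- (2 * s + 1)))"

text \<open>The bound is a product of a function of \<open>y\<close> and a function of
  \<open>a\<close>, uniform in \<open>v\<close>, so dominated convergence can be applied in each
  variable in turn. The added 1 covers \<open>y > 1\<close>, where no singular weight is
  produced.\<close>

lemma block_integrand_le:
  assumes s: "0 < s" "s < 1 / 2" and v: "0 < v" "v \<le> 1" and y: "0 < y" and a: "0 \<le> a" "a < 2"
  shows "block_integrand s v y a \<le> majorant s y * (8 * (singular_weight (s + 1 / 2) a + 1))"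
proof -
  define X where "X = block_point v y a"
  have Xv: "y \<le> X * v" using block_point_bounds[OF v(1) y a] by (simp add: X_def)
  then have X: "X > 0" using v y by (metis less_le_trans zero_less_mult_pos2)
  have w: "singular_weight (s + 1 / 2) a \<ge> 0" by (rule singular_weight_nonneg)
  show ?thesis
  proof (cases "y \<le> 1")
    case True
    have b: "1 - frac a > 0" by (simp add: frac_lt_1)
    have "block_integrand s v y a \<le> (X * v) powr (- 2 * s - 1) * (8 * (X * v / (1 - frac a)) powr (s + 1 / 2))"
      using dilation_diff_square_le[OF s v X, of "s + 1 / 2"] s
      by (auto simp: block_integrand_def X_def frac_block_point intro!: mult_left_mono)
    also have "\<dots> = 8 * (((X * v) powr (- 2 * s - 1) * (X * v) powr (s + 1 / 2)) * (1 - frac a) powr (- (s + 1 / 2)))"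
      using X v b unfolding powr_minus_divide[of "1 - frac a" "s + 1 / 2"] by (simp add: powr_divide)
    also have "(X * v) powr (- 2 * s - 1) * (X * v) powr (s + 1 / 2) = (X * v) powr (- (s + 1 / 2))"
      by (simp add: powr_add[symmetric])
    also have "8 * ((X * v) powr (- (s + 1 / 2)) * (1 - frac a) powr (- (s + 1 / 2))) \<le>
      8 * (y powr (- (s + 1 / 2)) * singular_weight (s + 1 / 2) a)"
      using Xv y s a by (intro mult_left_mono mult_mono powr_mono2' powr_one_minus_frac_le) auto
    also have "\<dots> \<le> majorant s y * (8 * (singular_weight (s + 1 / 2) a + 1))"
      using True w by (simp add: majorant_def algebra_simps)
    finally show ?thesis .
  next
    case False
    have "block_integrand s v y a \<le> (X * v) powr (- 2 * s - 1) * 4"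
      using dilation_diff_square_le_4[of s v X] s v
      by (auto simp: block_integrand_def X_def intro!: mult_left_mono)
    also have "\<dots> \<le> y powr (- 2 * s - 1) * (8 * (singular_weight (s + 1 / 2) a + 1))"
      using Xv y s w by (intro mult_mono powr_mono2') auto
    finally show ?thesis using False by (simp add: majorant_def)
  qed
qed

lemma nn_integral_majorant_finite:
  assumes "0 < s" "s < 1 / 2"
  shows "(\<integral>\<^sup>+y\<in>{0<..}. ennreal (majorant s y) \<partial>lborel) < \<infinity>"
  unfolding majorant_def using assms by (intro nn_integral_powr_tail_finite) auto

lemma majorant_nonneg: "majorant s y \<ge> 0"
  by (simp add: majorant_def)

lemma majorant_measurable [measurable]: "majorant s \<in> borel_measurable borel"
  unfolding majorant_def[abs_def] by measurable

definition block_weight :: "real \<Rightarrow> ennreal"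
  where "block_weight s = (\<integral>\<^sup>+a\<in>{0..<2}. ennreal (8 * (singular_weight (s + 1 / 2) a + 1)) \<partial>lborel)"

lemma block_weight_finite:
  assumes s: "0 < s" "s < 1 / 2"
  shows "block_weight s < \<infinity>"
proof -
  have "block_weight s = (\<integral>\<^sup>+a. ennreal 8 * (ennreal (singular_weight (s + 1 / 2) a) * indicator {0..<2} a + indicator {0..<2} a) \<partial>lborel)"
  proof -
    have "ennreal (8 * (w + 1)) = ennreal 8 * (ennreal w + 1)" if "w \<ge> 0" for w
      using that by (subst ennreal_mult) auto
    from this[OF singular_weight_nonneg] show ?thesis
      unfolding block_weight_def by (simp only: distrib_right mult.assoc mult_1_left)
  qed
  also have "\<dots> = ennreal 8 * ((\<integral>\<^sup>+a\<in>{0..<2}. ennreal (singular_weight (s + 1 / 2) a) \<partial>lborel) + (\<integral>\<^sup>+a. indicator {0..<2::real} a \<partial>lborel))"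
    by (subst nn_integral_cmult, measurable, subst nn_integral_add) auto
  also have "\<dots> < \<infinity>"
    using nn_integral_singular_weight_finite[of "s + 1 / 2"] s by (simp add: ennreal_mult_less_top)
  finally show ?thesis .
qed

lemma inner_integral_le:
  assumes s: "0 < s" "s < 1 / 2" and v: "0 < v" "v \<le> 1" and y: "0 < y"
  shows "(\<integral>\<^sup>+a\<in>{0..<2}. ennreal (block_integrand s v y a) \<partial>lborel) \<le> ennreal (majorant s y) * block_weight s"
proof -
  have "(\<integral>\<^sup>+a\<in>{0..<2}. ennreal (block_integrand s v y a) \<partial>lborel) \<le>
      (\<integral>\<^sup>+a. ennreal (majorant s y) * (ennreal (8 * (singular_weight (s + 1 / 2) a + 1)) * indicator {0..<2} a) \<partial>lborel)"
  proof (intro nn_integral_mono)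
    fix a :: real
    have le: "ennreal (block_integrand s v y a) \<le> ennreal (majorant s y) * ennreal (8 * (singular_weight (s + 1 / 2) a + 1))"
      if "0 \<le> a" "a < 2"
      unfolding ennreal_mult'[OF majorant_nonneg, symmetric]
      using that by (intro ennreal_leI block_integrand_le s v y)
    show "ennreal (block_integrand s v y a) * indicator {0..<2} a \<le>
      ennreal (majorant s y) * (ennreal (8 * (singular_weight (s + 1 / 2) a + 1)) * indicator {0..<2} a)"
    proof (cases "a \<in> {0..<2}")
      case True
      then show ?thesis using le by (simp only: indicator_simps mult_1_right atLeastLessThan_iff)
    next
      case False
      then show ?thesis by (simp del: ennreal_plus)
    qed
  qed
  also have "\<dots> = ennreal (majorant s y) * block_weight s"
    unfolding block_weight_def by (rule nn_integral_cmult) measurable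
  finally show ?thesis .
qed

text \<open>The Jacobian \<open>1 / (2 * v)\<close> and the normalisation
  \<open>v powr (- 2 * s)\<close> combine to the factor already built into
  \<open>block_integrand\<close>. The identity is exact; \<open>v\<close> remains only inside the
  integrand, where the limit is taken later.\<close>

lemma nn_integral_increment_far:
  assumes v: "0 < v"
  shows "ennreal (v powr (- 2 * s)) * (\<integral>\<^sup>+x\<in>{2..}. ennreal ((dilation_diff s v x)\<^sup>2 * x powr (- 2 * s - 1)) \<partial>lborel) =
    ennreal (1 / 2) * (\<integral>\<^sup>+y\<in>{0<..}. (\<integral>\<^sup>+a\<in>{0..<2}. ennreal (block_integrand s v y a) \<partial>lborel) \<partial>lborel)"
proof -
  define h where "h x = ennreal ((dilation_diff s v x)\<^sup>2 * x powr (- 2 * s - 1))" for x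
  have [measurable]: "h \<in> borel_measurable borel" unfolding h_def[abs_def] by measurable
  define H where "H y = (\<integral>\<^sup>+a\<in>{0..<2}. h (block_point v y a) \<partial>lborel)" for y
  have [measurable]: "H \<in> borel_measurable borel" unfolding H_def[abs_def] block_point_def by measurable
  have eq: "ennreal (v powr (- 2 * s - 1)) * h (block_point v y a) = ennreal (block_integrand s v y a)"
    if "0 < y" "0 \<le> a" "a < 2" for y a
  proof -
    have "block_point v y a * v > 0" using block_point_bounds[of v y a] v that by linarith
    then have "block_point v y a > 0" using v by (simp add: zero_less_mult_iff)
    then have "(block_point v y a * v) powr (- 2 * s - 1) = block_point v y a powr (- 2 * s - 1) * v powr (- 2 * s - 1)"
      using v by (simp add: powr_mult)
    then show ?thesis
      by (simp add: h_def block_integrand_def ennreal_mult[symmetric] mult_ac)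
  qed
  have eq2: "ennreal (v powr (- 2 * s - 1)) * (H y * indicator {0<..} y) =
      (\<integral>\<^sup>+a\<in>{0..<2}. ennreal (block_integrand s v y a) \<partial>lborel) * indicator {0<..} y" for y
  proof (cases "y > 0")
    case True
    have "ennreal (v powr (- 2 * s - 1)) * H y = (\<integral>\<^sup>+a. ennreal (v powr (- 2 * s - 1)) * (h (block_point v y a) * indicator {0..<2} a) \<partial>lborel)"
      unfolding H_def block_point_def by (rule nn_integral_cmult[symmetric]) measurable
    also have "\<dots> = (\<integral>\<^sup>+a\<in>{0..<2}. ennreal (block_integrand s v y a) \<partial>lborel)"
      using eq[OF True] by (intro nn_integral_cong) (auto simp: indicator_def)
    finally show ?thesis using True by simp
  qed simp
  have "v powr (- 2 * s) * (1 / (2 * v)) = 1 / 2 * v powr (- 2 * s - 1)"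
    using v by (simp add: powr_diff)
  then have c: "ennreal (v powr (- 2 * s)) * ennreal (1 / (2 * v)) = ennreal (1 / 2) * ennreal (v powr (- 2 * s - 1))"
    using ennreal_mult'[of "v powr (- 2 * s)" "1 / (2 * v)"] ennreal_mult'[of "1 / 2" "v powr (- 2 * s - 1)"]
    by (simp only: powr_ge_zero zero_le_divide_1_iff zero_le_numeral)
  have "ennreal (v powr (- 2 * s)) * (\<integral>\<^sup>+x\<in>{2..}. h x \<partial>lborel) =
     ennreal (v powr (- 2 * s)) * (ennreal (1 / (2 * v)) * (\<integral>\<^sup>+y\<in>{0<..}. H y \<partial>lborel))"
    unfolding H_def block_point_def using v by (subst nn_integral_average[where c = "1 / (2 * v)"]) auto
  also have "\<dots> = ennreal (1 / 2) * (ennreal (v powr (- 2 * s - 1)) * (\<integral>\<^sup>+y\<in>{0<..}. H y \<partial>lborel))"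
    by (simp only: mult.assoc[symmetric] c)
  also have "ennreal (v powr (- 2 * s - 1)) * (\<integral>\<^sup>+y\<in>{0<..}. H y \<partial>lborel) =
    (\<integral>\<^sup>+y\<in>{0<..}. (\<integral>\<^sup>+a\<in>{0..<2}. ennreal (block_integrand s v y a) \<partial>lborel) \<partial>lborel)"
    unfolding eq2[symmetric] by (rule nn_integral_cmult[symmetric]) measurable
  finally show ?thesis by (simp add: h_def)
qed

lemma scaled_increment_eq:
  assumes s: "0 < s" "s < 1 / 2" and v: "0 < v"
  shows "ennreal (v powr (- 2 * s) * increment (scaled_remainder s) v) =
    ennreal (v powr (- 2 * s)) * (\<integral>\<^sup>+x\<in>{0<..<2}. ennreal ((dilation_diff s v x)\<^sup>2 * x powr (- 2 * s - 1)) \<partial>lborel) +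
    ennreal (1 / 2) * (\<integral>\<^sup>+y\<in>{0<..}. (\<integral>\<^sup>+a\<in>{0..<2}. ennreal (block_integrand s v y a) \<partial>lborel) \<partial>lborel)"
proof -
  define h where "h x = ennreal ((dilation_diff s v x)\<^sup>2 * x powr (- 2 * s - 1))" for x
  have [measurable]: "h \<in> borel_measurable borel" unfolding h_def[abs_def] by measurable
  have "ennreal (increment (scaled_remainder s) v) = (\<integral>\<^sup>+x. h x * indicator {0<..<2} x + h x * indicator {2..} x \<partial>lborel)"
    unfolding ennreal_increment_eq[OF s] h_def by (intro nn_integral_cong) (auto simp: indicator_def)
  also have "\<dots> = (\<integral>\<^sup>+x\<in>{0<..<2}. h x \<partial>lborel) + (\<integral>\<^sup>+x\<in>{2..}. h x \<partial>lborel)"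
    by (rule nn_integral_add) measurable
  finally show ?thesis
    unfolding nn_integral_increment_far[OF v, symmetric] h_def
    by (simp add: ennreal_mult' distrib_left)
qed

text \<open>The exponent is \<open>(s + 1 / 2) - 2 * s\<close>, positive for
  \<open>s < 1 / 2\<close>, so this contribution vanishes with \<open>v\<close>.\<close>

lemma scaled_near_0_le:
  assumes s: "0 < s" "s < 1 / 2" and v: "0 < v" "v \<le> 1"
  shows "ennreal (v powr (- 2 * s)) * (\<integral>\<^sup>+x\<in>{0<..<2}. ennreal ((dilation_diff s v x)\<^sup>2 * x powr (- 2 * s - 1)) \<partial>lborel) \<le>
    ennreal (v powr (1 / 2 - s)) * (2 * block_weight s)"
proof -
  have "v powr (- 2 * s) * (16 * v powr (s + 1 / 2)) = v powr (1 / 2 - s) * 16"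
    by (simp add: powr_add[symmetric])
  then have c: "ennreal (v powr (- 2 * s)) * ennreal (16 * v powr (s + 1 / 2)) = ennreal (v powr (1 / 2 - s)) * ennreal 16"
    by (metis ennreal_mult' powr_ge_zero)
  have "ennreal (v powr (- 2 * s)) * (\<integral>\<^sup>+x\<in>{0<..<2}. ennreal ((dilation_diff s v x)\<^sup>2 * x powr (- 2 * s - 1)) \<partial>lborel)
    \<le> ennreal (v powr (- 2 * s)) * (ennreal (16 * v powr (s + 1 / 2)) * (\<integral>\<^sup>+x\<in>{0..<2}. ennreal (singular_weight (s + 1 / 2) x) \<partial>lborel))"
    by (intro mult_left_mono dilation_diff_near_0 s v) auto
  also have "\<dots> = ennreal (v powr (1 / 2 - s)) * (ennreal 16 * (\<integral>\<^sup>+x\<in>{0..<2}. ennreal (singular_weight (s + 1 / 2) x) \<partial>lborel))"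
    by (simp only: mult.assoc[symmetric] c)
  finally have 1: "ennreal (v powr (- 2 * s)) * (\<integral>\<^sup>+x\<in>{0<..<2}. ennreal ((dilation_diff s v x)\<^sup>2 * x powr (- 2 * s - 1)) \<partial>lborel) \<le>
    ennreal (v powr (1 / 2 - s)) * (ennreal 16 * (\<integral>\<^sup>+x\<in>{0..<2}. ennreal (singular_weight (s + 1 / 2) x) \<partial>lborel))" .
  have "ennreal 16 * (\<integral>\<^sup>+x\<in>{0..<2}. ennreal (singular_weight (s + 1 / 2) x) \<partial>lborel) =
     (\<integral>\<^sup>+x. ennreal 16 * (ennreal (singular_weight (s + 1 / 2) x) * indicator {0..<2} x) \<partial>lborel)"
    by (rule nn_integral_cmult[symmetric]) measurable
  also have "\<dots> \<le> (\<integral>\<^sup>+a. 2 * (ennreal (8 * (singular_weight (s + 1 / 2) a + 1)) * indicator {0..<2} a) \<partial>lborel)"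
  proof (intro nn_integral_mono)
    fix x :: real
    have "ennreal 16 * ennreal (singular_weight (s + 1 / 2) x) \<le> ennreal 2 * ennreal (8 * (singular_weight (s + 1 / 2) x + 1))"
      by (simp only: ennreal_mult'[symmetric]) (auto simp: singular_weight_nonneg ennreal_mult'[symmetric] intro!: ennreal_leI)
    then show "ennreal 16 * (ennreal (singular_weight (s + 1 / 2) x) * indicator {0..<2} x) \<le>
      2 * (ennreal (8 * (singular_weight (s + 1 / 2) x + 1)) * indicator {0..<2} x)"
      by (auto simp: indicator_def)
  qed
  also have "\<dots> = 2 * block_weight s"
    unfolding block_weight_def by (rule nn_integral_cmult) measurable
  finally have 2: "ennreal 16 * (\<integral>\<^sup>+x\<in>{0..<2}. ennreal (singular_weight (s + 1 / 2) x) \<partial>lborel) \<le> 2 * block_weight s" .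
  show ?thesis by (rule order_trans[OF 1 mult_left_mono[OF 2]]) simp
qed

text \<open>The uniform order \<open>v powr (2 * s)\<close>, valid without restricting
  \<open>v\<close> to suitable scales. It supplies the majorant for the Gaussian average of
  increments.\<close>

lemma increment_bounded:
  assumes s: "0 < s" "s < 1 / 2"
  obtains K where "K \<ge> 0" "\<And>v. 0 < v \<Longrightarrow> v \<le> 1 \<Longrightarrow> v powr (- 2 * s) * increment (scaled_remainder s) v \<le> K"
proof -
  define B where "B = 2 * block_weight s + ennreal (1 / 2) * ((\<integral>\<^sup>+y\<in>{0<..}. ennreal (majorant s y) \<partial>lborel) * block_weight s)"
  have "ennreal (1 / 2) < \<infinity>" unfolding infinity_ennreal_def by (rule ennreal_less_top)
  then have B: "B < \<infinity>"
    unfolding B_def using block_weight_finite[OF s] nn_integral_majorant_finite[OF s]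
    by (auto simp: ennreal_mult_less_top)
  have le: "ennreal (v powr (- 2 * s) * increment (scaled_remainder s) v) \<le> B" if v: "0 < v" "v \<le> 1" for v
    unfolding scaled_increment_eq[OF s v(1)] B_def
  proof (intro add_mono mult_left_mono)
    have "ennreal (v powr (1 / 2 - s)) * (2 * block_weight s) \<le> 1 * (2 * block_weight s)"
      using v s by (intro mult_right_mono) (auto simp: powr_le1)
    then show "ennreal (v powr (- 2 * s)) * (\<integral>\<^sup>+x\<in>{0<..<2}. ennreal ((dilation_diff s v x)\<^sup>2 * x powr (- 2 * s - 1)) \<partial>lborel)
       \<le> 2 * block_weight s"
      using scaled_near_0_le[OF s v] by (simp add: order_trans)
    have "(\<integral>\<^sup>+y\<in>{0<..}. (\<integral>\<^sup>+a\<in>{0..<2}. ennreal (block_integrand s v y a) \<partial>lborel) \<partial>lborel) \<le>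
       (\<integral>\<^sup>+y. (ennreal (majorant s y) * indicator {0<..} y) * block_weight s \<partial>lborel)"
      using inner_integral_le[OF s v] by (intro nn_integral_mono) (auto simp: indicator_def)
    also have "\<dots> = (\<integral>\<^sup>+y\<in>{0<..}. ennreal (majorant s y) \<partial>lborel) * block_weight s"
      by (rule nn_integral_multc) measurable
    finally show "(\<integral>\<^sup>+y\<in>{0<..}. (\<integral>\<^sup>+a\<in>{0..<2}. ennreal (block_integrand s v y a) \<partial>lborel) \<partial>lborel) \<le>
       (\<integral>\<^sup>+y\<in>{0<..}. ennreal (majorant s y) \<partial>lborel) * block_weight s" .
  qed auto
  show ?thesis
  proof (rule that[of "enn2real B"])
    fix v :: real assume "0 < v" "v \<le> 1"
    from le[OF this] show "v powr (- 2 * s) * increment (scaled_remainder s) v \<le> enn2real B"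
using B by (cases B) (auto simp: ennreal_le_iff)
  qed simp
qed

section \<open>Increments deep inside a block\<close>

text \<open>What \<open>block_integrand\<close> becomes as \<open>v\<close> tends to 0: multiplying
  \<open>x\<close> by \<open>exp v\<close> moves it by about \<open>x * v\<close>, hence by
  \<open>y\<close>, and the factor \<open>exp (- s * v)\<close> disappears.\<close>

definition limit_integrand :: "real \<Rightarrow> (real \<Rightarrow> real) \<Rightarrow> real \<Rightarrow> real \<Rightarrow> real"
  where "limit_integrand s e y a = y powr (- 2 * s - 1) * (e (a + y) - e a)\<^sup>2"

text \<open>Extended nonnegative values allow positivity and the scaling relation between the two
  sawtooths to be proved independently of finiteness.\<close>

definition increment_constant :: "real \<Rightarrow> (real \<Rightarrow> real) \<Rightarrow> ennreal"
  where "increment_constant s e =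
    ennreal (1 / 2) * (\<integral>\<^sup>+y\<in>{0<..}. (\<integral>\<^sup>+a\<in>{0..<2}. ennreal (limit_integrand s e y a) \<partial>lborel) \<partial>lborel)"

lemma limit_integrand_measurable [measurable]:
  assumes [measurable]: "e \<in> borel_measurable borel"
  shows "(\<lambda>(y, a). limit_integrand s e y a) \<in> borel_measurable (borel \<Otimes>\<^sub>M borel)"
  unfolding limit_integrand_def by measurable

lemma AE_add_not_Ints: "AE a in lborel. a + y \<notin> (\<int> :: real set)"
proof (rule AE_I')
  have "countable ((\<lambda>k. k - y) ` (\<int> :: real set))"
    by (intro countable_image) (simp add: Ints_def countable_image)
  then show "(\<lambda>k. k - y) ` (\<int> :: real set) \<in> null_sets lborel"
    by (rule countable_imp_null_set_lborel)
  show "{a \<in> space lborel. \<not> a + y \<notin> \<int>} \<subseteq> (\<lambda>k. k - y) ` \<int>"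
    by (auto intro: rev_image_eqI[where x = "_ + y"])
qed

text \<open>Here \<open>e\<close> stands for either sawtooth. The assumption \<open>agree\<close>
  says that along the sequence \<open>v\<close> every fixed window of scales around
  \<open>1 / v j\<close> eventually lies where the remainder has the shape \<open>e\<close>.\<close>

context
  fixes s :: real and v :: "nat \<Rightarrow> real" and e :: "real \<Rightarrow> real"
  assumes s: "0 < s" "s < 1 / 2"
    and v: "\<And>j. 0 < v j" "\<And>j. v j \<le> 1" "v \<longlonglongrightarrow> 0"
    and e_meas: "e \<in> borel_measurable borel"
    and e_periodic: "\<And>x. e (x + 2) = e x"
    and e_cont: "\<And>x. x \<notin> \<int> \<Longrightarrow> isCont e x"
    and agree: "\<And>p q. 0 < p \<Longrightarrow> \<forall>\<^sub>F j in sequentially. \<forall>x. p \<le> x * v j \<and> x * v j \<le> q \<longrightarrow> remainder x = e x"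
begin

lemma e_shift: "e (2 * real n + x) = e x"
proof (induction n)
  case (Suc n)
  have "e (2 * real (Suc n) + x) = e ((2 * real n + x) + 2)" by (simp add: algebra_simps)
  also have "\<dots> = e x" by (simp add: e_periodic Suc)
  finally show ?case .
qed simp

text \<open>By periodicity the even start of the block drops out: the two arguments become
  \<open>a\<close> and \<open>a + r j\<close>, where \<open>r j\<close> tends to \<open>y\<close>.
  Continuity of \<open>e\<close> is required only at \<open>a + y\<close>, since the value at
  \<open>a\<close> is exact.\<close>

lemma dilation_diff_tendsto:
  assumes y: "0 < y" and a: "0 \<le> a" "a < 2" "a + y \<notin> \<int>"
  shows "(\<lambda>j. dilation_diff s (v j) (block_point (v j) y a)) \<longlonglongrightarrow> e (a + y) - e a"
    and "(\<lambda>j. block_point (v j) y a * v j) \<longlonglongrightarrow> y"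
proof -
  define X where "X j = block_point (v j) y a" for j
  define r where "r j = X j * (exp (v j) - 1)" for j
  show Xv: "(\<lambda>j. block_point (v j) y a * v j) \<longlonglongrightarrow> y"
  proof (rule tendsto_sandwich[OF always_eventually always_eventually])
    show "\<forall>j. y \<le> block_point (v j) y a * v j" "\<forall>j. block_point (v j) y a * v j \<le> y + 4 * v j"
      using block_point_bounds[OF v(1) y a(1,2)] by auto
    show "(\<lambda>j. y + 4 * v j) \<longlonglongrightarrow> y"
      using tendsto_add[OF tendsto_const tendsto_mult[OF tendsto_const v(3)], of y 4] by simp
  qed simp
  have Xv': "(\<lambda>j. X j * v j) \<longlonglongrightarrow> y" using Xv by (simp add: X_def)
  have ev1: "(\<lambda>j. exp (v j)) \<longlonglongrightarrow> 1"
    using tendsto_exp[OF v(3)] by simp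
  have "filterlim v (at 0) sequentially"
    using v(1,3) by (auto simp: filterlim_at intro!: always_eventually) (metis less_irrefl)
  then have "(\<lambda>j. (exp (v j) - 1) / v j) \<longlonglongrightarrow> 1"
    using filterlim_compose lim_exp_minus_1 by blast
  from tendsto_mult[OF Xv' this] have r: "r \<longlonglongrightarrow> y"
    using v(1) by (simp add: r_def[abs_def] less_imp_neq[symmetric])
  \<comment> \<open>Stated for any \<open>X'\<close> of the right size, because it is applied both
    to the point and to its dilation; the window from \<open>y / 2\<close> to \<open>2 * y\<close>
    contains the limit in its interior.\<close>
  have ev: "\<forall>\<^sub>F j in sequentially. e (X' j) = remainder (X' j)" if "(\<lambda>j. X' j * v j) \<longlonglongrightarrow> y" for X'
  proof -
    have "\<forall>\<^sub>F j in sequentially. y / 2 < X' j * v j" "\<forall>\<^sub>F j in sequentially. X' j * v j < 2 * y"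
      by (rule order_tendstoD[OF that]; use y in simp)+
    moreover have "\<forall>\<^sub>F j in sequentially. \<forall>x. y / 2 \<le> x * v j \<and> x * v j \<le> 2 * y \<longrightarrow> remainder x = e x"
      using y by (intro agree) simp
    ultimately show ?thesis by eventually_elim auto
  qed
  have "(\<lambda>j. (X j * exp (v j)) * v j) \<longlonglongrightarrow> y"
    using tendsto_mult[OF Xv' ev1] by (simp add: mult_ac)
  from ev[OF this] ev[OF Xv'] have evs:
    "\<forall>\<^sub>F j in sequentially. e (a + r j) * exp (- s * v j) - e a = dilation_diff s (v j) (X j)"
  proof eventually_elim
    case (elim j)
    have "X j * exp (v j) = 2 * real (nat \<lceil>1 / (2 * v j) * y\<rceil>) + (a + r j)"
      by (simp add: r_def X_def block_point_def algebra_simps)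
    then have "e (X j * exp (v j)) = e (a + r j)" by (simp only: e_shift)
    moreover have "e (X j) = e a" by (simp add: X_def block_point_def e_shift)
    ultimately show ?case using elim by (simp add: dilation_diff_def)
  qed
  have "(\<lambda>j. e (a + r j)) \<longlonglongrightarrow> e (a + y)"
    by (rule isCont_tendsto_compose[OF e_cont[OF a(3)]]) (intro tendsto_intros r)
  moreover have "(\<lambda>j. exp (- s * v j)) \<longlonglongrightarrow> 1"
    using tendsto_exp[OF tendsto_mult[OF tendsto_const v(3)], of "- s"] by simp
  ultimately have "(\<lambda>j. e (a + r j) * exp (- s * v j) - e a) \<longlonglongrightarrow> e (a + y) * 1 - e a"
    by (intro tendsto_intros)
  then show "(\<lambda>j. dilation_diff s (v j) (block_point (v j) y a)) \<longlonglongrightarrow> e (a + y) - e a"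
    using Lim_transform_eventually[OF _ evs] by (simp add: X_def)
qed

lemma block_integrand_tendsto:
  assumes y: "0 < y" and a: "0 \<le> a" "a < 2" "a + y \<notin> \<int>"
  shows "(\<lambda>j. block_integrand s (v j) y a) \<longlonglongrightarrow> limit_integrand s e y a"
  unfolding block_integrand_def limit_integrand_def
  using y by (intro tendsto_intros dilation_diff_tendsto[OF assms]) auto

lemma inner_integral_tendsto:
  assumes y: "0 < y"
  shows "(\<lambda>j. \<integral>\<^sup>+a\<in>{0..<2}. ennreal (block_integrand s (v j) y a) \<partial>lborel) \<longlonglongrightarrow>
    (\<integral>\<^sup>+a\<in>{0..<2}. ennreal (limit_integrand s e y a) \<partial>lborel)"
proof (rule nn_integral_dominated_convergence)
  note e_meas [measurable]
  show "(\<lambda>a. ennreal (limit_integrand s e y a) * indicator {0..<2} a) \<in> borel_measurable lborel"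
    by measurable
  show "(\<lambda>a. ennreal (block_integrand s (v j) y a) * indicator {0..<2} a) \<in> borel_measurable lborel" for j
    by measurable
  show "(\<lambda>a. ennreal (majorant s y * (8 * (singular_weight (s + 1 / 2) a + 1))) * indicator {0..<2} a) \<in> borel_measurable lborel"
    by measurable
  show "AE a in lborel. ennreal (block_integrand s (v j) y a) * indicator {0..<2} a \<le>
    ennreal (majorant s y * (8 * (singular_weight (s + 1 / 2) a + 1))) * indicator {0..<2} a" for j
    using block_integrand_le[OF s v(1,2) y] by (intro AE_I2) (auto simp: indicator_def intro!: ennreal_leI)
  have "(\<integral>\<^sup>+a. ennreal (majorant s y * (8 * (singular_weight (s + 1 / 2) a + 1))) * indicator {0..<2} a \<partial>lborel) =
     (\<integral>\<^sup>+a. ennreal (majorant s y) * (ennreal (8 * (singular_weight (s + 1 / 2) a + 1)) * indicator {0..<2} a) \<partial>lborel)"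
    by (simp only: ennreal_mult'[OF majorant_nonneg] mult.assoc)
  also have "\<dots> = ennreal (majorant s y) * block_weight s"
    unfolding block_weight_def by (rule nn_integral_cmult) measurable
  also have "\<dots> < \<infinity>" using block_weight_finite[OF s] by (simp add: ennreal_mult_less_top)
  finally show "(\<integral>\<^sup>+a. ennreal (majorant s y * (8 * (singular_weight (s + 1 / 2) a + 1))) * indicator {0..<2} a \<partial>lborel) < \<infinity>" .
  show "AE a in lborel. (\<lambda>j. ennreal (block_integrand s (v j) y a) * indicator {0..<2} a) \<longlonglongrightarrow>
     ennreal (limit_integrand s e y a) * indicator {0..<2} a"
    using AE_add_not_Ints[of y]
  proof eventually_elim
    case (elim a)
    then show ?case
      using block_integrand_tendsto[OF y, of a] by (cases "a \<in> {0..<2}") (auto intro: tendsto_ennrealI)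
  qed
qed

text \<open>Dominated convergence in \<open>y\<close>, on top of the one in \<open>a\<close>,
  handles the part from 2 on; the part below 2 vanishes at the rate
  \<open>v powr (1 / 2 - s)\<close>.\<close>

lemma increment_tendsto_ennreal:
  "(\<lambda>j. ennreal (v j powr (- 2 * s) * increment (scaled_remainder s) (v j))) \<longlonglongrightarrow> increment_constant s e"
proof -
  note e_meas [measurable]
  have bw: "block_weight s < \<infinity>" by (rule block_weight_finite[OF s])
  have "(\<lambda>j. \<integral>\<^sup>+y\<in>{0<..}. (\<integral>\<^sup>+a\<in>{0..<2}. ennreal (block_integrand s (v j) y a) \<partial>lborel) \<partial>lborel) \<longlonglongrightarrow>
    (\<integral>\<^sup>+y\<in>{0<..}. (\<integral>\<^sup>+a\<in>{0..<2}. ennreal (limit_integrand s e y a) \<partial>lborel) \<partial>lborel)"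
  proof (rule nn_integral_dominated_convergence)
    show "AE y in lborel. (\<integral>\<^sup>+a\<in>{0..<2}. ennreal (block_integrand s (v j) y a) \<partial>lborel) * indicator {0<..} y \<le>
      (ennreal (majorant s y) * indicator {0<..} y) * block_weight s" for j
      using inner_integral_le[OF s v(1,2)] by (intro AE_I2) (auto simp: indicator_def)
    have "(\<integral>\<^sup>+y. (ennreal (majorant s y) * indicator {0<..} y) * block_weight s \<partial>lborel) =
      (\<integral>\<^sup>+y\<in>{0<..}. ennreal (majorant s y) \<partial>lborel) * block_weight s"
      by (rule nn_integral_multc) measurable
    also have "\<dots> < \<infinity>" using bw nn_integral_majorant_finite[OF s] by (simp add: ennreal_mult_less_top)
    finally show "(\<integral>\<^sup>+y. (ennreal (majorant s y) * indicator {0<..} y) * block_weight s \<partial>lborel) < \<infinity>" .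
    show "AE y in lborel. (\<lambda>j. (\<integral>\<^sup>+a\<in>{0..<2}. ennreal (block_integrand s (v j) y a) \<partial>lborel) * indicator {0<..} y) \<longlonglongrightarrow>
      (\<integral>\<^sup>+a\<in>{0..<2}. ennreal (limit_integrand s e y a) \<partial>lborel) * indicator {0<..} y"
      using inner_integral_tendsto by (intro AE_I2) (auto simp: indicator_def)
  qed measurable
  then have far: "(\<lambda>j. ennreal (1 / 2) * (\<integral>\<^sup>+y\<in>{0<..}. (\<integral>\<^sup>+a\<in>{0..<2}. ennreal (block_integrand s (v j) y a) \<partial>lborel) \<partial>lborel)) \<longlonglongrightarrow>
    increment_constant s e"
    unfolding increment_constant_def by (rule ennreal_tendsto_cmult[rotated]) (rule ennreal_less_top)
  have near: "(\<lambda>j. ennreal (v j powr (- 2 * s)) * (\<integral>\<^sup>+x\<in>{0<..<2}. ennreal ((dilation_diff s (v j) x)\<^sup>2 * x powr (- 2 * s - 1)) \<partial>lborel)) \<longlonglongrightarrow> 0"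
  proof (rule tendsto_sandwich[OF always_eventually always_eventually tendsto_const])
    show "\<forall>j. ennreal (v j powr (- 2 * s)) * (\<integral>\<^sup>+x\<in>{0<..<2}. ennreal ((dilation_diff s (v j) x)\<^sup>2 * x powr (- 2 * s - 1)) \<partial>lborel)
      \<le> 2 * block_weight s * ennreal (v j powr (1 / 2 - s))"
      using scaled_near_0_le[OF s v(1,2)] by (simp add: mult.commute)
    have "(\<lambda>j. v j powr (1 / 2 - s)) \<longlonglongrightarrow> 0 powr (1 / 2 - s)"
      using s v by (intro tendsto_powr2) (auto intro!: always_eventually less_imp_le)
    then have "(\<lambda>j. ennreal (v j powr (1 / 2 - s))) \<longlonglongrightarrow> 0"
      using tendsto_ennrealI by fastforce
    then show "(\<lambda>j. 2 * block_weight s * ennreal (v j powr (1 / 2 - s))) \<longlonglongrightarrow> 0"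
      using ennreal_tendsto_cmult[of "2 * block_weight s" "\<lambda>j. ennreal (v j powr (1 / 2 - s))" 0 sequentially] bw
      by (simp add: ennreal_mult_less_top)
  qed auto
  show ?thesis
    unfolding scaled_increment_eq[OF s v(1)] using tendsto_add[OF near far] by simp
qed

text \<open>Finiteness is inherited from the uniform bound on the scaled increments, of which the
  constant is a limit.\<close>

lemma increment_constant_finite: "increment_constant s e < \<infinity>"
proof -
  obtain K where K: "\<And>v. 0 < v \<Longrightarrow> v \<le> 1 \<Longrightarrow> v powr (- 2 * s) * increment (scaled_remainder s) v \<le> K"
    using increment_bounded[OF s] by blast
  have "increment_constant s e \<le> ennreal K"
    by (rule LIMSEQ_le_const2[OF increment_tendsto_ennreal]) (use K v in \<open>auto intro!: ennreal_leI\<close>)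
  then show ?thesis by (simp add: order_le_less_trans)
qed

lemma increment_tendsto:
  "(\<lambda>j. v j powr (- 2 * s) * increment (scaled_remainder s) (v j)) \<longlonglongrightarrow> enn2real (increment_constant s e)"
proof -
  have "(\<lambda>j. enn2real (ennreal (v j powr (- 2 * s) * increment (scaled_remainder s) (v j)))) \<longlonglongrightarrow> enn2real (increment_constant s e)"
    using increment_tendsto_ennreal increment_constant_finite by (intro tendsto_enn2real) auto
  then show ?thesis by (simp add: increment_def)
qed

end

section \<open>The two sawtooths\<close>

text \<open>The shape of \<open>remainder\<close> on the blocks with \<open>eta = 0\<close> and on the alternating blocks.\<close>

definition saw1 :: "real \<Rightarrow> real"
  where "saw1 x = - frac x"

definition saw2 :: "real \<Rightarrow> real"
  where "saw2 x = 1 - 2 * frac (x / 2)"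

lemma saw_measurable [measurable]:
  "saw1 \<in> borel_measurable borel" "saw2 \<in> borel_measurable borel"
  unfolding saw1_def[abs_def] saw2_def[abs_def] frac_def by measurable

lemma saw1_periodic: "saw1 (x + 1) = saw1 x"
  by (simp add: saw1_def frac_1_eq)

lemma saw2_eq_saw1: "saw2 x = 1 + 2 * saw1 (x / 2)"
  by (simp add: saw1_def saw2_def)

lemma saw1_periodic2: "saw1 (x + 2) = saw1 x"
  using saw1_periodic[of x] saw1_periodic[of "x + 1"] by (simp add: add.assoc)

lemma saw2_periodic2: "saw2 (x + 2) = saw2 x"
  using saw1_periodic[of "x / 2"] by (simp add: saw2_eq_saw1 add_divide_distrib)

lemma isCont_saw1: "x \<notin> \<int> \<Longrightarrow> isCont saw1 x"
  unfolding saw1_def[abs_def] by (intro continuous_intros continuous_frac)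

lemma isCont_saw2:
  assumes "x \<notin> \<int>"
  shows "isCont saw2 x"
proof -
  have "x / 2 \<notin> \<int>"
  proof
    assume "x / 2 \<in> \<int>"
    then have "2 * (x / 2) \<in> \<int>" by (intro Ints_mult) auto
    with assms show False by simp
  qed
  then have "isCont (\<lambda>x. saw1 (x / 2)) x"
    by (intro isCont_o2[of _ "\<lambda>x. x / 2" saw1] isCont_saw1) auto
  then show ?thesis
    unfolding saw2_eq_saw1[abs_def] by (intro continuous_intros)
qed

lemma remainder_eq_saw1:
  assumes "\<not> (\<exists>N. M (2 * N) \<le> nat \<lfloor>x\<rfloor> \<and> nat \<lfloor>x\<rfloor> < M (2 * N + 1))"
  shows "remainder x = saw1 x"
  using assms by (simp add: remainder_def eta_sum_eq saw1_def frac_def)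

text \<open>In an alternating block the partial sum of \<open>eta\<close> is 1 exactly at even
  integers. Added to the floor it always gives the odd integer \<open>2 * k + 1\<close> with
  \<open>k\<close> the floor of \<open>x / 2\<close>, and subtracting \<open>x\<close> leaves a
  sawtooth of period 2.\<close>

lemma remainder_eq_saw2:
  assumes x: "0 \<le> x" and M: "M (2 * N) \<le> nat \<lfloor>x\<rfloor>" "nat \<lfloor>x\<rfloor> < M (2 * N + 1)"
  shows "remainder x = saw2 x"
proof (cases "even \<lfloor>x\<rfloor>")
  case True
  then obtain k where k: "\<lfloor>x\<rfloor> = 2 * k" by (auto elim: evenE)
  then have "\<lfloor>x / 2\<rfloor> = k" by (simp add: floor_eq_iff)
  moreover have "even (nat \<lfloor>x\<rfloor>)" using True x by (simp add: even_nat_iff)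
  ultimately show ?thesis using M k by (auto simp: remainder_def eta_sum_eq saw2_def frac_def)
next
  case False
  then obtain k where k: "\<lfloor>x\<rfloor> = 2 * k + 1" by (auto elim: oddE)
  then have "\<lfloor>x / 2\<rfloor> = k" by (simp add: floor_eq_iff)
  moreover have "odd (nat \<lfloor>x\<rfloor>)" using False x by (simp add: even_nat_iff)
  ultimately show ?thesis using M k by (auto simp: remainder_def eta_sum_eq saw2_def frac_def)
qed

lemma M_mono: "m \<le> n \<Longrightarrow> M m \<le> M n"
  by (simp add: M_def)

lemma M_Suc: "M (Suc m) = (M m)\<^sup>2"
  by (simp add: M_def power_mult[symmetric] mult.commute)

lemma M_ge: "m \<le> M m"
  unfolding M_def by (meson less_exp order.strict_trans less_imp_le)

lemma remainder_plain_block: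
  assumes x: "real (M (2 * N + 1)) \<le> x" "x < real (M (2 * N + 2))"
  shows "remainder x = saw1 x"
proof (rule remainder_eq_saw1, safe)
  have n: "M (2 * N + 1) \<le> nat \<lfloor>x\<rfloor>" "nat \<lfloor>x\<rfloor> < M (2 * N + 2)"
    using x le_nat_floor[of "M (2 * N + 1)" x] by (blast, linarith)
  fix N' assume N': "M (2 * N') \<le> nat \<lfloor>x\<rfloor>" "nat \<lfloor>x\<rfloor> < M (2 * N' + 1)"
  show False
  proof (cases "N' \<le> N")
    case True
    then show False using n N' M_mono[of "2 * N' + 1" "2 * N + 1"] by simp
  next
    case False
    then show False using n N' M_mono[of "2 * N + 2" "2 * N'"] by simp
  qed
qed

text \<open>Indexed so that the block runs from \<open>M (k + 1)\<close> to \<open>M (k + 2)\<close>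
  with \<open>k = 2 * N + 1\<close>, the same shape as the plain block with
  \<open>k = 2 * N\<close>.\<close>

lemma remainder_alternating_block:
  assumes x: "real (M (2 * N + 2)) \<le> x" "x < real (M (2 * N + 3))"
  shows "remainder x = saw2 x"
proof (rule remainder_eq_saw2[where N = "N + 1"])
  show "0 \<le> x" using x by linarith
  show "M (2 * (N + 1)) \<le> nat \<lfloor>x\<rfloor>" using x by (simp add: le_nat_floor)
  have "nat \<lfloor>x\<rfloor> < M (2 * N + 3)" using x by linarith
  then show "nat \<lfloor>x\<rfloor> < M (2 * (N + 1) + 1)" by (simp add: eval_nat_numeral)
qed

text \<open>With \<open>m = M (k j)\<close> the window describes \<open>x\<close> between
  \<open>p * m ^ 3 / z\<close> and \<open>q * m ^ 3 / z\<close>, and the block runs from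
  \<open>m ^ 2\<close> to \<open>m ^ 4\<close>. The window is inside as soon as \<open>m\<close> is
  at least \<open>z / p\<close> and larger than \<open>q / z\<close>.\<close>

lemma block_agree:
  fixes k :: "nat \<Rightarrow> nat"
  assumes k: "\<And>j. j \<le> k j" and z: "z > 0" and p: "0 < p"
    and e: "\<And>j x. real (M (k j + 1)) \<le> x \<Longrightarrow> x < real (M (k j + 2)) \<Longrightarrow> remainder x = e x"
  shows "\<forall>\<^sub>F j in sequentially. \<forall>x. p \<le> x * (1 / real (M (k j)) ^ 3 * z) \<and> x * (1 / real (M (k j)) ^ 3 * z) \<le> q \<longrightarrow> remainder x = e x"
proof -
  have "filterlim (\<lambda>j. real (M (k j))) at_top sequentially"
  proof (rule filterlim_at_top_mono[OF filterlim_real_sequentially], intro always_eventually allI)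
    show "real j \<le> real (M (k j))" for j using M_ge[of "k j"] k[of j] by simp
  qed
  then have "\<forall>\<^sub>F j in sequentially. z / p \<le> real (M (k j))" "\<forall>\<^sub>F j in sequentially. q / z < real (M (k j))"
    by (simp_all only: filterlim_at_top_dense) (blast intro: eventually_mono less_imp_le)+
  then show ?thesis
  proof eventually_elim
    case (elim j)
    define m where "m = real (M (k j))"
    have m: "m > 0" by (simp add: m_def M_def)
    have zp: "z \<le> m * p" and qz: "q < m * z" using elim z p unfolding m_def[symmetric] by (simp_all add: pos_divide_le_eq pos_divide_less_eq)
    show ?case
    proof safe
      fix x assume "p \<le> x * (1 / real (M (k j)) ^ 3 * z)" "x * (1 / real (M (k j)) ^ 3 * z) \<le> q"
      then have 1: "p * m ^ 3 \<le> x * z" "x * z \<le> q * m ^ 3"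
        using m unfolding m_def[symmetric] by (simp_all add: pos_le_divide_eq pos_divide_le_eq)
      have "m\<^sup>2 * z \<le> m\<^sup>2 * (m * p)" using zp by (intro mult_left_mono) auto
      also have "\<dots> = p * m ^ 3" by (simp add: power2_eq_square power3_eq_cube)
      finally have a: "m\<^sup>2 \<le> x" using 1 z by (metis mult_le_cancel_right_pos order_trans)
      have "x * z < (m * z) * m ^ 3" using m by (intro le_less_trans[OF 1(2) mult_strict_right_mono[OF qz]]) simp
      also have "\<dots> = m ^ 4 * z" by (simp add: eval_nat_numeral)
      finally have b: "x < m ^ 4" using z by simp
      show "remainder x = e x"
      proof (rule e[of j])
        show "real (M (k j + 1)) \<le> x" using a by (simp add: M_Suc m_def)
        have "real (M (k j + 2)) = m ^ 4" by (simp add: M_Suc m_def power_mult[symmetric])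
        then show "x < real (M (k j + 2))" using b by simp
      qed
    qed
  qed
qed

lemma nn_integral_saw1_half:
  fixes y :: real
  shows "(\<integral>\<^sup>+a\<in>{0..<2}. ennreal ((saw1 (a + y) - saw1 a)\<^sup>2) \<partial>lborel) =
    2 * (\<integral>\<^sup>+a\<in>{0..<1}. ennreal ((saw1 (a + y) - saw1 a)\<^sup>2) \<partial>lborel)"
proof -
  define h where "h a = ennreal ((saw1 (a + y) - saw1 a)\<^sup>2)" for a
  have [measurable]: "h \<in> borel_measurable borel" unfolding h_def[abs_def] by measurable
  have per: "h (1 + a) = h a" for a
    using saw1_periodic[of a] saw1_periodic[of "a + y"] by (simp add: h_def add_ac)
  have "(\<integral>\<^sup>+a\<in>{0..<2}. h a \<partial>lborel) = (\<integral>\<^sup>+a. h a * indicator {0..<1} a + h a * indicator {1..<2} a \<partial>lborel)"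
    by (intro nn_integral_cong) (auto simp: indicator_def)
  also have "\<dots> = (\<integral>\<^sup>+a\<in>{0..<1}. h a \<partial>lborel) + (\<integral>\<^sup>+a\<in>{1..<2}. h a \<partial>lborel)"
    by (rule nn_integral_add) measurable
  also have "(\<integral>\<^sup>+a\<in>{1..<2}. h a \<partial>lborel) = ennreal \<bar>1\<bar> * (\<integral>\<^sup>+a. h (1 + 1 * a) * indicator {1..<2} (1 + 1 * a) \<partial>lborel)"
    by (rule nn_integral_real_affine) auto
  also have "\<dots> = (\<integral>\<^sup>+a\<in>{0..<1}. h a \<partial>lborel)"
    using per by (auto simp: indicator_def intro!: nn_integral_cong)
  finally show ?thesis by (simp add: h_def mult_2)
qed

text \<open>The dilation by 2 contributes 4 through the squared amplitude and a Jacobian 2; the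
  Jacobian is absorbed because \<open>{0..<2}\<close> holds two periods of
  \<open>saw1\<close>.\<close>

lemma nn_integral_saw2:
  fixes y :: real
  shows "(\<integral>\<^sup>+a\<in>{0..<2}. ennreal ((saw2 (a + y) - saw2 a)\<^sup>2) \<partial>lborel) =
    4 * (\<integral>\<^sup>+a\<in>{0..<2}. ennreal ((saw1 (a + y / 2) - saw1 a)\<^sup>2) \<partial>lborel)"
proof -
  define f where "f a = ennreal ((saw2 (a + y) - saw2 a)\<^sup>2) * indicator {0..<2} a" for a
  define g where "g a = ennreal ((saw1 (a + y / 2) - saw1 a)\<^sup>2) * indicator {0..<1} a" for a
  have [measurable]: "f \<in> borel_measurable borel" "g \<in> borel_measurable borel"
    unfolding f_def[abs_def] g_def[abs_def] by measurable
  have fg: "f (0 + 2 * a) = 4 * g a" for a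
  proof (cases "a \<in> {0..<1}")
    case True
    have "saw2 (2 * a + y) - saw2 (2 * a) = 2 * (saw1 (a + y / 2) - saw1 a)"
      by (simp add: saw2_eq_saw1 add_divide_distrib)
    then have "(saw2 (2 * a + y) - saw2 (2 * a))\<^sup>2 = 4 * (saw1 (a + y / 2) - saw1 a)\<^sup>2"
      by (simp only: power_mult_distrib) simp
    then show ?thesis using True by (simp add: f_def g_def ennreal_mult')
  qed (simp add: f_def g_def)
  have "(\<integral>\<^sup>+a. f a \<partial>lborel) = ennreal \<bar>2\<bar> * (\<integral>\<^sup>+a. f (0 + 2 * a) \<partial>lborel)"
    using nn_integral_real_affine[of f 2 0] by simp
  also have "\<dots> = 2 * (4 * (\<integral>\<^sup>+a. g a \<partial>lborel))"
    unfolding fg by (simp add: nn_integral_cmult)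
  also have "\<dots> = 4 * (2 * (\<integral>\<^sup>+a. g a \<partial>lborel))" by (rule mult.left_commute)
  finally show ?thesis by (simp only: f_def g_def nn_integral_saw1_half)
qed

lemma increment_constant_alt:
  assumes [measurable]: "e \<in> borel_measurable borel"
  shows "increment_constant s e = ennreal (1 / 2) *
    (\<integral>\<^sup>+y\<in>{0<..}. ennreal (y powr (- 2 * s - 1)) * (\<integral>\<^sup>+a\<in>{0..<2}. ennreal ((e (a + y) - e a)\<^sup>2) \<partial>lborel) \<partial>lborel)"
proof -
  have "(\<integral>\<^sup>+a\<in>{0..<2}. ennreal (limit_integrand s e y a) \<partial>lborel) =
    ennreal (y powr (- 2 * s - 1)) * (\<integral>\<^sup>+a\<in>{0..<2}. ennreal ((e (a + y) - e a)\<^sup>2) \<partial>lborel)" for y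
    unfolding limit_integrand_def
    by (subst nn_integral_cmult[symmetric]) (auto simp: ennreal_mult' mult.assoc)
  then show ?thesis by (simp only: increment_constant_def)
qed

text \<open>Substituting \<open>2 * y\<close> for \<open>y\<close> turns the weight and its Jacobian
  into the factor \<open>2 powr (- 2 * s)\<close>; the 4 is the squared amplitude.\<close>

lemma increment_constant_saw2:
  "increment_constant s saw2 = ennreal (4 * 2 powr (- 2 * s)) * increment_constant s saw1"
proof -
  define A where "A y = (\<integral>\<^sup>+a\<in>{0..<2}. ennreal ((saw1 (a + y) - saw1 a)\<^sup>2) \<partial>lborel)" for y :: real
  have [measurable]: "A \<in> borel_measurable borel" unfolding A_def[abs_def] by measurable
  define f where "f y = ennreal (y powr (- 2 * s - 1)) * (4 * A (y / 2)) * indicator {0<..} y" for y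
  define g where "g y = ennreal (y powr (- 2 * s - 1)) * A y * indicator {0<..} y" for y
  have [measurable]: "f \<in> borel_measurable borel" "g \<in> borel_measurable borel"
    unfolding f_def[abs_def] g_def[abs_def] by measurable
  have fg: "ennreal 2 * f (0 + 2 * y) = ennreal (4 * 2 powr (- 2 * s)) * g y" for y
  proof (cases "y > 0")
    case True
    have "2 * ((2 * y) powr (- 2 * s - 1) * 4) = (4 * 2 powr (- 2 * s)) * y powr (- 2 * s - 1)"
      using True by (simp add: powr_mult powr_diff)
    then have "ennreal 2 * (ennreal ((2 * y) powr (- 2 * s - 1)) * ennreal 4) =
      ennreal (4 * 2 powr (- 2 * s)) * ennreal (y powr (- 2 * s - 1))"
      using ennreal_mult''[of "y powr (- 2 * s - 1)" "4 * 2 powr (- 2 * s)"]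
      by (simp only: ennreal_mult'[OF powr_ge_zero, symmetric] ennreal_mult'[OF zero_le_numeral, symmetric] powr_ge_zero)
    then have "(ennreal 2 * (ennreal ((2 * y) powr (- 2 * s - 1)) * 4)) * A y =
      (ennreal (4 * 2 powr (- 2 * s)) * ennreal (y powr (- 2 * s - 1))) * A y"
      by (simp only: ennreal_numeral)
    then show ?thesis using True by (simp only: f_def g_def) (simp add: mult.assoc)
  qed (simp add: f_def g_def)
  have "(\<integral>\<^sup>+y. f y \<partial>lborel) = ennreal 2 * (\<integral>\<^sup>+y. f (0 + 2 * y) \<partial>lborel)"
    using nn_integral_real_affine[of f 2 0] by simp
  also have "\<dots> = (\<integral>\<^sup>+y. ennreal 2 * f (0 + 2 * y) \<partial>lborel)"
    by (rule nn_integral_cmult[symmetric]) measurable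
  also have "\<dots> = ennreal (4 * 2 powr (- 2 * s)) * (\<integral>\<^sup>+y. g y \<partial>lborel)"
    unfolding fg by (rule nn_integral_cmult) measurable
  finally have I: "(\<integral>\<^sup>+y\<in>{0<..}. ennreal (y powr (- 2 * s - 1)) * (4 * A (y / 2)) \<partial>lborel) =
    ennreal (4 * 2 powr (- 2 * s)) * (\<integral>\<^sup>+y\<in>{0<..}. ennreal (y powr (- 2 * s - 1)) * A y \<partial>lborel)"
    by (simp only: f_def g_def)
  have "increment_constant s saw2 = ennreal (1 / 2) * (\<integral>\<^sup>+y\<in>{0<..}. ennreal (y powr (- 2 * s - 1)) * (4 * A (y / 2)) \<partial>lborel)"
    by (simp only: increment_constant_alt[OF saw_measurable(2)] nn_integral_saw2 A_def)
  also have "\<dots> = ennreal (4 * 2 powr (- 2 * s)) * (ennreal (1 / 2) * (\<integral>\<^sup>+y\<in>{0<..}. ennreal (y powr (- 2 * s - 1)) * A y \<partial>lborel))"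
    unfolding I by (rule mult.left_commute)
  finally show ?thesis
    by (simp only: increment_constant_alt[OF saw_measurable(1)] A_def)
qed

text \<open>For \<open>1 / 4 \<le> y \<le> 1 / 2\<close> and \<open>0 \<le> a < 1 / 2\<close> no
  jump lies between \<open>a\<close> and \<open>a + y\<close>, so the squared difference is
  \<open>y\<^sup>2\<close>, at least 1/16. The two periods over half a unit of \<open>a\<close> give
  1/16, and a quarter unit of \<open>y\<close> gives 1/64.\<close>

lemma increment_constant_saw1_pos:
  assumes s: "0 < s"
  shows "increment_constant s saw1 > 0"
proof -
  have "ennreal (1 / 64) = (\<integral>\<^sup>+y. ennreal (1 / 16) * indicator {1 / 4..1 / 2 :: real} y \<partial>lborel)"
    by (simp add: nn_integral_cmult_indicator ennreal_mult[symmetric])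
  also have "\<dots> \<le> (\<integral>\<^sup>+y\<in>{0<..}. ennreal (y powr (- 2 * s - 1)) * (2 * (\<integral>\<^sup>+a\<in>{0..<1}. ennreal ((saw1 (a + y) - saw1 a)\<^sup>2) \<partial>lborel)) \<partial>lborel)"
  proof (intro nn_integral_mono)
    fix y :: real
    show "ennreal (1 / 16) * indicator {1 / 4..1 / 2} y \<le> ennreal (y powr (- 2 * s - 1)) *
      (2 * (\<integral>\<^sup>+a\<in>{0..<1}. ennreal ((saw1 (a + y) - saw1 a)\<^sup>2) \<partial>lborel)) * indicator {0<..} y"
    proof (cases "y \<in> {1 / 4..1 / 2}")
      case True
      then have y: "1 / 4 \<le> y" "y \<le> 1 / 2" by auto
      have "ennreal (1 / 32) = (\<integral>\<^sup>+a. ennreal (1 / 16) * indicator {0..<1 / 2 :: real} a \<partial>lborel)"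
        using ennreal_mult'[of "1 / 16" "1 / 2"] by (simp add: nn_integral_cmult_indicator)
      also have "\<dots> \<le> (\<integral>\<^sup>+a\<in>{0..<1}. ennreal ((saw1 (a + y) - saw1 a)\<^sup>2) \<partial>lborel)"
      proof (intro nn_integral_mono)
        fix a :: real
        have "ennreal (1 / 16) \<le> ennreal ((saw1 (a + y) - saw1 a)\<^sup>2)" if a: "0 \<le> a" "a < 1 / 2"
        proof (rule ennreal_leI)
          have "frac a = a" "frac (a + y) = a + y" using a y by (auto simp: frac_eq)
          then have "(saw1 (a + y) - saw1 a)\<^sup>2 = y\<^sup>2" by (simp add: saw1_def)
          moreover have "(1 / 4)\<^sup>2 \<le> y\<^sup>2" using y by (intro power_mono) auto
          ultimately show "1 / 16 \<le> (saw1 (a + y) - saw1 a)\<^sup>2" by (simp add: power2_eq_square)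
        qed
        then show "ennreal (1 / 16) * indicator {0..<1 / 2} a \<le> ennreal ((saw1 (a + y) - saw1 a)\<^sup>2) * indicator {0..<1} a"
          by (auto simp: indicator_def)
      qed
      finally have I: "ennreal (1 / 32) \<le> (\<integral>\<^sup>+a\<in>{0..<1}. ennreal ((saw1 (a + y) - saw1 a)\<^sup>2) \<partial>lborel)" .
      have "1 \<le> y powr (- 2 * s - 1)"
        using y s powr_mono2'[of "- 2 * s - 1" y 1] by simp
      then have "1 * (2 * ennreal (1 / 32)) \<le> ennreal (y powr (- 2 * s - 1)) *
        (2 * (\<integral>\<^sup>+a\<in>{0..<1}. ennreal ((saw1 (a + y) - saw1 a)\<^sup>2) \<partial>lborel))"
        using I by (intro mult_mono) auto
      moreover have "2 * ennreal (1 / 32) = ennreal (1 / 16)"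
        using ennreal_mult'[of 2 "1 / 32"] by simp
      ultimately show ?thesis using True y by (simp add: indicator_def)
    qed simp
  qed
  finally have "0 < (\<integral>\<^sup>+y\<in>{0<..}. ennreal (y powr (- 2 * s - 1)) * (\<integral>\<^sup>+a\<in>{0..<2}. ennreal ((saw1 (a + y) - saw1 a)\<^sup>2) \<partial>lborel) \<partial>lborel)"
    unfolding nn_integral_saw1_half by (rule less_le_trans[rotated]) simp
  moreover have "0 < ennreal (1 / 2)" by (simp only: ennreal_less_zero_iff)
  ultimately show ?thesis
    unfolding increment_constant_alt[OF saw_measurable(1)] by (simp only: ennreal_zero_less_mult_iff)
qed

section \<open>Divergence of the means\<close>

lemma increment_minus: "increment g (- v) = increment g v"
proof -
  have "increment g (- v) = (\<integral>u. (g (u + v + - v) - g (u + v))\<^sup>2 \<partial>lborel)"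
    unfolding increment_def by (rule integral_shift[of "\<lambda>u. (g (u + - v) - g u)\<^sup>2" v, symmetric])
  then show ?thesis by (simp add: increment_def power2_commute)
qed

lemma increment_abs: "increment g \<bar>v\<bar> = increment g v"
  by (cases "v \<ge> 0") (simp_all add: increment_minus)

lemma increment_0: "increment g 0 = 0"
  by (simp add: increment_def)

lemma increment_nonneg: "increment g v \<ge> 0"
  by (simp add: increment_def)

text \<open>The factor left by the weight of \<open>gauss_mean_square\<close> once the increment is
  replaced by a multiple of the power \<open>2 * s\<close>.\<close>

definition gauss_moment :: "real \<Rightarrow> real"
  where "gauss_moment s = (\<integral>z. std_normal_density z * (z\<^sup>2 - 1) * \<bar>z\<bar> powr (2 * s) \<partial>lborel)"

lemma integrable_gauss_moment_majorant:
  "integrable lborel (\<lambda>z. std_normal_density z * (z\<^sup>2 + 1) * (K * (1 + \<bar>z\<bar>)))"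
proof -
  have "integrable lborel (\<lambda>z. K * (std_normal_density z * \<bar>z\<bar> ^ 3 + std_normal_density z * \<bar>z\<bar> ^ 2
      + std_normal_density z * \<bar>z\<bar> ^ 1 + std_normal_density z * \<bar>z\<bar> ^ 0))"
    by (intro integrable_mult_right Bochner_Integration.integrable_add integrable_std_normal_moment_abs)
  then show ?thesis
    by (rule Bochner_Integration.integrable_cong[THEN iffD1, rotated -1])
       (auto simp: algebra_simps power2_eq_square power3_eq_cube)
qed

lemma abs_powr_le:
  fixes s z :: real
  assumes "0 < s" "s < 1 / 2"
  shows "\<bar>z\<bar> powr (2 * s) \<le> 1 + \<bar>z\<bar>"
proof (cases "\<bar>z\<bar> \<le> 1")
  case True
  then have "\<bar>z\<bar> powr (2 * s) \<le> 1" using assms by (simp add: powr_le1)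
  then show ?thesis by simp
next
  case False
  then have "\<bar>z\<bar> powr (2 * s) \<le> \<bar>z\<bar> powr 1" using assms by (intro powr_mono) auto
  then show ?thesis using False by simp
qed

lemma abs_gauss_weight_le:
  assumes "0 < s" "s < 1 / 2" "0 \<le> q" "q \<le> K * \<bar>z\<bar> powr (2 * s)" "0 \<le> K"
  shows "\<bar>std_normal_density z * (z\<^sup>2 - 1) * q\<bar> \<le> std_normal_density z * (z\<^sup>2 + 1) * (K * (1 + \<bar>z\<bar>))"
proof -
  have "q \<le> K * (1 + \<bar>z\<bar>)"
    using assms(4) mult_left_mono[OF abs_powr_le[OF assms(1,2)] assms(5)] by (rule order_trans)
  moreover have "\<bar>z\<^sup>2 - 1\<bar> \<le> z\<^sup>2 + 1" by (simp add: abs_le_iff)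
  ultimately show ?thesis
    using assms by (auto simp: abs_mult intro!: mult_mono)
qed

text \<open>Since \<open>std_normal_density z * (z\<^sup>2 - 1)\<close> has integral 0, the power
  may be replaced by the power minus 1. That difference has the same sign as
  \<open>z\<^sup>2 - 1\<close>, so the integrand is positive except at 1 and -1.\<close>

lemma gauss_moment_nonzero:
  assumes s: "0 < s" "s < 1 / 2"
  shows "gauss_moment s \<noteq> 0"
proof
  assume 0: "gauss_moment s = 0"
  define f where "f z = std_normal_density z * (z\<^sup>2 - 1) * (\<bar>z\<bar> powr (2 * s) - 1)" for z
  have i1: "integrable lborel (\<lambda>z. std_normal_density z * (z\<^sup>2 - 1) * \<bar>z\<bar> powr (2 * s))"
    by (rule Bochner_Integration.integrable_bound[OF integrable_gauss_moment_majorant[of 1]])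
       (use abs_gauss_weight_le[OF s, of "\<bar>_\<bar> powr (2 * s)" 1] in \<open>auto intro!: AE_I2 order_trans[OF _ abs_ge_self]\<close>)
  have i2: "integrable lborel std_normal_density" "integrable lborel (\<lambda>z. std_normal_density z * z\<^sup>2)"
    using integrable_std_normal_moment[of 0] integrable_std_normal_moment[of 2] by auto
  have e: "(\<integral>z. std_normal_density z \<partial>lborel) = 1" "(\<integral>z. std_normal_density z * z\<^sup>2 \<partial>lborel) = 1"
    using integral_std_normal_moment_even[of 0] integral_std_normal_moment_even[of 1] by auto
  have f_eq: "f z = std_normal_density z * (z\<^sup>2 - 1) * \<bar>z\<bar> powr (2 * s) - (std_normal_density z * z\<^sup>2 - std_normal_density z)" for z
    by (simp add: f_def algebra_simps)
  have f_int: "integrable lborel f"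
    unfolding f_eq[abs_def] by (intro Bochner_Integration.integrable_diff i1 i2)
  have "(\<integral>z. f z \<partial>lborel) = 0"
    unfolding f_eq using i1 i2 0 by (simp add: e gauss_moment_def)
  moreover have sgn: "0 < (z\<^sup>2 - 1) * (\<bar>z\<bar> powr (2 * s) - 1)" if "\<bar>z\<bar> \<noteq> 1" for z
  proof (cases "\<bar>z\<bar> < 1")
    case True
    then have "z\<^sup>2 < 1" by (simp add: abs_square_less_1)
    moreover have "\<bar>z\<bar> powr (2 * s) < 1 powr (2 * s)"
      using True s by (intro powr_less_mono2) auto
    ultimately show ?thesis by (intro mult_neg_neg) auto
  next
    case False
    then have "1 < \<bar>z\<bar>" using that by simp
    then have "z\<^sup>2 > 1" by (metis abs_1 abs_square_less_1 abs_square_eq_1 linorder_neqE_linordered_idom not_less_iff_gr_or_eq)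
    moreover have "1 powr (2 * s) < \<bar>z\<bar> powr (2 * s)"
      using \<open>1 < \<bar>z\<bar>\<close> s by (intro powr_less_mono2) auto
    ultimately show ?thesis by (intro mult_pos_pos) auto
  qed
  have pos: "0 < f z" if "\<bar>z\<bar> \<noteq> 1" for z
    using sgn[OF that] normal_density_pos[of 1 0 z] by (simp add: f_def mult.assoc)
  have f1: "f z = 0" if "\<bar>z\<bar> = 1" for z using that by (simp add: f_def)
  have nonneg: "0 \<le> f z" for z using pos[of z] f1[of z] by (cases "\<bar>z\<bar> = 1") auto
  ultimately have "AE z in lborel. f z = 0"
    using integral_nonneg_eq_0_iff_AE[OF f_int] by simp
  \<comment> \<open>\<open>z \<noteq> z\<close> is falsity: away from 1 and -1 the vanishing of
    \<open>f\<close> contradicts \<open>pos\<close>, and the line is not a null set.\<close>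
  then have "AE z in lborel. z \<noteq> (z::real)"
    using AE_lborel_singleton[of 1] AE_lborel_singleton[of "- 1"]
  proof eventually_elim
    case (elim z)
    then have "\<bar>z\<bar> \<noteq> 1" by (auto simp: abs_if split: if_splits)
    then show ?case using pos elim by fastforce
  qed
  then show False
    by (subst (asm) AE_iff_null) (auto simp: null_sets_def)
qed

context
  fixes s :: real
  assumes s: "0 < s" "s < 1 / 2"
begin

lemmas g_int = integrable_scaled_remainder[OF s]
  and g_bound = abs_scaled_remainder_le_1[OF s]

lemmas corr_eq = correlation_eq[OF g_int g_bound]
  and corr_le = abs_correlation_le[OF g_int g_bound]

lemma increment_measurable: "increment (scaled_remainder s) \<in> borel_measurable borel"
proof -
  have "increment (scaled_remainder s) = (\<lambda>v. 2 * (correlation (scaled_remainder s) 0 - correlation (scaled_remainder s) v))"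
  proof
    show "increment (scaled_remainder s) v = 2 * (correlation (scaled_remainder s) 0 - correlation (scaled_remainder s) v)" for v
      unfolding corr_eq[of v] by simp
  qed
  then show ?thesis
    using borel_measurable_integrable[OF integrable_correlation[OF g_int g_bound]] by simp
qed

text \<open>Beyond \<open>\<bar>v\<bar> = 1\<close> the bound \<open>4 * C0\<close> by the
  autocorrelation at 0 suffices. A homogeneous bound for all \<open>v\<close> is wanted because it
  remains uniform after the rescaling \<open>v = h * z\<close>.\<close>

lemma increment_le_powr:
  obtains K where "K \<ge> 0" "\<And>v. increment (scaled_remainder s) v \<le> K * \<bar>v\<bar> powr (2 * s)"
proof -
  define C0 where "C0 = correlation (scaled_remainder s) 0"
  obtain K where K: "K \<ge> 0" "\<And>v. 0 < v \<Longrightarrow> v \<le> 1 \<Longrightarrow> v powr (- 2 * s) * increment (scaled_remainder s) v \<le> K"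
    using increment_bounded[OF s] by blast
  have C0: "C0 \<ge> 0" using corr_le[of 0] unfolding C0_def by linarith
  have le: "increment (scaled_remainder s) v \<le> 4 * C0" for v
    using corr_eq[of v] corr_le[of v] unfolding C0_def by linarith
  show ?thesis
  proof (rule that[of "K + 4 * C0"])
    fix v
    have "increment (scaled_remainder s) \<bar>v\<bar> \<le> (K + 4 * C0) * \<bar>v\<bar> powr (2 * s)"
    proof (cases "v = 0")
      case True
      then show ?thesis by (simp add: increment_0)
    next
      case False
      show ?thesis
      proof (cases "\<bar>v\<bar> \<le> 1")
        case True
        have "increment (scaled_remainder s) \<bar>v\<bar> = \<bar>v\<bar> powr (- 2 * s) * increment (scaled_remainder s) \<bar>v\<bar> * \<bar>v\<bar> powr (2 * s)"
          using False by (simp add: powr_minus field_simps)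
        also have "\<dots> \<le> K * \<bar>v\<bar> powr (2 * s)"
          using K(2)[of "\<bar>v\<bar>"] True False by (intro mult_right_mono) auto
        also have "\<dots> \<le> (K + 4 * C0) * \<bar>v\<bar> powr (2 * s)" using C0 by (intro mult_right_mono) auto
        finally show ?thesis .
      next
        case large: False
        have "increment (scaled_remainder s) \<bar>v\<bar> \<le> (K + 4 * C0) * 1" using le[of "\<bar>v\<bar>"] K by simp
        also have "\<dots> \<le> (K + 4 * C0) * \<bar>v\<bar> powr (2 * s)"
          using large s K C0 by (intro mult_left_mono ge_one_powr_ge_zero) auto
        finally show ?thesis .
      qed
    qed
    then show "increment (scaled_remainder s) v \<le> (K + 4 * C0) * \<bar>v\<bar> powr (2 * s)"
      by (simp add: increment_abs)
  qed (use K C0 in simp)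
qed

lemma integrable_increment_weight:
  assumes h: "h > 0"
  shows "integrable lborel (\<lambda>z. std_normal_density z * (z\<^sup>2 - 1) * increment (scaled_remainder s) (h * z))"
proof -
  note [measurable] = increment_measurable
  obtain K where K: "K \<ge> 0" "\<And>v. increment (scaled_remainder s) v \<le> K * \<bar>v\<bar> powr (2 * s)"
    using increment_le_powr by blast
  show ?thesis
  proof (rule Bochner_Integration.integrable_bound[OF integrable_gauss_moment_majorant[of "K * h powr (2 * s)"]])
    have "increment (scaled_remainder s) (h * z) \<le> K * h powr (2 * s) * \<bar>z\<bar> powr (2 * s)" for z
      using K(2)[of "h * z"] h by (simp add: abs_mult powr_mult mult_ac)
    then show "AE z in lborel. norm (std_normal_density z * (z\<^sup>2 - 1) * increment (scaled_remainder s) (h * z)) \<le>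
      norm (std_normal_density z * (z\<^sup>2 + 1) * (K * h powr (2 * s) * (1 + \<bar>z\<bar>)))"
      unfolding real_norm_def
      by (intro AE_I2 order_trans[OF _ abs_ge_self] abs_gauss_weight_le[OF s] increment_nonneg mult_nonneg_nonneg powr_ge_zero K)
  qed measurable
qed

text \<open>This is \<open>J h\<close> of the overview.\<close>

definition mean_square :: "real \<Rightarrow> real"
  where "mean_square h = (\<integral>t. (norm (dirichlet_f (Complex s t)))\<^sup>2 * exp (- (h * t)\<^sup>2 / 2) \<partial>lborel)"

context
  fixes h :: "nat \<Rightarrow> real" and e :: "real \<Rightarrow> real"
  assumes h: "\<And>j. 0 < h j" "h \<longlonglongrightarrow> 0"
    and e_meas: "e \<in> borel_measurable borel"
    and e_periodic: "\<And>x. e (x + 2) = e x"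
    and e_cont: "\<And>x. x \<notin> \<int> \<Longrightarrow> isCont e x"
    and agree: "\<And>p q z. 0 < p \<Longrightarrow> 0 < z \<Longrightarrow>
      \<forall>\<^sub>F j in sequentially. \<forall>x. p \<le> x * (h j * z) \<and> x * (h j * z) \<le> q \<longrightarrow> remainder x = e x"
begin

text \<open>The limit theorem for increments is applied to \<open>h j * \<bar>z\<bar>\<close>, with
  indices shifted to keep it below 1; evenness of the increment removes the sign of
  \<open>z\<close>.\<close>

lemma increment_along_tendsto:
  "(\<lambda>j. h j powr (- 2 * s) * increment (scaled_remainder s) (h j * z)) \<longlonglongrightarrow>
    \<bar>z\<bar> powr (2 * s) * enn2real (increment_constant s e)"
proof (cases "z = 0")
  case True
  then show ?thesis by (simp add: increment_0)
next
  case False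
  then have z: "\<bar>z\<bar> > 0" by simp
  have lim: "(\<lambda>j. h j * \<bar>z\<bar>) \<longlonglongrightarrow> 0"
    using tendsto_mult[OF h(2) tendsto_const] by simp
  then obtain j0 where j0: "\<And>j. j \<ge> j0 \<Longrightarrow> h j * \<bar>z\<bar> < 1"
    using order_tendstoD(2)[OF lim, of 1] unfolding eventually_sequentially by auto
  define v where "v j = h (j + j0) * \<bar>z\<bar>" for j
  have "(\<lambda>j. v j powr (- 2 * s) * increment (scaled_remainder s) (v j)) \<longlonglongrightarrow> enn2real (increment_constant s e)"
  proof (rule increment_tendsto[OF s])
    show "0 < v j" "v j \<le> 1" for j using h(1) z j0[of "j + j0"] by (auto simp: v_def)
    show "v \<longlonglongrightarrow> 0" unfolding v_def[abs_def] by (rule LIMSEQ_ignore_initial_segment[OF lim])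
    show "\<forall>\<^sub>F j in sequentially. \<forall>x. p \<le> x * v j \<and> x * v j \<le> q \<longrightarrow> remainder x = e x" if "0 < p" for p q
      using agree[OF that z, of q]
      unfolding v_def eventually_sequentially_seg[of "\<lambda>j. \<forall>x. p \<le> x * (h j * \<bar>z\<bar>) \<and> x * (h j * \<bar>z\<bar>) \<le> q \<longrightarrow> remainder x = e x"] .
  qed (fact e_meas e_periodic e_cont)+
  then have "(\<lambda>j. \<bar>z\<bar> powr (2 * s) * (v j powr (- 2 * s) * increment (scaled_remainder s) (v j))) \<longlonglongrightarrow>
    \<bar>z\<bar> powr (2 * s) * enn2real (increment_constant s e)"
    by (rule tendsto_mult_left)
  moreover have "\<bar>z\<bar> powr (2 * s) * (v j powr (- 2 * s) * increment (scaled_remainder s) (v j)) =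
    h (j + j0) powr (- 2 * s) * increment (scaled_remainder s) (h (j + j0) * z)" for j
  proof -
    have "\<bar>z\<bar> powr (2 * s) * v j powr (- 2 * s) = h (j + j0) powr (- 2 * s)"
      using z h(1)[of "j + j0"] by (simp add: v_def powr_mult powr_minus field_simps)
    moreover have "increment (scaled_remainder s) (v j) = increment (scaled_remainder s) (h (j + j0) * z)"
      using increment_abs[of "scaled_remainder s" "h (j + j0) * z"] h(1)[of "j + j0"] by (simp add: v_def abs_mult)
    ultimately show ?thesis by (simp add: mult.assoc[symmetric])
  qed
  ultimately have "(\<lambda>j. h (j + j0) powr (- 2 * s) * increment (scaled_remainder s) (h (j + j0) * z)) \<longlonglongrightarrow>
    \<bar>z\<bar> powr (2 * s) * enn2real (increment_constant s e)"
    by (simp only:)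
  then show ?thesis
    by (rule LIMSEQ_offset[where f = "\<lambda>j. h j powr (- 2 * s) * increment (scaled_remainder s) (h j * z)"])
qed

text \<open>The power splits into the \<open>h\<^sup>2\<close> of \<open>gauss_mean_square\<close>
  and the \<open>h powr (- 2 * s)\<close> that normalises increments. The correlation term is
  bounded and keeps the full factor \<open>h powr (2 - 2 * s)\<close>, so it vanishes.\<close>

lemma mean_square_tendsto:
  "(\<lambda>j. h j powr (2 - 2 * s) * mean_square (h j)) \<longlonglongrightarrow> pi * (gauss_moment s * enn2real (increment_constant s e))"
proof -
  let ?q = "increment (scaled_remainder s)"
  note [measurable] = increment_measurable
  obtain K where K: "K \<ge> 0" "\<And>v. ?q v \<le> K * \<bar>v\<bar> powr (2 * s)"
    using increment_le_powr by blast
  have K_h: "h j powr (- 2 * s) * ?q (h j * z) \<le> K * \<bar>z\<bar> powr (2 * s)" for j z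
  proof -
    have "h j powr (- 2 * s) * ?q (h j * z) \<le> h j powr (- 2 * s) * (K * \<bar>h j * z\<bar> powr (2 * s))"
      by (intro mult_left_mono K) auto
    also have "\<dots> = K * \<bar>z\<bar> powr (2 * s)"
      using h(1)[of j] by (simp add: abs_mult powr_mult powr_minus field_simps)
    finally show ?thesis .
  qed
  have lim: "(\<lambda>j. \<integral>z. std_normal_density z * (z\<^sup>2 - 1) * (h j powr (- 2 * s) * ?q (h j * z)) \<partial>lborel) \<longlonglongrightarrow>
      (\<integral>z. std_normal_density z * (z\<^sup>2 - 1) * (\<bar>z\<bar> powr (2 * s) * enn2real (increment_constant s e)) \<partial>lborel)"
  proof (rule integral_dominated_convergence)
    show "integrable lborel (\<lambda>z. std_normal_density z * (z\<^sup>2 + 1) * (K * (1 + \<bar>z\<bar>)))"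
      by (rule integrable_gauss_moment_majorant)
    show "AE z in lborel. (\<lambda>j. std_normal_density z * (z\<^sup>2 - 1) * (h j powr (- 2 * s) * ?q (h j * z))) \<longlonglongrightarrow>
      std_normal_density z * (z\<^sup>2 - 1) * (\<bar>z\<bar> powr (2 * s) * enn2real (increment_constant s e))"
      by (intro AE_I2 tendsto_mult_left increment_along_tendsto)
    show "AE z in lborel. norm (std_normal_density z * (z\<^sup>2 - 1) * (h j powr (- 2 * s) * ?q (h j * z))) \<le>
      std_normal_density z * (z\<^sup>2 + 1) * (K * (1 + \<bar>z\<bar>))" for j
      unfolding real_norm_def
      by (intro AE_I2 abs_gauss_weight_le[OF s] mult_nonneg_nonneg increment_nonneg powr_ge_zero K_h K)
  qed measurable
  define X where "X j = (\<integral>z. std_normal_density z * correlation (scaled_remainder s) (h j * z) \<partial>lborel)" for j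
  have X_le: "\<bar>X j\<bar> \<le> correlation (scaled_remainder s) 0" for j
  proof -
    have d: "integrable lborel std_normal_density" "(\<integral>z. std_normal_density z \<partial>lborel) = 1"
      using integrable_std_normal_moment[of 0] integral_std_normal_moment_even[of 0] by auto
    have "\<bar>X j\<bar> \<le> (\<integral>z. std_normal_density z * correlation (scaled_remainder s) 0 \<partial>lborel)"
      unfolding X_def real_norm_def[symmetric]
    proof (rule Bochner_Integration.integral_norm_bound_integral)
      show i: "integrable lborel (\<lambda>z. std_normal_density z * correlation (scaled_remainder s) 0)"
        using d by simp
      have [measurable]: "correlation (scaled_remainder s) \<in> borel_measurable borel"
        using borel_measurable_integrable[OF integrable_correlation[OF g_int g_bound]] by simp
      show le: "norm (std_normal_density z * correlation (scaled_remainder s) (h j * z)) \<le>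
        std_normal_density z * correlation (scaled_remainder s) 0" for z
        using corr_le by (auto simp: abs_mult intro!: mult_left_mono)
      show "integrable lborel (\<lambda>z. std_normal_density z * correlation (scaled_remainder s) (h j * z))"
      proof (rule Bochner_Integration.integrable_bound[OF i])
        show "AE z in lborel. norm (std_normal_density z * correlation (scaled_remainder s) (h j * z)) \<le>
          norm (std_normal_density z * correlation (scaled_remainder s) 0)"
          using order_trans[OF le abs_ge_self] by (intro AE_I2) simp
      qed measurable
    qed
    then show ?thesis using d by simp
  qed
  have X_lim: "(\<lambda>j. h j powr (2 - 2 * s) * X j) \<longlonglongrightarrow> 0"
  proof (rule Lim_null_comparison)
    show "\<forall>\<^sub>F j in sequentially. norm (h j powr (2 - 2 * s) * X j) \<le> h j powr (2 - 2 * s) * correlation (scaled_remainder s) 0"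
      using X_le by (intro always_eventually) (auto simp: abs_mult intro!: mult_left_mono)
    have "(\<lambda>j. h j powr (2 - 2 * s)) \<longlonglongrightarrow> 0 powr (2 - 2 * s)"
      using s h by (intro tendsto_powr2) (auto intro!: always_eventually less_imp_le)
    then have "(\<lambda>j. h j powr (2 - 2 * s)) \<longlonglongrightarrow> 0" by simp
    from tendsto_mult_right[OF this] show "(\<lambda>j. h j powr (2 - 2 * s) * correlation (scaled_remainder s) 0) \<longlonglongrightarrow> 0"
      by simp
  qed
  have eq: "h j powr (2 - 2 * s) * mean_square (h j) = 2 * pi * s\<^sup>2 * (h j powr (2 - 2 * s) * X j) +
    pi * (\<integral>z. std_normal_density z * (z\<^sup>2 - 1) * (h j powr (- 2 * s) * ?q (h j * z)) \<partial>lborel)" for j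
  proof -
    have hp: "h j powr (2 - 2 * s) = h j powr (- 2 * s) * (h j)\<^sup>2"
      using h(1)[of j] by (simp add: powr_diff powr_minus field_simps)
    have ms: "mean_square (h j) = (\<integral>t. (s\<^sup>2 + t\<^sup>2) * exp (- (h j * t)\<^sup>2 / 2) *
        ((\<integral>u. scaled_remainder s u * cos (t * u) \<partial>lborel)\<^sup>2 + (\<integral>u. scaled_remainder s u * sin (t * u) \<partial>lborel)\<^sup>2) \<partial>lborel)"
      unfolding mean_square_def norm_dirichlet_f_square[OF s] by (simp add: mult_ac)
    have "h j powr (2 - 2 * s) * mean_square (h j) = h j powr (- 2 * s) * (2 * pi * s\<^sup>2 * (h j)\<^sup>2 * X j +
      pi * (\<integral>z. std_normal_density z * (z\<^sup>2 - 1) * ?q (h j * z) \<partial>lborel))"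
      unfolding hp ms X_def mult.assoc[of "h j powr _"]
      by (subst gauss_mean_square(2)[OF g_int g_bound h(1) integrable_increment_weight[OF h(1)]]) simp
    also have "\<dots> = 2 * pi * s\<^sup>2 * (h j powr (2 - 2 * s) * X j) +
      pi * (h j powr (- 2 * s) * (\<integral>z. std_normal_density z * (z\<^sup>2 - 1) * ?q (h j * z) \<partial>lborel))"
      unfolding hp by (simp add: algebra_simps)
    also have "h j powr (- 2 * s) * (\<integral>z. std_normal_density z * (z\<^sup>2 - 1) * ?q (h j * z) \<partial>lborel) =
      (\<integral>z. h j powr (- 2 * s) * (std_normal_density z * (z\<^sup>2 - 1) * ?q (h j * z)) \<partial>lborel)"
      by simp
    also have "\<dots> = (\<integral>z. std_normal_density z * (z\<^sup>2 - 1) * (h j powr (- 2 * s) * ?q (h j * z)) \<partial>lborel)"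
      by (simp add: mult_ac)
    finally show ?thesis .
  qed
  have "(\<lambda>j. h j powr (2 - 2 * s) * mean_square (h j)) \<longlonglongrightarrow> 2 * pi * s\<^sup>2 * 0 +
    pi * (\<integral>z. std_normal_density z * (z\<^sup>2 - 1) * (\<bar>z\<bar> powr (2 * s) * enn2real (increment_constant s e)) \<partial>lborel)"
    unfolding eq by (intro tendsto_add tendsto_mult_left X_lim lim)
  also have "(\<integral>z. std_normal_density z * (z\<^sup>2 - 1) * (\<bar>z\<bar> powr (2 * s) * enn2real (increment_constant s e)) \<partial>lborel) =
    gauss_moment s * enn2real (increment_constant s e)"
    by (simp add: gauss_moment_def mult.assoc[symmetric])
  finally show ?thesis by simp
qed

end

lemma continuous_on_dirichlet_f_line: "continuous_on UNIV (\<lambda>t. (norm (dirichlet_f (Complex s t)))\<^sup>2)"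
proof -
  have "continuous_on ({z. Re z > 0} - {1}) dirichlet_f"
    using is_continuation_dirichlet_f by (auto simp: is_continuation_def intro: holomorphic_on_imp_continuous_on)
  then have "continuous_on UNIV (\<lambda>t. dirichlet_f (Complex s t))"
    by (rule continuous_on_compose2) (use s in \<open>auto simp: complex_eq_iff intro!: continuous_intros\<close>)
  then show ?thesis by (intro continuous_intros)
qed

text \<open>The means of the theorem run over positive \<open>t\<close> only. Evenness in
  \<open>t\<close> is read off the formula with the squared cosine and sine transforms.\<close>

lemma mean_square_eq:
  assumes h: "h > 0"
  shows "mean_square h = 2 * (\<integral>t. indicator {0..} t * ((norm (dirichlet_f (Complex s t)))\<^sup>2 * exp (- (h * t)\<^sup>2 / 2)) \<partial>lborel)"
proof -
  define F where "F t = (norm (dirichlet_f (Complex s t)))\<^sup>2 * exp (- (h * t)\<^sup>2 / 2)" for t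
  have even: "F (- t) = F t" for t
    by (simp add: F_def norm_dirichlet_f_square[OF s])
  have "integrable lborel F"
    using gauss_mean_square(1)[OF g_int g_bound h integrable_increment_weight[OF h], of s]
    by (simp add: F_def[abs_def] norm_dirichlet_f_square[OF s] mult_ac)
  then have "integrable lborel (\<lambda>t. indicator {0..} t *\<^sub>R F t)"
    by (intro integrable_mult_indicator) auto
  then have "has_bochner_integral lborel (\<lambda>t. indicator {0..} t *\<^sub>R F t) (\<integral>t. indicator {0..} t *\<^sub>R F t \<partial>lborel)"
    by (rule has_bochner_integral_integrable)
  from has_bochner_integral_even_function[OF this even] show ?thesis
    by (simp add: mean_square_def F_def has_bochner_integral_iff)
qed

end

text \<open>The ratio exceeds 1 since \<open>2 powr (- 2 * s)\<close> is above 1/2. Finiteness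
  matters because \<open>enn2real\<close> sends infinity to 0, which would make both sides
  equal.\<close>

lemma increment_constants_differ:
  assumes s: "0 < s" "s < 1 / 2" and fin: "increment_constant s saw1 < \<infinity>"
  shows "enn2real (increment_constant s saw2) \<noteq> enn2real (increment_constant s saw1)"
proof -
  define G where "G = enn2real (increment_constant s saw1)"
  have "G > 0"
    using increment_constant_saw1_pos[OF s(1)] fin by (simp add: G_def enn2real_positive_iff)
  moreover have "enn2real (increment_constant s saw2) = 4 * 2 powr (- 2 * s) * G"
    unfolding increment_constant_saw2 G_def by (simp add: enn2real_mult)
  moreover have "2 powr (- 1) < (2 powr (- 2 * s) :: real)"
    using s by (intro powr_less_mono) auto
  then have "4 * 2 powr (- 2 * s) > (1 :: real)" by (simp add: powr_minus)
  ultimately show ?thesis unfolding G_def[symmetric] by auto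
qed

theorem proposition4p4:
  fixes \<sigma> :: real
  assumes "0 < \<sigma>" and "\<sigma> < 1 / 2"
  shows "\<not> (\<exists>L :: real.
    ((\<lambda>T :: real. 1 / T powr (2 - 2 * \<sigma>) *
        integral {0..T} (\<lambda>t. (norm (dirichlet_f (Complex \<sigma> t)))\<^sup>2)) \<longlongrightarrow> L) at_top)"
proof
  assume "\<exists>L :: real.
    ((\<lambda>T :: real. 1 / T powr (2 - 2 * \<sigma>) *
        integral {0..T} (\<lambda>t. (norm (dirichlet_f (Complex \<sigma> t)))\<^sup>2)) \<longlongrightarrow> L) at_top"
  then obtain L where L: "((\<lambda>T :: real. 1 / T powr (2 - 2 * \<sigma>) *
        integral {0..T} (\<lambda>t. (norm (dirichlet_f (Complex \<sigma> t)))\<^sup>2)) \<longlongrightarrow> L) at_top" by blast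
  define c where "c = (\<integral>x. indicator {0..} x * (x * exp (- x\<^sup>2 / 2)) * (L * x powr (2 - 2 * \<sigma>)) \<partial>lborel)"
  \<comment> \<open>The exponent 3 places \<open>1 / h k\<close> between
    \<open>M (k + 1) = M k ^ 2\<close> and \<open>M (k + 2) = M k ^ 4\<close>, far from
    both.\<close>
  define h where "h k = 1 / real (M k) ^ 3" for k
  have h_pos: "h k > 0" for k by (simp add: h_def M_def)
  have h_lim: "(\<lambda>j. h (k j)) \<longlonglongrightarrow> 0" if k: "\<And>j. j \<le> k j" for k :: "nat \<Rightarrow> nat"
  proof (rule tendsto_sandwich[OF always_eventually always_eventually tendsto_const LIMSEQ_inverse_real_of_nat])
    show "\<forall>j. h (k j) \<le> inverse (real (Suc j))"
    proof
      fix j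
      have "Suc j \<le> M (k j)"
        using k[of j] unfolding M_def by (meson Suc_leI less_exp order.strict_trans1 order.strict_trans)
      then have "real (Suc j) \<le> real (M (k j))" by simp
      also have "\<dots> \<le> real (M (k j)) ^ 3" by (rule self_le_power) (auto simp: M_def)
      finally show "h (k j) \<le> inverse (real (Suc j))"
        by (simp add: h_def inverse_eq_divide frac_le)
    qed
    show "\<forall>j. 0 \<le> h (k j)" using h_pos less_imp_le by blast
  qed
  \<comment> \<open>Under the assumed convergence the limit \<open>2 * c\<close> is the same for
    every choice of indices \<open>k\<close>.\<close>
  have abel: "(\<lambda>j. h (k j) powr (2 - 2 * \<sigma>) * mean_square \<sigma> (h (k j))) \<longlonglongrightarrow> 2 * c"
    if k: "\<And>j. j \<le> k j" for k :: "nat \<Rightarrow> nat"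
  proof -
    have "(\<lambda>j. 2 * (h (k j) powr (2 - 2 * \<sigma>) * (\<integral>t. indicator {0..} t * ((norm (dirichlet_f (Complex \<sigma> t)))\<^sup>2 * exp (- (h (k j) * t)\<^sup>2 / 2)) \<partial>lborel))) \<longlonglongrightarrow> 2 * c"
      unfolding c_def using assms h_pos
      by (intro tendsto_mult_left gauss_average_tendsto L h_lim k continuous_on_dirichlet_f_line) auto
    then show ?thesis
      unfolding mean_square_eq[OF assms h_pos] by (simp add: mult_ac)
  qed
  \<comment> \<open>Even indices lead to plain blocks, odd ones to alternating blocks.\<close>
  have agree1: "\<forall>\<^sub>F j in sequentially. \<forall>x. p \<le> x * (h (2 * j) * z) \<and> x * (h (2 * j) * z) \<le> q \<longrightarrow> remainder x = saw1 x"
    if "0 < p" "0 < z" for p q z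
    unfolding h_def using that by (intro block_agree remainder_plain_block) auto
  have agree2: "\<forall>\<^sub>F j in sequentially. \<forall>x. p \<le> x * (h (2 * j + 1) * z) \<and> x * (h (2 * j + 1) * z) \<le> q \<longrightarrow> remainder x = saw2 x"
    if "0 < p" "0 < z" for p q z
    unfolding h_def using that by (intro block_agree remainder_alternating_block) (auto simp: eval_nat_numeral)
  have "2 * c = pi * (gauss_moment \<sigma> * enn2real (increment_constant \<sigma> saw1))"
    by (rule LIMSEQ_unique[OF abel mean_square_tendsto[OF assms h_pos h_lim saw_measurable(1) saw1_periodic2 isCont_saw1 agree1]]) auto
  moreover have "2 * c = pi * (gauss_moment \<sigma> * enn2real (increment_constant \<sigma> saw2))"
    by (rule LIMSEQ_unique[OF abel mean_square_tendsto[OF assms h_pos h_lim saw_measurable(2) saw2_periodic2 isCont_saw2 agree2]]) auto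
  ultimately have "enn2real (increment_constant \<sigma> saw2) = enn2real (increment_constant \<sigma> saw1)"
    using gauss_moment_nonzero[OF assms] by simp
  moreover have "increment_constant \<sigma> saw1 < \<infinity>"
  proof (rule increment_constant_finite[OF assms _ _ _ saw_measurable(1) saw1_periodic2 isCont_saw1])
    show "0 < h (2 * j)" "h (2 * j) \<le> 1" for j
      using h_pos by (auto simp: h_def M_def)
    show "(\<lambda>j. h (2 * j)) \<longlonglongrightarrow> 0" by (rule h_lim) simp
    show "\<forall>\<^sub>F j in sequentially. \<forall>x. p \<le> x * h (2 * j) \<and> x * h (2 * j) \<le> q \<longrightarrow> remainder x = saw1 x" if "0 < p" for p q
      using agree1[OF that, of 1 q] by simp
  qed
  ultimately show False using increment_constants_differ[OF assms] by blast
qed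

end
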